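(* (i) Let $(M,J,\nabla)$ be a simply connected special complex manifold of complex dimension $n$. Then there exists a holomorphic totally complex immersion $\phi : M \to V = T^*\mathbb{C}^n$ inducing the connection $\nabla$ on $M$. Moreover, $\phi$ is unique up to an affine transformation of $V$ preserving the real structure $\tau$, where $\tau$ is considered as a (constant) field of antilinear involutions on the tangent spaces of $V$. Finally, $\omega = 2\phi^*(\sum_{i=1}^n dx^i\wedge dy_i)$ is a $\nabla$-parallel symplectic structure defining on $(M,J,\nabla)$ the structure of a special symplectic manifold. (ii) Let $(M,J,\nabla,\omega)$ be a simply connected special symplectic manifold of complex dimension $n$. Then there exists a holomorphic totally complex immersion $\phi : M \to V = T^*\mathbb{C}^n$ inducing the connection $\nabla$ and the symplectic form $\omega$ on $M$. Moreover, $\phi$ is unique up to an affine transformation of $V$ preserving the complex symplectic form $\Omega$ and the real structure $\tau$ (considered as a field of antilinear involutions on the tangent spaces of $V$). (iii) Let $(M,J,\nabla,\omega)$ be a simply connected special Kähler manifold of complex dimension $n$ with special Kähler metric $g$. Then there exists a holomorphic nondegenerate Lagrangian (and hence totally complex) immersion $\phi : M \to V = T^*\mathbb{C}^n$ inducing the Kähler metric $g$, the connection $\nabla$ and the symplectic form $\omega = 2\phi^*(\sum_{i=1}^n dx^i\wedge dy_i) = g(\cdot,J\cdot)$ on $M$. Moreover, $\phi$ is unique up to an affine transformation of $V$ preserving the complex symplectic form $\Omega$ and the real structure $\tau$ (considered as a field of antilinear involutions on the tangent spaces of $V$).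
   Context: Metrics, in particular Kähler metrics, are allowed to be indefinite. A special complex manifold $(M,J,\nabla)$ is a complex manifold $(M,J)$ together with a flat torsionfree connection $\nabla$ on its real tangent bundle such that $d^\nabla J=0$, i.e. $(\nabla_XJ)Y=(\nabla_YJ)X$ for all $X,Y$. A special symplectic manifold $(M,J,\nabla,\omega)$ is a special complex manifold together with a $\nabla$-parallel symplectic form $\omega$. A special Kähler manifold is a special symplectic manifold $(M,J,\nabla,\omega)$ with $\omega$ $J$-invariant (of type $(1,1)$); its special Kähler metric is $g(\cdot,\cdot)=\omega(J\cdot,\cdot)$. $V=T^*\mathbb{C}^n=\mathbb{C}^{2n}$ has canonical coordinates $(z^1,\dots,z^n,w_1,\dots,w_n)$, standard complex symplectic form $\Omega=\sum_{i=1}^n dz^i\wedge dw_i$, standard real structure $\tau:V\to V$ (complex conjugation) with fixed point set $V^\tau=T^*\mathbb{R}^n=\mathbb{R}^{2n}$, and Hermitian form $\gamma=\sqrt{-1}\,\Omega(\cdot,\tau\cdot)$. Put $x^i=\mathrm{Re}\,z^i$, $y_i=\mathrm{Re}\,w_i$. A holomorphic immersion $\phi:M\to V$ of a connected complex $n$-fold is called nondegenerate if $\phi^*\gamma$ is nondegenerate; Lagrangian if $\phi^*\Omega=0$; totally complex if $V^\tau\cap d\phi(T_pM)=0$ for all $p\in M$. A nondegenerate $\phi$ induces the (possibly indefinite) Kähler metric $g=\mathrm{Re}\,\phi^*\gamma$ on $M$. If $\phi$ is totally complex, the pulled back functions $x^i\circ\phi,\ y_j\circ\phi$ are local coordinates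 around each point of $M$; the induced connection $\nabla$ is the flat torsionfree connection for which these functions are affine ($\nabla d(x^i\circ\phi)=\nabla d(y_j\circ\phi)=0$), and the induced symplectic form is $\omega=2\phi^*(\sum dx^i\wedge dy_i)$. A holomorphic Lagrangian immersion is nondegenerate if and only if it is totally complex. *)

theory Defs
  imports "HOL-Analysis.Analysis"
begin

section \<open>Smooth and holomorphic maps between vector spaces\<close>

text \<open>Applied to open \<open>S\<close> of a finite-dimensional space, where \<open>C_k_on\<close> is \<open>C^k\<close> regularity.\<close>

primrec C_k_on :: "nat \<Rightarrow> 'a::real_normed_vector set \<Rightarrow> ('a \<Rightarrow> 'b::real_normed_vector) \<Rightarrow> bool" where
  "C_k_on 0 S f \<longleftrightarrow> continuous_on S f"
| "C_k_on (Suc k) S f \<longleftrightarrow>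
     (\<forall>x\<in>S. f differentiable (at x)) \<and> (\<forall>v. C_k_on k S (\<lambda>x. frechet_derivative f (at x) v))"

definition smooth_on :: "'a::real_normed_vector set \<Rightarrow> ('a \<Rightarrow> 'b::real_normed_vector) \<Rightarrow> bool" where
  "smooth_on S f \<longleftrightarrow> (\<forall>k. C_k_on k S f)"

definition cvec_holomorphic_on ::
    "(complex ^ 'n) set \<Rightarrow> (complex ^ 'n \<Rightarrow> complex ^ 'k) \<Rightarrow> bool" where
  "cvec_holomorphic_on S f \<longleftrightarrow>
     (\<forall>z\<in>S. \<exists>L. (f has_derivative L) (at z) \<and> (\<forall>c v. L (c *s v) = c *s L v))"


section \<open>Complex manifolds\<close>

text \<open>A chart is its domain together with the coordinate map, whose values off the domain
  are irrelevant.\<close>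

type_synonym ('m, 'n) chart = "'m set \<times> ('m \<Rightarrow> complex ^ 'n)"

definition inv_chart :: "('m, 'n) chart \<Rightarrow> complex ^ 'n \<Rightarrow> 'm" where
  "inv_chart c = inv_into (fst c) (snd c)"

definition complex_manifold ::
    "('m::{t2_space, second_countable_topology}, 'n::finite) chart set \<Rightarrow> bool" where
  "complex_manifold A \<longleftrightarrow>
     (\<Union>c\<in>A. fst c) = UNIV \<and>
     (\<forall>c\<in>A. open (fst c) \<and> open (snd c ` fst c) \<and>
        homeomorphism (fst c) (snd c ` fst c) (snd c) (inv_chart c)) \<and>
     (\<forall>c\<in>A. \<forall>d\<in>A. cvec_holomorphic_on (snd c ` (fst c \<inter> fst d)) (snd d \<circ> inv_chart c))"

definition smooth_map_on ::
    "('m::topological_space, 'n::finite) chart set \<Rightarrow> 'm set \<Rightarrow> ('m \<Rightarrow> 'b::real_normed_vector) \<Rightarrow> bool"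
where
  "smooth_map_on A U f \<longleftrightarrow> (\<forall>c\<in>A. smooth_on (snd c ` (fst c \<inter> U)) (f \<circ> inv_chart c))"

definition holomorphic_map ::
    "('m::topological_space, 'n::finite) chart set \<Rightarrow> ('m \<Rightarrow> complex ^ 'k) \<Rightarrow> bool" where
  "holomorphic_map A f \<longleftrightarrow> (\<forall>c\<in>A. cvec_holomorphic_on (snd c ` fst c) (f \<circ> inv_chart c))"

text \<open>
  The real tangent space \<open>T_p M\<close> is modelled by the type \<open>complex ^ 'n\<close>: a tangent vector at \<open>p\<close> is
  given by its coordinates in the chart \<open>chart_at A p\<close> selected at \<open>p\<close>.  This selection is arbitrary
  and not continuous in \<open>p\<close>, so every condition on how an object varies with \<open>p\<close> has to be
  formulated through a fixed chart \<open>c\<close>: \<open>differential A (snd c) p v\<close> are the coordinates in \<open>c\<close> of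
  the vector \<open>v\<close> of \<open>T_p M\<close>.
\<close>

definition chart_at :: "('m, 'n) chart set \<Rightarrow> 'm \<Rightarrow> ('m, 'n) chart" where
  "chart_at A p = (SOME c. c \<in> A \<and> p \<in> fst c)"

definition differential ::
    "('m, 'n::finite) chart set \<Rightarrow> ('m \<Rightarrow> 'b::real_normed_vector) \<Rightarrow> 'm \<Rightarrow> complex ^ 'n \<Rightarrow> 'b" where
  "differential A f p v =
     (let c = chart_at A p in frechet_derivative (f \<circ> inv_chart c) (at (snd c p)) v)"

definition immersion ::
    "('m, 'n::finite) chart set \<Rightarrow> ('m \<Rightarrow> 'b::real_normed_vector) \<Rightarrow> bool" where
  "immersion A f \<longleftrightarrow> (\<forall>p. inj (differential A f p))"

text \<open>The complex structure on \<open>T_p M\<close>; its expression is the same in every chart because the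
  transition maps are holomorphic.\<close>

definition J :: "complex ^ 'n \<Rightarrow> complex ^ 'n" where
  "J v = \<i> *s v"

definition vector_field_on ::
    "('m::topological_space, 'n::finite) chart set \<Rightarrow> 'm set \<Rightarrow> ('m \<Rightarrow> complex ^ 'n) \<Rightarrow> bool" where
  "vector_field_on A U X \<longleftrightarrow>
     (\<forall>c\<in>A. smooth_on (snd c ` (fst c \<inter> U)) ((\<lambda>p. differential A (snd c) p (X p)) \<circ> inv_chart c))"

definition deriv_along ::
    "('m, 'n::finite) chart set \<Rightarrow> ('m \<Rightarrow> complex ^ 'n) \<Rightarrow> ('m \<Rightarrow> 'b::real_normed_vector) \<Rightarrow> 'm \<Rightarrow> 'b"
where
  "deriv_along A X f p = differential A f p (X p)"

text \<open>In coordinates, \<open>[X,Y]\<close> is the derivative of the components of \<open>Y\<close> along \<open>X\<close> minus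
  that of the components of \<open>X\<close> along \<open>Y\<close>.\<close>

definition lie_bracket ::
    "('m, 'n::finite) chart set \<Rightarrow> ('m \<Rightarrow> complex ^ 'n) \<Rightarrow> ('m \<Rightarrow> complex ^ 'n) \<Rightarrow> 'm \<Rightarrow> complex ^ 'n"
where
  "lie_bracket A X Y p =
     (let x = snd (chart_at A p)
      in deriv_along A X (deriv_along A Y x) p - deriv_along A Y (deriv_along A X x) p)"


section \<open>Connections on the real tangent bundle\<close>

text \<open>\<open>D p v Y\<close> is the covariant derivative at \<open>p\<close> of the local vector field \<open>Y\<close> in direction
  \<open>v\<close>.  The values of \<open>D\<close> on fields that are not smooth near \<open>p\<close> are junk and never used.\<close>

type_synonym ('m, 'n) conn =
  "'m \<Rightarrow> complex ^ 'n \<Rightarrow> ('m \<Rightarrow> complex ^ 'n) \<Rightarrow> complex ^ 'n"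

definition cov_deriv ::
    "('m, 'n) conn \<Rightarrow> ('m \<Rightarrow> complex ^ 'n) \<Rightarrow> ('m \<Rightarrow> complex ^ 'n) \<Rightarrow> 'm \<Rightarrow> complex ^ 'n" where
  "cov_deriv D X Y p = D p (X p) Y"

definition connection ::
    "('m::topological_space, 'n::finite) chart set \<Rightarrow> ('m, 'n) conn \<Rightarrow> bool" where
  "connection A D \<longleftrightarrow>
     (\<forall>U Y. open U \<longrightarrow> vector_field_on A U Y \<longrightarrow>
        (\<forall>p\<in>U. linear (\<lambda>v. D p v Y)) \<and>
        (\<forall>Z. vector_field_on A U Z \<longrightarrow> (\<forall>q\<in>U. Y q = Z q) \<longrightarrow> (\<forall>p\<in>U. \<forall>v. D p v Y = D p v Z)) \<and>
        (\<forall>Z. vector_field_on A U Z \<longrightarrow>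
           (\<forall>p\<in>U. \<forall>v. D p v (\<lambda>q. Y q + Z q) = D p v Y + D p v Z)) \<and>
        (\<forall>f::'m \<Rightarrow> real. smooth_map_on A U f \<longrightarrow>
           (\<forall>p\<in>U. \<forall>v. D p v (\<lambda>q. f q *\<^sub>R Y q) = differential A f p v *\<^sub>R Y p + f p *\<^sub>R D p v Y)) \<and>
        (\<forall>X. vector_field_on A U X \<longrightarrow> vector_field_on A U (cov_deriv D X Y)))"

definition torsion_free ::
    "('m::topological_space, 'n::finite) chart set \<Rightarrow> ('m, 'n) conn \<Rightarrow> bool" where
  "torsion_free A D \<longleftrightarrow>
     (\<forall>U X Y. open U \<longrightarrow> vector_field_on A U X \<longrightarrow> vector_field_on A U Y \<longrightarrow>
        (\<forall>p\<in>U. cov_deriv D X Y p - cov_deriv D Y X p - lie_bracket A X Y p = 0))"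

definition flat :: "('m::topological_space, 'n::finite) chart set \<Rightarrow> ('m, 'n) conn \<Rightarrow> bool" where
  "flat A D \<longleftrightarrow>
     (\<forall>U X Y Z. open U \<longrightarrow> vector_field_on A U X \<longrightarrow> vector_field_on A U Y \<longrightarrow> vector_field_on A U Z \<longrightarrow>
        (\<forall>p\<in>U. cov_deriv D X (cov_deriv D Y Z) p - cov_deriv D Y (cov_deriv D X Z) p
                - cov_deriv D (lie_bracket A X Y) Z p = 0))"

definition cov_deriv_J ::
    "('m, 'n) conn \<Rightarrow> ('m \<Rightarrow> complex ^ 'n) \<Rightarrow> ('m \<Rightarrow> complex ^ 'n) \<Rightarrow> 'm \<Rightarrow> complex ^ 'n" where
  "cov_deriv_J D X Y p = cov_deriv D X (\<lambda>q. J (Y q)) p - J (cov_deriv D X Y p)"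

text \<open>\<open>(\<nabla>\<^sub>X \<alpha>) Y\<close> for a one-form \<open>\<alpha>\<close>\<close>

definition cov_deriv_form1 ::
    "('m, 'n::finite) chart set \<Rightarrow> ('m, 'n) conn \<Rightarrow> ('m \<Rightarrow> complex ^ 'n \<Rightarrow> real) \<Rightarrow>
     ('m \<Rightarrow> complex ^ 'n) \<Rightarrow> ('m \<Rightarrow> complex ^ 'n) \<Rightarrow> 'm \<Rightarrow> real" where
  "cov_deriv_form1 A D \<alpha> X Y p =
     deriv_along A X (\<lambda>q. \<alpha> q (Y q)) p - \<alpha> p (cov_deriv D X Y p)"

definition affine_function ::
    "('m::topological_space, 'n::finite) chart set \<Rightarrow> ('m, 'n) conn \<Rightarrow> ('m \<Rightarrow> real) \<Rightarrow> bool" where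
  "affine_function A D f \<longleftrightarrow>
     (\<forall>U X Y. open U \<longrightarrow> vector_field_on A U X \<longrightarrow> vector_field_on A U Y \<longrightarrow>
        (\<forall>p\<in>U. cov_deriv_form1 A D (differential A f) X Y p = 0))"


section \<open>Symplectic forms\<close>

type_synonym ('m, 'n) form2 = "'m \<Rightarrow> complex ^ 'n \<Rightarrow> complex ^ 'n \<Rightarrow> real"

definition smooth_form2 ::
    "('m::topological_space, 'n::finite) chart set \<Rightarrow> ('m, 'n) form2 \<Rightarrow> bool" where
  "smooth_form2 A \<omega> \<longleftrightarrow>
     (\<forall>p. bilinear (\<omega> p) \<and> (\<forall>v. \<omega> p v v = 0)) \<and>
     (\<forall>U X Y. open U \<longrightarrow> vector_field_on A U X \<longrightarrow> vector_field_on A U Y \<longrightarrow>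
        smooth_map_on A U (\<lambda>p. \<omega> p (X p) (Y p)))"

text \<open>The invariant formula for the exterior derivative: \<open>d\<omega>(X,Y,Z) = 0\<close>\<close>

definition closed_form2 ::
    "('m::topological_space, 'n::finite) chart set \<Rightarrow> ('m, 'n) form2 \<Rightarrow> bool" where
  "closed_form2 A \<omega> \<longleftrightarrow>
     (\<forall>U X Y Z. open U \<longrightarrow> vector_field_on A U X \<longrightarrow> vector_field_on A U Y \<longrightarrow> vector_field_on A U Z \<longrightarrow>
        (\<forall>p\<in>U. deriv_along A X (\<lambda>q. \<omega> q (Y q) (Z q)) p
                - deriv_along A Y (\<lambda>q. \<omega> q (X q) (Z q)) p
                + deriv_along A Z (\<lambda>q. \<omega> q (X q) (Y q)) p
                - \<omega> p (lie_bracket A X Y p) (Z p)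
                + \<omega> p (lie_bracket A X Z p) (Y p)
                - \<omega> p (lie_bracket A Y Z p) (X p) = 0))"

definition symplectic_form ::
    "('m::topological_space, 'n::finite) chart set \<Rightarrow> ('m, 'n) form2 \<Rightarrow> bool" where
  "symplectic_form A \<omega> \<longleftrightarrow>
     smooth_form2 A \<omega> \<and> closed_form2 A \<omega> \<and> (\<forall>p u. (\<forall>v. \<omega> p u v = 0) \<longrightarrow> u = 0)"

definition cov_deriv_form2 ::
    "('m, 'n::finite) chart set \<Rightarrow> ('m, 'n) conn \<Rightarrow> ('m, 'n) form2 \<Rightarrow>
     ('m \<Rightarrow> complex ^ 'n) \<Rightarrow> ('m \<Rightarrow> complex ^ 'n) \<Rightarrow> ('m \<Rightarrow> complex ^ 'n) \<Rightarrow> 'm \<Rightarrow> real" where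
  "cov_deriv_form2 A D \<omega> X Y Z p =
     deriv_along A X (\<lambda>q. \<omega> q (Y q) (Z q)) p
     - \<omega> p (cov_deriv D X Y p) (Z p) - \<omega> p (Y p) (cov_deriv D X Z p)"

definition parallel_form2 ::
    "('m::topological_space, 'n::finite) chart set \<Rightarrow> ('m, 'n) conn \<Rightarrow> ('m, 'n) form2 \<Rightarrow> bool" where
  "parallel_form2 A D \<omega> \<longleftrightarrow>
     (\<forall>U X Y Z. open U \<longrightarrow> vector_field_on A U X \<longrightarrow> vector_field_on A U Y \<longrightarrow> vector_field_on A U Z \<longrightarrow>
        (\<forall>p\<in>U. cov_deriv_form2 A D \<omega> X Y Z p = 0))"


section \<open>Special manifolds\<close>

definition special_complex_manifold ::
    "('m::{t2_space, second_countable_topology}, 'n::finite) chart set \<Rightarrow> ('m, 'n) conn \<Rightarrow> bool" where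
  "special_complex_manifold A D \<longleftrightarrow>
     complex_manifold A \<and> connection A D \<and> flat A D \<and> torsion_free A D \<and>
     (\<forall>U X Y. open U \<longrightarrow> vector_field_on A U X \<longrightarrow> vector_field_on A U Y \<longrightarrow>
        (\<forall>p\<in>U. cov_deriv_J D X Y p = cov_deriv_J D Y X p))"

definition special_symplectic_manifold ::
    "('m::{t2_space, second_countable_topology}, 'n::finite) chart set \<Rightarrow> ('m, 'n) conn \<Rightarrow>
     ('m, 'n) form2 \<Rightarrow> bool" where
  "special_symplectic_manifold A D \<omega> \<longleftrightarrow>
     special_complex_manifold A D \<and> symplectic_form A \<omega> \<and> parallel_form2 A D \<omega>"

definition special_kaehler_manifold ::
    "('m::{t2_space, second_countable_topology}, 'n::finite) chart set \<Rightarrow> ('m, 'n) conn \<Rightarrow>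
     ('m, 'n) form2 \<Rightarrow> bool" where
  "special_kaehler_manifold A D \<omega> \<longleftrightarrow>
     special_symplectic_manifold A D \<omega> \<and> (\<forall>p u v. \<omega> p (J u) (J v) = \<omega> p u v)"

definition special_kaehler_metric :: "('m, 'n) form2 \<Rightarrow> 'm \<Rightarrow> complex ^ 'n \<Rightarrow> complex ^ 'n \<Rightarrow> real" where
  "special_kaehler_metric \<omega> p u v = \<omega> p (J u) v"


section \<open>The space \<open>V = T\<^sup>*\<complex>\<^sup>n\<close> and immersions into it\<close>

text \<open>The components \<open>Inl i\<close> are the coordinates \<open>z^i\<close>, the components \<open>Inr i\<close> are the \<open>w_i\<close>.\<close>

type_synonym 'n cotangent = "complex ^ ('n + 'n)"

definition \<Omega> :: "'n::finite cotangent \<Rightarrow> 'n cotangent \<Rightarrow> complex" where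
  "\<Omega> u v = (\<Sum>i\<in>UNIV. u $ Inl i * v $ Inr i - v $ Inl i * u $ Inr i)"

definition \<tau> :: "'n::finite cotangent \<Rightarrow> 'n cotangent" where
  "\<tau> v = (\<chi> k. cnj (v $ k))"

definition \<gamma> :: "'n::finite cotangent \<Rightarrow> 'n cotangent \<Rightarrow> complex" where
  "\<gamma> u v = \<i> * \<Omega> u (\<tau> v)"

definition nondegenerate ::
    "('m, 'n::finite) chart set \<Rightarrow> ('m \<Rightarrow> 'n cotangent) \<Rightarrow> bool" where
  "nondegenerate A \<phi> \<longleftrightarrow>
     (\<forall>p u. (\<forall>v. \<gamma> (differential A \<phi> p u) (differential A \<phi> p v) = 0) \<longrightarrow> u = 0)"

definition lagrangian ::
    "('m, 'n::finite) chart set \<Rightarrow> ('m \<Rightarrow> 'n cotangent) \<Rightarrow> bool" where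
  "lagrangian A \<phi> \<longleftrightarrow> (\<forall>p u v. \<Omega> (differential A \<phi> p u) (differential A \<phi> p v) = 0)"

definition totally_complex ::
    "('m, 'n::finite) chart set \<Rightarrow> ('m \<Rightarrow> 'n cotangent) \<Rightarrow> bool" where
  "totally_complex A \<phi> \<longleftrightarrow> (\<forall>p. {v. \<tau> v = v} \<inter> range (differential A \<phi> p) = {0})"

definition induced_metric ::
    "('m, 'n::finite) chart set \<Rightarrow> ('m \<Rightarrow> 'n cotangent) \<Rightarrow> 'm \<Rightarrow> complex ^ 'n \<Rightarrow> complex ^ 'n \<Rightarrow> real"
where
  "induced_metric A \<phi> p u v = Re (\<gamma> (differential A \<phi> p u) (differential A \<phi> p v))"

definition x_coord :: "'n::finite \<Rightarrow> 'n cotangent \<Rightarrow> real" where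
  "x_coord i v = Re (v $ Inl i)"

definition y_coord :: "'n::finite \<Rightarrow> 'n cotangent \<Rightarrow> real" where
  "y_coord i v = Re (v $ Inr i)"

definition induces_connection ::
    "('m::topological_space, 'n::finite) chart set \<Rightarrow> ('m \<Rightarrow> 'n cotangent) \<Rightarrow> ('m, 'n) conn \<Rightarrow> bool" where
  "induces_connection A \<phi> D \<longleftrightarrow>
     connection A D \<and> flat A D \<and> torsion_free A D \<and>
     (\<forall>i. affine_function A D (x_coord i \<circ> \<phi>) \<and> affine_function A D (y_coord i \<circ> \<phi>))"

text \<open>\<open>2 \<phi>^* (\<Sum>i. dx^i \<and> dy_i)\<close>; the functions \<open>x^i\<close> and \<open>y_i\<close> are linear on \<open>V\<close> and so equal
  their differentials.\<close>

definition induced_form2 ::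
    "('m, 'n::finite) chart set \<Rightarrow> ('m \<Rightarrow> 'n cotangent) \<Rightarrow> ('m, 'n) form2" where
  "induced_form2 A \<phi> p u v =
     2 * (\<Sum>i\<in>UNIV. x_coord i (differential A \<phi> p u) * y_coord i (differential A \<phi> p v)
                  - x_coord i (differential A \<phi> p v) * y_coord i (differential A \<phi> p u))"


section \<open>Affine transformations of \<open>V\<close>\<close>

definition affine_transformation :: "(complex ^ 'k \<Rightarrow> complex ^ 'k::finite) \<Rightarrow> bool" where
  "affine_transformation F \<longleftrightarrow>
     (\<exists>(L :: complex ^ 'k ^ 'k) b. invertible L \<and> F = (\<lambda>v. L *v v + b))"

definition preserves_real_structure :: "('n::finite cotangent \<Rightarrow> 'n cotangent) \<Rightarrow> bool" where
  "preserves_real_structure F \<longleftrightarrow>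
     (\<forall>p u. frechet_derivative F (at p) (\<tau> u) = \<tau> (frechet_derivative F (at p) u))"

definition preserves_symplectic_form :: "('n::finite cotangent \<Rightarrow> 'n cotangent) \<Rightarrow> bool" where
  "preserves_symplectic_form F \<longleftrightarrow>
     (\<forall>p u v. \<Omega> (frechet_derivative F (at p) u) (frechet_derivative F (at p) v) = \<Omega> u v)"


section \<open>Realisations of special manifolds\<close>

definition special_complex_realisation ::
    "('m::topological_space, 'n::finite) chart set \<Rightarrow> ('m, 'n) conn \<Rightarrow> ('m \<Rightarrow> 'n cotangent) \<Rightarrow> bool" where
  "special_complex_realisation A D \<phi> \<longleftrightarrow>
     holomorphic_map A \<phi> \<and> immersion A \<phi> \<and> totally_complex A \<phi> \<and> induces_connection A \<phi> D"

definition special_symplectic_realisation ::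
    "('m::topological_space, 'n::finite) chart set \<Rightarrow> ('m, 'n) conn \<Rightarrow> ('m, 'n) form2 \<Rightarrow>
     ('m \<Rightarrow> 'n cotangent) \<Rightarrow> bool" where
  "special_symplectic_realisation A D \<omega> \<phi> \<longleftrightarrow>
     special_complex_realisation A D \<phi> \<and> \<omega> = induced_form2 A \<phi>"

definition special_kaehler_realisation ::
    "('m::topological_space, 'n::finite) chart set \<Rightarrow> ('m, 'n) conn \<Rightarrow> ('m, 'n) form2 \<Rightarrow>
     ('m \<Rightarrow> 'n cotangent) \<Rightarrow> bool" where
  "special_kaehler_realisation A D \<omega> \<phi> \<longleftrightarrow>
     holomorphic_map A \<phi> \<and> immersion A \<phi> \<and> nondegenerate A \<phi> \<and> lagrangian A \<phi> \<and>
     special_kaehler_metric \<omega> = induced_metric A \<phi> \<and> induces_connection A \<phi> D \<and>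
     \<omega> = induced_form2 A \<phi>"

end

theory Submission
  imports Defs "HOL-Complex_Analysis.Cauchy_Integral_Formula"
begin

text \<open>
  A parallel one-form \<open>\<alpha>\<close> is closed because \<open>\<nabla>\<close> is torsion-free, and \<open>\<alpha> \<circ> J\<close> is closed
  because \<open>d\<^sup>\<nabla>J = 0\<close>; so locally \<open>df = \<alpha> - \<i> \<alpha> \<circ> J\<close> for a holomorphic function \<open>f\<close> whose real part is
  affine.  The pair \<open>(\<alpha>, f)\<close> solves a linear total differential system that is integrable because
  \<open>\<nabla>\<close> is flat, and on a simply connected \<open>M\<close> the local solutions given by the Frobenius theorem
  continue to global ones.  Thus \<open>f\<close> exists globally for every prescribed value and differential
  \<open>d (Re f)\<close> at one point, and is determined by them.

  The components of \<open>\<phi>\<close> are \<open>2n\<close> such functions for which the forms \<open>d (Re f)\<close> are a basis of the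
  cotangent space at one point, a Darboux basis of \<open>\<omega>\<close> in (ii) and (iii).  Two bases differ by a
  constant real matrix, which is symplectic if both are Darboux bases.  As \<open>\<omega>\<close> and
  \<open>2 \<phi>\<^sup>*(\<Sum>i. dx\<^sup>i \<and> dy\<^sub>i)\<close> are both parallel, they agree once they agree at one point.  With
  \<open>\<omega>\<close> of this form, its \<open>J\<close>-invariance is equivalent to \<open>\<phi>\<^sup>*\<Omega> = 0\<close> and gives
  \<open>Re \<phi>\<^sup>*\<gamma> = \<omega>(J\<cdot>, \<cdot>)\<close>.
\<close>

section \<open>Maps of class \<open>C\<^sup>k\<close>\<close>

text \<open>Transition maps are only assumed complex differentiable, while fields have to be smooth,
  so regularity in several variables must first be earned from Cauchy's formula. The chart selected
  at a point jumps with the point; hence every derivative is moved into one fixed chart, where the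
  connection becomes its Christoffel map \<open>\<Gamma>\<close>. Curvature, torsion and
  \<open>d\<nabla>J\<close>, tested on fields with constant coordinates, turn into identities for
  \<open>\<Gamma>\<close>, and these supply the integrability conditions. Solving for \<alpha> and f
  together replaces a separate Poincare lemma and leaves a single uniqueness statement. Continuation
  needs more than a solution through one point: one neighbourhood must serve all initial points in
  it, which follows from linearity and uniqueness. The space of germs is never built; lifts of paths
  to it are described directly. Simple connectedness is available through free homotopies of loops,
  so the base point moves, and the monodromy argument has to follow its track.\<close>

lemma frechet_derivative_cong_open:
  assumes "open S" "x \<in> S" "\<And>y. y \<in> S \<Longrightarrow> f y = g y"
  shows "frechet_derivative f (at x) = frechet_derivative g (at x)"
proof -
  \<comment> \<open>\<open>frechet_derivative\<close> is a choice of a derivative, so equivalence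
    for every D gives equal values even where neither function is differentiable.\<close>
  have "(f has_derivative D) (at x) \<longleftrightarrow> (g has_derivative D) (at x)" for D
    using assms by (metis has_derivative_transform_within_open)
  then show ?thesis by (simp add: frechet_derivative_def)
qed

lemma differentiable_cong_open:
  assumes "open S" "x \<in> S" "\<And>y. y \<in> S \<Longrightarrow> f y = g y"
  shows "f differentiable (at x) \<longleftrightarrow> g differentiable (at x)"
  unfolding differentiable_def using assms by (metis has_derivative_transform_within_open)

lemma C_k_on_cong:
  assumes "open S" "\<And>x. x \<in> S \<Longrightarrow> f x = g x"
  shows "C_k_on k S f \<longleftrightarrow> C_k_on k S g"
  using assms(2)
proof (induction k arbitrary: f g)
  case 0
  then show ?case by (simp cong: continuous_on_cong)
next
  case (Suc k)
  have "C_k_on k S (\<lambda>x. frechet_derivative f (at x) v) \<longleftrightarrow>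
        C_k_on k S (\<lambda>x. frechet_derivative g (at x) v)" for v
    by (rule Suc.IH) (use frechet_derivative_cong_open[OF assms(1)] Suc.prems in metis)
  moreover have "(\<forall>x\<in>S. f differentiable (at x)) \<longleftrightarrow> (\<forall>x\<in>S. g differentiable (at x))"
    using differentiable_cong_open[OF assms(1)] Suc.prems by metis
  ultimately show ?case by simp
qed

lemma C_k_on_subset: "C_k_on k S f \<Longrightarrow> T \<subseteq> S \<Longrightarrow> C_k_on k T f"
  by (induction k arbitrary: f) (auto intro: continuous_on_subset)

lemma C_k_on_Suc_imp: "C_k_on (Suc k) S f \<Longrightarrow> C_k_on k S f"
proof (induction k arbitrary: f)
  case 0
  then show ?case
    by (auto simp: differentiable_imp_continuous_within continuous_at_imp_continuous_on)
next
  case (Suc k)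
  show ?case
    using Suc.prems Suc.IH C_k_on.simps(2)[of k S f] C_k_on.simps(2)[of "Suc k" S f] by blast
qed

lemma C_k_on_imp_continuous_on: "C_k_on k S f \<Longrightarrow> continuous_on S f"
proof (induction k)
  case (Suc k)
  then show ?case using C_k_on_Suc_imp by blast
qed simp

text \<open>Replaces the chosen \<open>frechet_derivative\<close> by an explicit formula, so that
  each closure property below reduces to its own induction hypothesis.\<close>

lemma C_k_on_SucI:
  assumes "open S" "\<And>x. x \<in> S \<Longrightarrow> (f has_derivative f' x) (at x)"
    and "\<And>v. C_k_on k S (\<lambda>x. f' x v)"
  shows "C_k_on (Suc k) S f"
proof -
  have "frechet_derivative f (at x) = f' x" if "x \<in> S" for x
    using assms(2)[OF that] frechet_derivative_at by metis
  then have "C_k_on k S (\<lambda>x. frechet_derivative f (at x) v)" for v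
    using assms(3)[of v] C_k_on_cong[OF assms(1), of "\<lambda>x. frechet_derivative f (at x) v" "\<lambda>x. f' x v" k] by simp
  then show ?thesis using assms(2) by (auto simp: differentiable_def)
qed

lemma C_k_on_Suc_has_derivative:
  "C_k_on (Suc k) S f \<Longrightarrow> x \<in> S \<Longrightarrow> (f has_derivative frechet_derivative f (at x)) (at x)"
  by (simp add: frechet_derivative_works[symmetric])

lemma C_k_on_const [simp]: "C_k_on k S (\<lambda>x. c)"
  by (induction k arbitrary: c) auto

lemma C_k_on_bounded_linear:
  assumes "open S" "bounded_linear L" "C_k_on k S f"
  shows "C_k_on k S (\<lambda>x. L (f x))"
  using assms(3)
proof (induction k arbitrary: f)
  case 0
  then show ?case using bounded_linear.continuous_on[OF assms(2)] by auto
next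
  case (Suc k)
  show ?case
  proof (rule C_k_on_SucI[OF assms(1)])
    show "((\<lambda>x. L (f x)) has_derivative (\<lambda>v. L (frechet_derivative f (at x) v))) (at x)" if "x \<in> S" for x
      using bounded_linear.has_derivative[OF assms(2) C_k_on_Suc_has_derivative[OF Suc.prems that]] .
    show "C_k_on k S (\<lambda>x. L (frechet_derivative f (at x) v))" for v
      by (rule Suc.IH) (use Suc.prems in simp)
  qed
qed

lemma C_k_on_add:
  assumes "open S" "C_k_on k S f" "C_k_on k S g"
  shows "C_k_on k S (\<lambda>x. f x + g x)"
  using assms(2,3)
proof (induction k arbitrary: f g)
  case 0
  then show ?case by (auto intro: continuous_intros)
next
  case (Suc k)
  show ?case
  proof (rule C_k_on_SucI[OF assms(1)])
    show "((\<lambda>x. f x + g x) has_derivative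
        (\<lambda>v. frechet_derivative f (at x) v + frechet_derivative g (at x) v)) (at x)" if "x \<in> S" for x
      using Suc.prems that by (intro has_derivative_add C_k_on_Suc_has_derivative)
    show "C_k_on k S (\<lambda>x. frechet_derivative f (at x) v + frechet_derivative g (at x) v)" for v
      by (rule Suc.IH) (use Suc.prems in auto)
  qed
qed

lemma C_k_on_bounded_bilinear:
  assumes "open S" "bounded_bilinear B" "C_k_on k S f" "C_k_on k S g"
  shows "C_k_on k S (\<lambda>x. B (f x) (g x))"
  using assms(3,4)
proof (induction k arbitrary: f g)
  case 0
  then show ?case by (auto intro: bounded_bilinear.continuous_on[OF assms(2)])
next
  case (Suc k)
  show ?case
  proof (rule C_k_on_SucI[OF assms(1)])
    show "((\<lambda>x. B (f x) (g x)) has_derivative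
        (\<lambda>v. B (f x) (frechet_derivative g (at x) v) + B (frechet_derivative f (at x) v) (g x))) (at x)"
      if "x \<in> S" for x
      using Suc.prems that
      by (intro bounded_bilinear.FDERIV[OF assms(2)] C_k_on_Suc_has_derivative)
    show "C_k_on k S (\<lambda>x. B (f x) (frechet_derivative g (at x) v) + B (frechet_derivative f (at x) v) (g x))" for v
      \<comment> \<open>In each Leibniz term one factor stays undifferentiated and is weakened from
        class \<open>Suc k\<close> to class k.\<close>
      using Suc.prems Suc.prems[THEN C_k_on_Suc_imp]
      by (intro C_k_on_add[OF assms(1)] Suc.IH) simp_all
  qed
qed

lemma C_k_on_scaleR:
  "open S \<Longrightarrow> C_k_on k S f \<Longrightarrow> C_k_on k S g \<Longrightarrow> C_k_on k S (\<lambda>x. f x *\<^sub>R g x)"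
  by (rule C_k_on_bounded_bilinear[OF _ bounded_bilinear_scaleR])

lemma C_k_on_diff:
  assumes "open S" "C_k_on k S f" "C_k_on k S g"
  shows "C_k_on k S (\<lambda>x. f x - g x)"
  using C_k_on_add[OF assms(1,2) C_k_on_bounded_linear[OF assms(1) bounded_linear_minus[OF bounded_linear_ident] assms(3)]]
  by simp

lemma C_k_on_sum:
  assumes "open S" "\<And>i. i \<in> I \<Longrightarrow> C_k_on k S (f i)"
  shows "C_k_on k S (\<lambda>x. \<Sum>i\<in>I. f i x)"
  using assms(2)
  by (induction I rule: infinite_finite_induct) (auto intro: C_k_on_add[OF assms(1)])

lemma C_k_on_componentwise:
  fixes f :: "'a::real_normed_vector \<Rightarrow> 'b::euclidean_space"
  assumes "open S"
  shows "C_k_on k S f \<longleftrightarrow> (\<forall>b\<in>Basis. C_k_on k S (\<lambda>x. f x \<bullet> b))"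
proof
  assume "C_k_on k S f"
  then show "\<forall>b\<in>Basis. C_k_on k S (\<lambda>x. f x \<bullet> b)"
    using C_k_on_bounded_linear[OF assms bounded_linear_inner_left] by blast
next
  assume "\<forall>b\<in>Basis. C_k_on k S (\<lambda>x. f x \<bullet> b)"
  then have "C_k_on k S (\<lambda>x. \<Sum>b\<in>Basis. (f x \<bullet> b) *\<^sub>R b)"
    by (intro C_k_on_sum C_k_on_scaleR assms) auto
  then show "C_k_on k S f" by (simp add: euclidean_representation)
qed

lemma linear_sum_Basis:
  fixes L :: "'a::euclidean_space \<Rightarrow> 'b::real_vector"
  assumes "linear L"
  shows "L v = (\<Sum>b\<in>Basis. (v \<bullet> b) *\<^sub>R L b)"
proof -
  have "L v = L (\<Sum>b\<in>Basis. (v \<bullet> b) *\<^sub>R b)" by (simp add: euclidean_representation)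
  also have "\<dots> = (\<Sum>b\<in>Basis. (v \<bullet> b) *\<^sub>R L b)"
    by (simp add: linear_sum[OF assms] linear_cmul[OF assms])
  finally show ?thesis .
qed

text \<open>Regularity of a family of linear maps is only ever known on fixed vectors. Expanding the
  argument in the finite basis turns the application into a sum of products.\<close>

lemma C_k_on_linear_apply:
  fixes f :: "'x::real_normed_vector \<Rightarrow> 'a::euclidean_space"
  assumes "open S" "\<And>x. x \<in> S \<Longrightarrow> linear (L x)" "\<And>b. C_k_on k S (\<lambda>x. L x b)" "C_k_on k S f"
  shows "C_k_on k S (\<lambda>x. L x (f x))"
proof -
  have "C_k_on k S (\<lambda>x. \<Sum>b\<in>Basis. (f x \<bullet> b) *\<^sub>R L x b)"
    by (intro C_k_on_sum C_k_on_scaleR assms C_k_on_bounded_linear[OF assms(1) bounded_linear_inner_left])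
  also have "?this \<longleftrightarrow> C_k_on k S (\<lambda>x. L x (f x))"
    by (rule C_k_on_cong[OF assms(1)]) (rule linear_sum_Basis[OF assms(2), symmetric])
  finally show ?thesis .
qed

lemma C_k_on_compose:
  fixes f :: "'x::real_normed_vector \<Rightarrow> 'a::euclidean_space"
  assumes "open S" "open T" "f ` S \<subseteq> T" "C_k_on k S f" "C_k_on k T g"
  shows "C_k_on k S (\<lambda>x. g (f x))"
  using assms(4,5)
proof (induction k arbitrary: g)
  case 0
  then show ?case using continuous_on_compose2[OF _ _ assms(3)] by auto
next
  case (Suc k)
  show ?case
  proof (rule C_k_on_SucI[OF assms(1)])
    show "((\<lambda>x. g (f x)) has_derivative
        (\<lambda>v. frechet_derivative g (at (f x)) (frechet_derivative f (at x) v))) (at x)" if "x \<in> S" for x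
    proof -
      have "f x \<in> T" using that assms(3) by blast
      then show ?thesis
        by (rule has_derivative_compose[OF C_k_on_Suc_has_derivative[OF Suc.prems(1) that]
              C_k_on_Suc_has_derivative[OF Suc.prems(2)]])
    qed
    \<comment> \<open>The linear maps in the chain rule, evaluated on fixed vectors, are again
      compositions with f; this is why the induction runs over all g.\<close>
    show "C_k_on k S (\<lambda>x. frechet_derivative g (at (f x)) (frechet_derivative f (at x) v))" for v
    proof (rule C_k_on_linear_apply[OF assms(1)])
      show "linear (frechet_derivative g (at (f x)))" if "x \<in> S" for x
        using Suc.prems(2) that assms(3) by (intro linear_frechet_derivative) auto
      show "C_k_on k S (\<lambda>x. frechet_derivative g (at (f x)) b)" for b
        by (rule Suc.IH) (use Suc.prems(2) Suc.prems(1)[THEN C_k_on_Suc_imp] in simp_all)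
      show "C_k_on k S (\<lambda>x. frechet_derivative f (at x) v)" using Suc.prems(1) by auto
    qed
  qed
qed

text \<open>In finite dimension, continuity on each basis vector gives continuity in the operator
  norm, and with it uniform bounds on compact sets.\<close>

lemma C_1_continuous_derivative:
  fixes f :: "'a::euclidean_space \<Rightarrow> 'b::real_normed_vector"
  assumes "open S" "C_k_on (Suc 0) S f"
  obtains f' where "\<And>x. x \<in> S \<Longrightarrow> (f has_derivative blinfun_apply (f' x)) (at x)"
    and "continuous_on S f'" and "\<And>x. x \<in> S \<Longrightarrow> blinfun_apply (f' x) = frechet_derivative f (at x)"
proof
  define f' where "f' x = Blinfun (frechet_derivative f (at x))" for x
  show *: "blinfun_apply (f' x) = frechet_derivative f (at x)" if "x \<in> S" for x
    using C_k_on_Suc_has_derivative[OF assms(2) that]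
    by (simp add: f'_def bounded_linear_Blinfun_apply has_derivative_bounded_linear)
  then show "(f has_derivative blinfun_apply (f' x)) (at x)" if "x \<in> S" for x
    using C_k_on_Suc_has_derivative[OF assms(2) that] that by simp
  show "continuous_on S f'"
  proof (rule continuous_on_blinfun_componentwise)
    fix i :: 'a
    have "continuous_on S (\<lambda>x. frechet_derivative f (at x) i)" using assms(2) by simp
    then show "continuous_on S (\<lambda>x. blinfun_apply (f' x) i)"
      using * by (simp cong: continuous_on_cong)
  qed
qed

section \<open>Holomorphic functions of several variables\<close>

text \<open>The Leibniz rule asks for a derivative that is continuous in operator norm. Here
  continuity in each fixed direction suffices, since the space of directions is
  finite-dimensional.\<close>

lemma has_derivative_integral_param:
  fixes F :: "'a::euclidean_space \<Rightarrow> real \<Rightarrow> 'b::banach"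
  assumes U: "open U" "convex U" "x0 \<in> U"
    and der: "\<And>x t. x \<in> U \<Longrightarrow> t \<in> {0..1} \<Longrightarrow> ((\<lambda>x. F x t) has_derivative F' x t) (at x)"
    and cont: "\<And>x. x \<in> U \<Longrightarrow> continuous_on {0..1} (F x)"
    and cont': "\<And>v. continuous_on (U \<times> {0..1}) (\<lambda>(x, t). F' x t v)"
  shows "((\<lambda>x. integral {0..1} (F x)) has_derivative (\<lambda>v. integral {0..1} (\<lambda>t. F' x0 t v))) (at x0)"
proof -
  define G where "G x t = Blinfun (F' x t)" for x t
  have G: "blinfun_apply (G x t) = F' x t" if "x \<in> U" "t \<in> {0..1}" for x t
    using der[OF that] by (simp add: G_def bounded_linear_Blinfun_apply has_derivative_bounded_linear)
  have cG: "continuous_on (U \<times> cbox 0 1) (\<lambda>(x, t). G x t)"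
  proof (rule continuous_on_blinfun_componentwise)
    fix i :: 'a
    have "continuous_on (U \<times> cbox 0 1) (\<lambda>p. case p of (x, t) \<Rightarrow> F' x t i)" using cont'[of i] by simp
    then show "continuous_on (U \<times> cbox 0 1) (\<lambda>p. blinfun_apply (case p of (x, t) \<Rightarrow> G x t) i)"
      by (rule continuous_on_eq) (auto simp: G)
  qed
  have "((\<lambda>x. integral (cbox 0 1) (F x)) has_derivative integral (cbox 0 1) (G x0)) (at x0 within U)"
  proof (rule leibniz_rule)
    show "((\<lambda>x. F x t) has_derivative blinfun_apply (G x t)) (at x within U)"
      if "x \<in> U" "t \<in> cbox 0 1" for x t
      using der[of x t] that G[of x t] by (simp add: has_derivative_at_withinI)
    show "F x integrable_on cbox 0 1" if "x \<in> U" for x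
      using cont[OF that] by (simp add: integrable_continuous_interval)
  qed (use U cG in auto)
  moreover have "blinfun_apply (integral (cbox 0 1) (G x0)) = (\<lambda>v. integral {0..1} (\<lambda>t. F' x0 t v))"
  proof
    fix v
    have "continuous_on (cbox 0 1) (\<lambda>t. G x0 t)"
    proof -
      have "continuous_on (cbox 0 1) (\<lambda>t. case (x0, t) of (x, t) \<Rightarrow> G x t)"
        by (rule continuous_on_compose2[OF cG]) (use U(3) in \<open>auto intro!: continuous_intros\<close>)
      then show ?thesis by simp
    qed
    then have "G x0 integrable_on cbox 0 1" by (rule integrable_continuous)
    then have "blinfun_apply (integral (cbox 0 1) (G x0)) v = integral (cbox 0 1) (\<lambda>t. blinfun_apply (G x0 t) v)"
      by (simp add: blinfun_apply_integral)
    also have "\<dots> = integral {0..1} (\<lambda>t. F' x0 t v)"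
      using G[OF U(3)] by (auto intro!: integral_cong)
    finally show "blinfun_apply (integral (cbox 0 1) (G x0)) v = integral {0..1} (\<lambda>t. F' x0 t v)" .
  qed
  ultimately show ?thesis using U at_within_open[OF U(3,1)] by simp
qed

text \<open>Scalar case of \<open>cvec_holomorphic_on\<close>, to which the one-variable Cauchy
  formula applies; it asks for complex differentiability pointwise, and smoothness is a
  theorem.\<close>

definition c_holomorphic_on :: "(complex ^ 'n) set \<Rightarrow> (complex ^ 'n \<Rightarrow> complex) \<Rightarrow> bool" where
  "c_holomorphic_on S h \<longleftrightarrow>
     (\<forall>z\<in>S. \<exists>L. (h has_derivative L) (at z) \<and> (\<forall>c v. L (c *s v) = c * L v))"

lemma c_holomorphic_on_derivative:
  fixes h :: "complex ^ 'n \<Rightarrow> complex"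
  assumes "c_holomorphic_on S h" "z \<in> S"
  shows "(h has_derivative frechet_derivative h (at z)) (at z)"
    and "frechet_derivative h (at z) (c *s v) = c * frechet_derivative h (at z) v"
  using assms unfolding c_holomorphic_on_def by (metis frechet_derivative_at)+

lemma norm_scale_vec: "norm (c *s (v::complex ^ 'n)) = cmod c * norm v"
  by (simp add: norm_vec_def vector_scalar_mult_def norm_mult L2_set_right_distrib)

lemma bounded_linear_scale_vec: "bounded_linear (\<lambda>c. c *s (v::complex ^ 'n))"
  by (rule bounded_linear_intro[where K="norm v"])
     (auto simp: norm_scale_vec vec_eq_iff algebra_simps)

lemma bounded_linear_scale_vec_right: "bounded_linear (\<lambda>v::complex ^ 'n. c *s v)"
  by (rule bounded_linear_intro[where K="cmod c"])
     (auto simp: norm_scale_vec vec_eq_iff algebra_simps)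

text \<open>Cauchy's formula for the first derivative at 0 of \<zeta> \<mapsto> h(z + \<zeta> v), on
  the circle of radius r. With the circle parametrised by {0..1}, z enters only through the argument
  of h and the right side can be differentiated in z.\<close>

lemma c_holomorphic_on_directional_Cauchy:
  fixes h :: "complex ^ 'n \<Rightarrow> complex"
  assumes "c_holomorphic_on S h" "0 < r" and S: "\<And>\<zeta>. cmod \<zeta> \<le> r \<Longrightarrow> z + \<zeta> *s v \<in> S"
  shows "frechet_derivative h (at z) v =
    integral {0..1} (\<lambda>t. h (z + (r * exp (2 * of_real pi * \<i> * of_real t)) *s v) *
       (exp (- (2 * of_real pi * \<i> * of_real t)) / r))"
proof -
  define g where "g \<zeta> = h (z + \<zeta> *s v)" for \<zeta>
  have g: "(g has_field_derivative frechet_derivative h (at (z + \<zeta> *s v)) v) (at \<zeta>)"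
    if "cmod \<zeta> \<le> r" for \<zeta>
  proof -
    let ?L = "frechet_derivative h (at (z + \<zeta> *s v))"
    have 1: "((\<lambda>\<zeta>. z + \<zeta> *s v) has_derivative (\<lambda>c. c *s v)) (at \<zeta>)"
      using bounded_linear_imp_has_derivative[OF bounded_linear_scale_vec]
      by (auto intro!: derivative_eq_intros)
    have "(g has_derivative (\<lambda>c. ?L (c *s v))) (at \<zeta>)"
      unfolding g_def
      by (rule has_derivative_compose[OF 1 c_holomorphic_on_derivative(1)[OF assms(1) S[OF that]]])
    moreover have "(\<lambda>c. ?L (c *s v)) = (*) (?L v)"
      using c_holomorphic_on_derivative(2)[OF assms(1) S[OF that]] by (auto simp: mult.commute)
    ultimately show ?thesis unfolding has_field_derivative_def by simp
  qed
  have contg: "continuous_on (cball 0 r) g"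
    using g by (intro continuous_at_imp_continuous_on ballI) (auto intro: DERIV_isCont)
  have holg: "g holomorphic_on ball 0 r"
    unfolding holomorphic_on_def field_differentiable_def
  proof
    fix \<zeta> assume "\<zeta> \<in> ball (0::complex) r"
    then show "\<exists>D. (g has_field_derivative D) (at \<zeta> within ball 0 r)"
      using has_field_derivative_at_within[OF g[of \<zeta>], of "ball 0 r"] by auto
  qed
  let ?I = "contour_integral (circlepath 0 r) (\<lambda>u. g u / (u - 0)^2)"
  note C = Cauchy_derivative_integral_circlepath[OF contg holg, of 0]
  have "(g has_field_derivative 1 / (2 * of_real pi * \<i>) * ?I) (at 0)"
    using C(2) assms(2) by simp
  then have eq: "frechet_derivative h (at z) v = 1 / (2 * of_real pi * \<i>) * ?I"
    using g[of 0] assms(2) DERIV_unique by force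
  have "((\<lambda>u. g u / (u - 0)^2) has_contour_integral ?I) (circlepath 0 r)"
    using C(1) assms(2) has_contour_integral_integral by simp
  then have "((\<lambda>t. g (circlepath 0 r t) / (circlepath 0 r t - 0)^2 *
      vector_derivative (circlepath 0 r) (at t within {0..1})) has_integral ?I) {0..1}"
    unfolding has_contour_integral_def .
  then have "((\<lambda>t. (1 / (2 * of_real pi * \<i>)) * (g (circlepath 0 r t) / (circlepath 0 r t - 0)^2 *
      vector_derivative (circlepath 0 r) (at t within {0..1}))) has_integral
      (1 / (2 * of_real pi * \<i>)) * ?I) {0..1}"
    by (rule has_integral_mult_right)
  \<comment> \<open>With u = r exp(2 pi i t) one has du = 2 pi i u dt, so du / (2 pi i u^2) = dt /
    u.\<close>
  moreover have "(1 / (2 * of_real pi * \<i>)) * (g (circlepath 0 r t) / (circlepath 0 r t - 0)^2 *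
      vector_derivative (circlepath 0 r) (at t within {0..1})) =
      h (z + (r * exp (2 * of_real pi * \<i> * of_real t)) *s v) *
       (exp (- (2 * of_real pi * \<i> * of_real t)) / r)" if "t \<in> {0..1}" for t
  proof -
    have "vector_derivative (circlepath 0 r) (at t within {0..1}) =
        2 * pi * \<i> * r * exp (2 * of_real pi * \<i> * t)"
      using that vector_derivative_circlepath01 by auto
    moreover have "circlepath 0 r t = r * exp (2 * of_real pi * \<i> * of_real t)"
      by (simp add: circlepath)
    ultimately show ?thesis
      using assms(2) by (simp add: g_def exp_minus field_simps power2_eq_square)
  qed
  ultimately have "((\<lambda>t. h (z + (r * exp (2 * of_real pi * \<i> * of_real t)) *s v) *
       (exp (- (2 * of_real pi * \<i> * of_real t)) / r)) has_integral
      (1 / (2 * of_real pi * \<i>)) * ?I) {0..1}"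
    using has_integral_cong[of "{0..1}"] by (metis (no_types, lifting))
  then show ?thesis unfolding eq by (rule integral_unique[symmetric])
qed

text \<open>The Cauchy formula shows first that the directional derivatives are continuous; only then may one
  differentiate under the integral sign.\<close>

lemma c_holomorphic_on_directional_derivative:
  fixes h :: "complex ^ 'n \<Rightarrow> complex"
  assumes hol: "c_holomorphic_on S h" and "open S"
  shows "c_holomorphic_on S (\<lambda>z. frechet_derivative h (at z) v)"
proof -
  let ?e = "\<lambda>t::real. exp (2 * of_real pi * \<i> * of_real t)"
  let ?e' = "\<lambda>t::real. exp (- (2 * of_real pi * \<i> * of_real t))"
  have local_formula: "\<exists>\<rho>>0. \<exists>r>0. ball z0 \<rho> \<subseteq> S \<and> (\<forall>z\<in>ball z0 \<rho>. \<forall>\<zeta>. cmod \<zeta> \<le> r \<longrightarrow> z + \<zeta> *s v \<in> S)"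
    if z0: "z0 \<in> S" for z0 v
  proof -
    obtain e where e: "e > 0" "ball z0 e \<subseteq> S" using \<open>open S\<close> z0 openE by blast
    \<comment> \<open>Chosen with r |v| < e/2, so that all circles around points of the half ball
      stay in S; the summand 1 covers v = 0.\<close>
    define r where "r = e / (2 * (norm v + 1))"
    have nv: "norm v + 1 > 0" by (simp add: add_nonneg_pos)
    have r: "r > 0" "r * norm v < e / 2"
    proof -
      show "r > 0" using e nv by (simp add: r_def)
      have "r * norm v < r * (norm v + 1)" using \<open>r > 0\<close> by simp
      also have "\<dots> = e / 2" using nv by (simp add: r_def field_simps)
      finally show "r * norm v < e / 2" .
    qed
    have "z + \<zeta> *s v \<in> S" if "z \<in> ball z0 (e/2)" "cmod \<zeta> \<le> r" for z \<zeta>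
    proof -
      have "norm (\<zeta> *s v) \<le> r * norm v" using that(2) by (simp add: norm_scale_vec mult_right_mono)
      then have "dist z0 (z + \<zeta> *s v) < e"
        using that(1) r(2) norm_triangle_ineq4[of "z0 - z" "\<zeta> *s v"] by (simp add: dist_norm algebra_simps)
      then show ?thesis using e(2) by auto
    qed
    then show ?thesis using e r(1) by (intro exI[of _ "e/2"] conjI exI[of _ r]) auto
  qed
  have conth: "continuous_on S h"
    using c_holomorphic_on_derivative(1)[OF hol]
    by (auto intro!: continuous_at_imp_continuous_on has_derivative_continuous)
  \<comment> \<open>Stated for any continuous f, to serve first for h and later for its directional
    derivatives.\<close>
  have cont_point: "continuous_on (ball z0 \<rho> \<times> {0..1}) (\<lambda>(z, t). f (z + (of_real r * ?e t) *s v))"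
    if "continuous_on S f" "r > 0" "\<forall>z\<in>ball z0 \<rho>. \<forall>\<zeta>. cmod \<zeta> \<le> r \<longrightarrow> z + \<zeta> *s v \<in> S"
    for f :: "complex ^ 'n \<Rightarrow> complex" and z0 \<rho> r v
    unfolding split_beta
  proof (rule continuous_on_compose2[OF that(1)])
    show "continuous_on (ball z0 \<rho> \<times> {0..1}) (\<lambda>p. fst p + (of_real r * ?e (snd p)) *s v)"
      by (intro continuous_intros bounded_linear.continuous_on[OF bounded_linear_scale_vec])
    show "(\<lambda>p. fst p + (of_real r * ?e (snd p)) *s v) ` (ball z0 \<rho> \<times> {0..1}) \<subseteq> S"
    proof clarsimp
      fix z :: "complex ^ 'n" and t :: real assume "dist z0 z < \<rho>"
      moreover have "cmod (of_real r * ?e t) \<le> r"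
        using that(2) by (simp add: norm_mult)
      ultimately show "z + (of_real r * ?e t) *s v \<in> S" using that(3) by auto
    qed
  qed
  have cont_der: "continuous_on S (\<lambda>z. frechet_derivative h (at z) v)" for v
  proof (rule continuous_at_imp_continuous_on, rule ballI)
    fix z0 assume "z0 \<in> S"
    from local_formula[OF this, of v] obtain \<rho> r where \<rho>: "\<rho> > 0" "r > 0"
      and in_S: "\<forall>z\<in>ball z0 \<rho>. \<forall>\<zeta>. cmod \<zeta> \<le> r \<longrightarrow> z + \<zeta> *s v \<in> S" by blast
    have "continuous_on (ball z0 \<rho> \<times> cbox 0 1) (\<lambda>(z, t). h (z + (of_real r * ?e t) *s v) * (?e' t / of_real r))"
      using cont_point[OF conth \<rho>(2) in_S] \<rho>(2) unfolding split_beta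
      by (auto intro!: continuous_intros)
    from integral_continuous_on_param[OF this]
    have "continuous_on (ball z0 \<rho>) (\<lambda>z. frechet_derivative h (at z) v)"
      by (rule continuous_on_eq)
         (use c_holomorphic_on_directional_Cauchy[OF hol \<rho>(2), of _ v] in_S in auto)
    then show "isCont (\<lambda>z. frechet_derivative h (at z) v) z0"
      using \<rho>(1) by (simp add: continuous_on_eq_continuous_at)
  qed
  show ?thesis
    unfolding c_holomorphic_on_def
  proof
    fix z0 assume "z0 \<in> S"
    from local_formula[OF this, of v] obtain \<rho> r where \<rho>: "\<rho> > 0" "r > 0"
      and in_S: "\<forall>z\<in>ball z0 \<rho>. \<forall>\<zeta>. cmod \<zeta> \<le> r \<longrightarrow> z + \<zeta> *s v \<in> S" by blast
    define F where "F z t = h (z + (of_real r * ?e t) *s v) * (?e' t / of_real r)" for z t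
    define F' where "F' z t w = frechet_derivative h (at (z + (of_real r * ?e t) *s v)) w * (?e' t / of_real r)" for z t w
    have inS: "z + (of_real r * ?e t) *s v \<in> S" if "z \<in> ball z0 \<rho>" for z t
      using in_S that \<rho>(2) by (auto simp: norm_mult)
    let ?L = "\<lambda>w. integral {0..1} (\<lambda>t. F' z0 t w)"
    have D: "((\<lambda>z. integral {0..1} (F z)) has_derivative ?L) (at z0)"
    proof (rule has_derivative_integral_param[of "ball z0 \<rho>"])
      show "((\<lambda>z. F z t) has_derivative F' z t) (at z)" if "z \<in> ball z0 \<rho>" for z t
      proof -
        have "((\<lambda>z. h (z + (of_real r * ?e t) *s v)) has_derivative
            (\<lambda>w. frechet_derivative h (at (z + (of_real r * ?e t) *s v)) w)) (at z)"
          by (rule has_derivative_compose[where f="\<lambda>z. z + (of_real r * ?e t) *s v" and f'="\<lambda>w. w",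
                OF _ c_holomorphic_on_derivative(1)[OF hol inS[OF that]]])
             (auto intro!: derivative_eq_intros)
        then show ?thesis unfolding F_def F'_def by (rule has_derivative_mult_left)
      qed
      show "continuous_on (ball z0 \<rho> \<times> {0..1}) (\<lambda>(x, t). F' x t w)" for w
        unfolding F'_def split_beta using cont_point[OF cont_der \<rho>(2) in_S] \<rho>(2)
        by (auto intro!: continuous_intros simp: split_beta)
      have "continuous_on (ball z0 \<rho> \<times> {0..1}) (\<lambda>(x, t). F x t)"
        unfolding F_def split_beta using cont_point[OF conth \<rho>(2) in_S] \<rho>(2)
        by (auto intro!: continuous_intros simp: split_beta)
      then show "continuous_on {0..1} (F x)" if "x \<in> ball z0 \<rho>" for x
        using that by (auto intro!: continuous_on_compose2[of _ "\<lambda>(x,t). F x t" _ "\<lambda>t. (x, t)", simplified] continuous_intros)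
    qed (use \<rho> in auto)
    have "((\<lambda>z. frechet_derivative h (at z) v) has_derivative ?L) (at z0)"
      by (rule has_derivative_transform_within_open[OF D open_ball[of z0 \<rho>]])
         (use c_holomorphic_on_directional_Cauchy[OF hol \<rho>(2), of _ v] in_S \<rho> in \<open>auto simp: F_def[abs_def]\<close>)
    \<comment> \<open>The integral inherits complex linearity from the derivatives of h at the
      points of the circle.\<close>
    moreover have "?L (c *s w) = c * ?L w" for c w
    proof -
      have "?L (c *s w) = integral {0..1} (\<lambda>t. c * F' z0 t w)"
        unfolding F'_def using c_holomorphic_on_derivative(2)[OF hol inS[of z0]] \<rho>(1)
        by (intro integral_cong) (simp add: mult.assoc)
      then show ?thesis by simp
    qed
    ultimately show "\<exists>L. ((\<lambda>z. frechet_derivative h (at z) v) has_derivative L) (at z0) \<and>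
        (\<forall>c v. L (c *s v) = c * L v)" by blast
  qed
qed

lemma c_holomorphic_on_imp_C_k_on:
  fixes h :: "complex ^ 'n \<Rightarrow> complex"
  assumes "c_holomorphic_on S h" and S: "open S"
  shows "C_k_on k S h"
  using assms(1)
proof (induction k arbitrary: h)
  case 0
  then show ?case
    by (auto intro!: continuous_at_imp_continuous_on has_derivative_continuous
        c_holomorphic_on_derivative(1))
next
  case (Suc k)
  show ?case
    by (rule C_k_on_SucI[OF S c_holomorphic_on_derivative(1)[OF Suc.prems]])
       (use Suc.IH c_holomorphic_on_directional_derivative[OF Suc.prems S] in auto)
qed

section \<open>Linear total differential systems\<close>

text \<open>The system is u'(x) v = A x v (u x), linear in the unknown. Regularity for fixed v and e
  is enough, because bilinearity reduces everything to basis vectors.\<close>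

locale total_system =
  fixes A :: "'a::euclidean_space \<Rightarrow> 'a \<Rightarrow> 'e::euclidean_space \<Rightarrow> 'e" and S :: "'a set"
  assumes open_S: "open S"
    and bilin: "x \<in> S \<Longrightarrow> bilinear (A x)"
    and C1: "C_k_on (Suc 0) S (\<lambda>x. A x v e)"
begin

abbreviation DA :: "'a \<Rightarrow> 'a \<Rightarrow> 'a \<Rightarrow> 'e \<Rightarrow> 'e" where
  "DA x h v e \<equiv> frechet_derivative (\<lambda>y. A y v e) (at x) h"

lemma A_linear: "x \<in> S \<Longrightarrow> linear (A x v)" "x \<in> S \<Longrightarrow> linear (\<lambda>v. A x v e)"
  using bilin unfolding bilinear_def by auto

lemma A_expand:
  assumes "x \<in> S"
  shows "A x v e = (\<Sum>b\<in>Basis. \<Sum>c\<in>Basis. (v \<bullet> b) *\<^sub>R (e \<bullet> c) *\<^sub>R A x b c)"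
proof -
  have "A x v e = (\<Sum>b\<in>Basis. (v \<bullet> b) *\<^sub>R A x b e)"
    by (rule linear_sum_Basis[OF A_linear(2)[OF assms]])
  also have "\<dots> = (\<Sum>b\<in>Basis. (v \<bullet> b) *\<^sub>R (\<Sum>c\<in>Basis. (e \<bullet> c) *\<^sub>R A x b c))"
    by (intro sum.cong refl arg_cong2[where f=scaleR] linear_sum_Basis[OF A_linear(1)[OF assms]])
  finally show ?thesis by (simp add: scaleR_right.sum)
qed

lemma A_deriv: "x \<in> S \<Longrightarrow> ((\<lambda>y. A y v e) has_derivative (\<lambda>h. DA x h v e)) (at x)"
  using C_k_on_Suc_has_derivative[OF C1] by auto

lemma DA_expand:
  assumes "x \<in> S"
  shows "DA x h v e = (\<Sum>b\<in>Basis. \<Sum>c\<in>Basis. (v \<bullet> b) *\<^sub>R (e \<bullet> c) *\<^sub>R DA x h b c)"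
proof -
  have "((\<lambda>y. \<Sum>b\<in>Basis. \<Sum>c\<in>Basis. (v \<bullet> b) *\<^sub>R (e \<bullet> c) *\<^sub>R A y b c) has_derivative
        (\<lambda>h. \<Sum>b\<in>Basis. \<Sum>c\<in>Basis. (v \<bullet> b) *\<^sub>R (e \<bullet> c) *\<^sub>R DA x h b c)) (at x)"
    by (intro has_derivative_sum has_derivative_scaleR_right A_deriv assms)
  then have "((\<lambda>y. A y v e) has_derivative
        (\<lambda>h. \<Sum>b\<in>Basis. \<Sum>c\<in>Basis. (v \<bullet> b) *\<^sub>R (e \<bullet> c) *\<^sub>R DA x h b c)) (at x)"
    by (rule has_derivative_transform_within_open[OF _ open_S assms]) (rule A_expand[symmetric])
  from has_derivative_unique[OF A_deriv[OF assms] this] show ?thesis by (rule fun_cong)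
qed

text \<open>Product rule with three moving slots (base point, direction, value), obtained by
  differentiating the finite basis expansion.\<close>

lemma A_has_derivative:
  assumes "open U" "x \<in> U" "p ` U \<subseteq> S"
    and p: "(p has_derivative p') (at x)" and q: "(q has_derivative q') (at x)"
    and r: "(r has_derivative r') (at x)"
  shows "((\<lambda>y. A (p y) (q y) (r y)) has_derivative
    (\<lambda>h. DA (p x) (p' h) (q x) (r x) + A (p x) (q' h) (r x) + A (p x) (q x) (r' h))) (at x)"
proof -
  have px: "p x \<in> S" using assms by auto
  have "((\<lambda>y. A (p y) b c) has_derivative (\<lambda>h. DA (p x) (p' h) b c)) (at x)" for b c
    by (rule has_derivative_compose[OF p A_deriv[OF px]])
  then have "((\<lambda>y. \<Sum>b\<in>Basis. \<Sum>c\<in>Basis. (q y \<bullet> b) *\<^sub>R (r y \<bullet> c) *\<^sub>R A (p y) b c) has_derivative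
      (\<lambda>h. \<Sum>b\<in>Basis. \<Sum>c\<in>Basis. (q x \<bullet> b) *\<^sub>R ((r x \<bullet> c) *\<^sub>R DA (p x) (p' h) b c + (r' h \<bullet> c) *\<^sub>R A (p x) b c)
         + (q' h \<bullet> b) *\<^sub>R (r x \<bullet> c) *\<^sub>R A (p x) b c)) (at x)"
    by (intro has_derivative_sum has_derivative_scaleR has_derivative_inner_left q r)
  also have "(\<lambda>h. \<Sum>b\<in>Basis. \<Sum>c\<in>Basis. (q x \<bullet> b) *\<^sub>R ((r x \<bullet> c) *\<^sub>R DA (p x) (p' h) b c + (r' h \<bullet> c) *\<^sub>R A (p x) b c)
         + (q' h \<bullet> b) *\<^sub>R (r x \<bullet> c) *\<^sub>R A (p x) b c) =
      (\<lambda>h. DA (p x) (p' h) (q x) (r x) + A (p x) (q' h) (r x) + A (p x) (q x) (r' h))"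
  proof
    fix h
    show "(\<Sum>b\<in>Basis. \<Sum>c\<in>Basis. (q x \<bullet> b) *\<^sub>R ((r x \<bullet> c) *\<^sub>R DA (p x) (p' h) b c + (r' h \<bullet> c) *\<^sub>R A (p x) b c)
         + (q' h \<bullet> b) *\<^sub>R (r x \<bullet> c) *\<^sub>R A (p x) b c) =
      DA (p x) (p' h) (q x) (r x) + A (p x) (q' h) (r x) + A (p x) (q x) (r' h)"
      unfolding DA_expand[OF px, where h="p' h" and v="q x" and e="r x"] A_expand[OF px, of "q' h" "r x"]
        A_expand[OF px, of "q x" "r' h"]
      by (simp add: scaleR_add_right sum.distrib)
  qed
  finally show ?thesis
    by (rule has_derivative_transform_within_open[OF _ assms(1,2)])
       (rule A_expand[symmetric], use assms(3) in auto)
qed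

lemma A_continuous_on:
  assumes "p ` X \<subseteq> S" "continuous_on X p" "continuous_on X q" "continuous_on X r"
  shows "continuous_on X (\<lambda>y. A (p y) (q y) (r y))"
proof -
  have "continuous_on X (\<lambda>y. A (p y) b c)" for b c
    using continuous_on_compose2[OF C_k_on_imp_continuous_on[OF C1] assms(2,1)] .
  then have "continuous_on X (\<lambda>y. \<Sum>b\<in>Basis. \<Sum>c\<in>Basis. (q y \<bullet> b) *\<^sub>R (r y \<bullet> c) *\<^sub>R A (p y) b c)"
    using assms by (intro continuous_intros)
  then show ?thesis by (rule continuous_on_eq) (rule A_expand[symmetric], use assms(1) in auto)
qed

lemma DA_continuous_on:
  assumes "p ` X \<subseteq> S" "continuous_on X p" "continuous_on X q" "continuous_on X r" "continuous_on X s"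
  shows "continuous_on X (\<lambda>y. DA (p y) (s y) (q y) (r y))"
proof -
  have c: "continuous_on S (\<lambda>y. DA y a b c)" for a b c
    using C1[of b c] by simp
  have "continuous_on X (\<lambda>y. DA (p y) a b c)" for a b c
    using continuous_on_compose2[OF c assms(2,1)] .
  then have "continuous_on X (\<lambda>y. \<Sum>b\<in>Basis. \<Sum>c\<in>Basis. (q y \<bullet> b) *\<^sub>R (r y \<bullet> c) *\<^sub>R
      (\<Sum>a\<in>Basis. (s y \<bullet> a) *\<^sub>R DA (p y) a b c))"
    using assms by (intro continuous_intros)
  then show ?thesis
  proof (rule continuous_on_eq)
    fix y assume "y \<in> X"
    then have y: "p y \<in> S" using assms(1) by auto
    have "(\<Sum>a\<in>Basis. (s y \<bullet> a) *\<^sub>R DA (p y) a b c) = DA (p y) (s y) b c" for b c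
      by (rule linear_sum_Basis[symmetric]) (rule has_derivative_linear[OF A_deriv[OF y]])
    then show "(\<Sum>b\<in>Basis. \<Sum>c\<in>Basis. (q y \<bullet> b) *\<^sub>R (r y \<bullet> c) *\<^sub>R
      (\<Sum>a\<in>Basis. (s y \<bullet> a) *\<^sub>R DA (p y) a b c)) = DA (p y) (s y) (q y) (r y)"
      by (simp add: DA_expand[OF y, where h="s y" and v="q y" and e="r y"])
  qed
qed

lemma A_bound:
  assumes "compact X" "X \<subseteq> S"
  obtains K where "K \<ge> 0" "\<And>x v e. x \<in> X \<Longrightarrow> norm (A x v e) \<le> K * norm v * norm e"
proof -
  have "\<exists>k\<ge>0. \<forall>x\<in>X. norm (A x b c) \<le> k" for b c
  proof -
    have "compact ((\<lambda>x. A x b c) ` X)"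
      using C_k_on_imp_continuous_on[OF C1] assms by (intro compact_continuous_image) (auto intro: continuous_on_subset)
    then have "bounded ((\<lambda>x. A x b c) ` X)" by (rule compact_imp_bounded)
    then obtain k where "k > 0" "\<forall>y\<in>(\<lambda>x. A x b c) ` X. norm y \<le> k" unfolding bounded_pos by blast
    then show ?thesis by (intro exI[of _ k]) auto
  qed
  then obtain k where k: "\<And>b c. k b c \<ge> 0" "\<And>b c x. x \<in> X \<Longrightarrow> norm (A x b c) \<le> k b c" by metis
  show ?thesis
  proof
    show "(\<Sum>b\<in>Basis. \<Sum>c\<in>Basis. k b c) \<ge> 0" using k by (intro sum_nonneg) auto
    fix x v e assume x: "x \<in> X"
    have "norm (A x v e) \<le> (\<Sum>b\<in>Basis. \<Sum>c\<in>Basis. norm ((v \<bullet> b) *\<^sub>R (e \<bullet> c) *\<^sub>R A x b c))"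
      unfolding A_expand[OF subsetD[OF assms(2) x], of v e]
      by (intro order_trans[OF norm_sum] sum_mono order_refl)
    also have "\<dots> \<le> (\<Sum>b\<in>Basis. \<Sum>c\<in>Basis. k b c * norm v * norm e)"
    proof (intro sum_mono)
      fix b :: 'a and c :: 'e assume "b \<in> Basis" "c \<in> Basis"
      then have "\<bar>v \<bullet> b\<bar> \<le> norm v" "\<bar>e \<bullet> c\<bar> \<le> norm e" by (auto simp: Basis_le_norm)
      then have "\<bar>v \<bullet> b\<bar> * (\<bar>e \<bullet> c\<bar> * norm (A x b c)) \<le> norm v * (norm e * k b c)"
        using k x by (intro mult_mono) auto
      then show "norm ((v \<bullet> b) *\<^sub>R (e \<bullet> c) *\<^sub>R A x b c) \<le> k b c * norm v * norm e"
        by (simp add: abs_mult mult_ac)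
    qed
    finally show "norm (A x v e) \<le> (\<Sum>b\<in>Basis. \<Sum>c\<in>Basis. k b c) * norm v * norm e"
      by (simp add: sum_distrib_right)
  qed
qed

text \<open>Here only v and e are expanded in the basis; the direction h is handled by compactness
  in operator norm, via \<open>C_1_continuous_derivative\<close>.\<close>

lemma DA_bound:
  assumes "compact X" "X \<subseteq> S"
  obtains K where "K \<ge> 0" "\<And>x h v e. x \<in> X \<Longrightarrow> norm (DA x h v e) \<le> K * norm h * norm v * norm e"
proof -
  have "\<exists>k\<ge>0. \<forall>x\<in>X. \<forall>h. norm (DA x h b c) \<le> k * norm h" for b c
  proof -
    obtain f' where f': "continuous_on S f'" "\<And>x. x \<in> S \<Longrightarrow> blinfun_apply (f' x) = (\<lambda>h. DA x h b c)"
      using C_1_continuous_derivative[OF open_S C1] by metis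
    have "compact (f' ` X)"
      using f'(1) assms by (intro compact_continuous_image) (auto intro: continuous_on_subset)
    then have "bounded (f' ` X)" by (rule compact_imp_bounded)
    then obtain k where k: "k > 0" "\<forall>x\<in>X. norm (f' x) \<le> k" unfolding bounded_pos by auto
    have "norm (DA x h b c) \<le> norm (f' x) * norm h" if "x \<in> X" for x h
      using norm_blinfun[of "f' x" h] f'(2) assms(2) that by auto
    then have "norm (DA x h b c) \<le> k * norm h" if "x \<in> X" for x h
      using k(2) that by (meson mult_right_mono norm_ge_zero order_trans)
    then show ?thesis using k(1) by (intro exI[of _ k]) auto
  qed
  then obtain k where k: "\<And>b c. k b c \<ge> 0" "\<And>b c x h. x \<in> X \<Longrightarrow> norm (DA x h b c) \<le> k b c * norm h" by metis
  show ?thesis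
  proof
    show "(\<Sum>b\<in>Basis. \<Sum>c\<in>Basis. k b c) \<ge> 0" using k by (intro sum_nonneg) auto
    fix x h v e assume x: "x \<in> X"
    have "norm (DA x h v e) \<le> (\<Sum>b\<in>Basis. \<Sum>c\<in>Basis. norm ((v \<bullet> b) *\<^sub>R (e \<bullet> c) *\<^sub>R DA x h b c))"
      unfolding DA_expand[OF subsetD[OF assms(2) x], where h=h and v=v and e=e]
      by (intro order_trans[OF norm_sum] sum_mono order_refl)
    also have "\<dots> \<le> (\<Sum>b\<in>Basis. \<Sum>c\<in>Basis. k b c * norm h * norm v * norm e)"
    proof (intro sum_mono)
      fix b :: 'a and c :: 'e assume "b \<in> Basis" "c \<in> Basis"
      then have "\<bar>v \<bullet> b\<bar> \<le> norm v" "\<bar>e \<bullet> c\<bar> \<le> norm e" by (auto simp: Basis_le_norm)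
      then have "\<bar>v \<bullet> b\<bar> * (\<bar>e \<bullet> c\<bar> * norm (DA x h b c)) \<le> norm v * (norm e * (k b c * norm h))"
        using k x by (intro mult_mono) auto
      then show "norm ((v \<bullet> b) *\<^sub>R (e \<bullet> c) *\<^sub>R DA x h b c) \<le> k b c * norm h * norm v * norm e"
        by (simp add: abs_mult mult_ac)
    qed
    finally show "norm (DA x h v e) \<le> (\<Sum>b\<in>Basis. \<Sum>c\<in>Basis. k b c) * norm h * norm v * norm e"
      by (simp add: sum_distrib_right)
  qed
qed

end

text \<open>The form needed for Picard iteration: increments bounded by a halving sequence give a
  limit, with the error bounded by the tail of the geometric series.\<close>

lemma geometric_Cauchy_convergent:
  fixes X :: "nat \<Rightarrow> 'b::banach"
  assumes "\<And>k. norm (X (Suc k) - X k) \<le> c / 2 ^ k"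
  shows "norm (X k - lim X) \<le> 2 * c / 2 ^ k" and "X \<longlonglongrightarrow> lim X"
proof -
  \<comment> \<open>The subtracted tail makes the induction on n close; it is dropped
    afterwards.\<close>
  have step: "norm (X (k + n) - X k) \<le> 2 * c / 2 ^ k - 2 * c / 2 ^ (k + n)" for k n
  proof (induction n)
    case (Suc n)
    have "norm (X (k + Suc n) - X k) \<le> norm (X (Suc (k + n)) - X (k + n)) + norm (X (k + n) - X k)"
      using norm_triangle_ineq[of "X (Suc (k + n)) - X (k + n)" "X (k + n) - X k"] by simp
    also have "\<dots> \<le> c / 2 ^ (k + n) + (2 * c / 2 ^ k - 2 * c / 2 ^ (k + n))"
      using Suc.IH assms[of "k + n"] by linarith
    also have "\<dots> = 2 * c / 2 ^ k - 2 * c / 2 ^ (k + Suc n)" by (simp add: field_simps)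
    finally show ?case .
  qed simp
  have c: "c \<ge> 0" using order_trans[OF norm_ge_zero assms[of 0]] by simp
  then have b: "norm (X (k + n) - X k) \<le> 2 * c / 2 ^ k" for k n
    using order_trans[OF step] by simp
  have "(\<lambda>k. 2 * c * (1/2) ^ k) \<longlonglongrightarrow> 2 * c * 0"
    by (intro tendsto_intros LIMSEQ_power_zero) simp
  then have z: "(\<lambda>k. 2 * c / 2 ^ k) \<longlonglongrightarrow> 0" by (simp add: power_divide)
  have "Cauchy X"
  proof (rule CauchyI')
    fix e :: real assume "e > 0"
    then have "\<forall>\<^sub>F k in sequentially. 2 * c / 2 ^ k < e / 2" by (intro order_tendstoD(2)[OF z]) simp
    then obtain N where N: "2 * c / 2 ^ N < e / 2" unfolding eventually_sequentially by auto
    show "\<exists>M. \<forall>m\<ge>M. \<forall>n>m. dist (X m) (X n) < e"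
    proof (intro exI allI impI)
      fix m n assume "m \<ge> N" "m < n"
      then obtain i j where "m = N + i" "n = N + j"
        using le_Suc_ex[of N m] le_Suc_ex[of N n] by auto
      then show "dist (X m) (X n) < e"
        using b[of N i] b[of N j] N norm_triangle_ineq4[of "X m - X N" "X n - X N"]
        by (simp add: dist_norm)
    qed
  qed
  then show X: "X \<longlonglongrightarrow> lim X" by (simp add: Cauchy_convergent_iff convergent_LIMSEQ_iff)
  have "(\<lambda>n. norm (X k - X (n + k))) \<longlonglongrightarrow> norm (X k - lim X)"
    by (intro tendsto_intros LIMSEQ_ignore_initial_segment X)
  then show "norm (X k - lim X) \<le> 2 * c / 2 ^ k"
    by (rule LIMSEQ_le_const2) (use b[of k] in \<open>auto simp: norm_minus_commute add.commute\<close>)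
qed

text \<open>The solution is the fixed point of \<open>u \<mapsto> u0 + \<integral> A(\<sigma>\<^sub>t x)(x - x0)(u(\<sigma>\<^sub>t x)) dt\<close> where
  \<open>\<sigma>\<^sub>t x\<close> runs along the segment from \<open>x0\<close> to \<open>x\<close>.  The iterates converge in \<open>C^1\<close>, and
  the defect \<open>e x h = u'(x) h - A x h (u x)\<close> satisfies, by integrability, the homogeneous equation
  \<open>e x h = \<integral> t A(\<sigma>\<^sub>t x)(x - x0)(e (\<sigma>\<^sub>t x) h) dt\<close>, which forces \<open>e = 0\<close>.\<close>

theorem (in total_system) frobenius:
  assumes integrable: "\<And>x v w e. x \<in> S \<Longrightarrow> DA x v w e - DA x w v e = A x v (A x w e) - A x w (A x v e)"
    and x0: "x0 \<in> S"
  shows "\<exists>r>0. ball x0 r \<subseteq> S \<and>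
    (\<forall>u0. \<exists>u. u x0 = u0 \<and> (\<forall>x\<in>ball x0 r. (u has_derivative (\<lambda>v. A x v (u x))) (at x)))"
proof -
  obtain R where R: "R > 0" "cball x0 R \<subseteq> S" using open_S x0 open_contains_cball by blast
  obtain K where K: "K \<ge> 0" "\<And>x v e. x \<in> cball x0 R \<Longrightarrow> norm (A x v e) \<le> K * norm v * norm e"
    using A_bound[OF compact_cball R(2)] by blast
  obtain K' where K': "K' \<ge> 0"
    "\<And>x h v e. x \<in> cball x0 R \<Longrightarrow> norm (DA x h v e) \<le> K' * norm h * norm v * norm e"
    using DA_bound[OF compact_cball R(2)] by blast
  \<comment> \<open>Gives K \<rho> \<le> 1/4. A contraction factor 1/4, not just 1/2, leaves room
    for the extra term in the iteration of the derivatives.\<close>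
  define \<rho> where "\<rho> = min R (1 / (4 * (K + 1)))"
  have \<rho>: "\<rho> > 0" "\<rho> \<le> R" using R(1) K(1) by (auto simp: \<rho>_def)
  have K\<rho>: "K * \<rho> \<le> 1/4"
  proof -
    have "K * \<rho> \<le> K * (1 / (4 * (K + 1)))" using K(1) by (intro mult_left_mono) (auto simp: \<rho>_def)
    also have "\<dots> \<le> 1/4" using K(1) by (simp add: field_simps)
    finally show ?thesis .
  qed
  define U where "U = ball x0 \<rho>"
  have U: "open U" "convex U" "x0 \<in> U" "U \<subseteq> cball x0 R" "U \<subseteq> S"
    using \<rho> R(2) by (auto simp: U_def)
  define \<sigma> where "\<sigma> t x = x0 + t *\<^sub>R (x - x0)" for t :: real and x
  have \<sigma>U: "\<sigma> t x \<in> U" if "x \<in> U" "t \<in> {0..1}" for t x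
  proof -
    have "\<bar>t\<bar> * norm (x - x0) \<le> 1 * norm (x - x0)" using that by (intro mult_right_mono) auto
    then show ?thesis using that(1) by (auto simp: \<sigma>_def U_def dist_norm norm_minus_commute)
  qed
  have diffU: "norm (x - x0) \<le> \<rho>" if "x \<in> U" for x
    using that by (auto simp: U_def dist_norm norm_minus_commute)
  have cont_\<sigma>: "continuous_on (U \<times> {0..1}) (\<lambda>p. \<sigma> (snd p) (fst p))"
    unfolding \<sigma>_def by (intro continuous_intros)
  have \<sigma>_img: "(\<lambda>p. \<sigma> (snd p) (fst p)) ` (U \<times> {0..1}) \<subseteq> U"
    using \<sigma>U by auto
  have cont_comp: "continuous_on (U \<times> {0..1}) (\<lambda>p. f (\<sigma> (snd p) (fst p)))" if "continuous_on U f"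
    for f :: "'a \<Rightarrow> 'e"
    by (rule continuous_on_compose2[OF that cont_\<sigma> \<sigma>_img])
  have slice: "continuous_on {0..1} (g x)" if "continuous_on (U \<times> {0..1}) (\<lambda>p. g (fst p) (snd p))" "x \<in> U"
    for g :: "'a \<Rightarrow> real \<Rightarrow> 'e" and x
  proof -
    have "continuous_on {0..1} (\<lambda>t. (x, t))" by (intro continuous_on_Pair continuous_on_const continuous_on_id)
    from continuous_on_compose2[OF that(1) this] that(2) show ?thesis by auto
  qed
  define I1 where "I1 u x t = A (\<sigma> t x) (x - x0) (u (\<sigma> t x))" for u x t
  \<comment> \<open>The derivative of \<open>I1 u x t\<close> in x along h, with d in the place of
    u'. The factors t come from differentiating \<sigma> t.\<close>
  define I2 where "I2 u d h x t = t *\<^sub>R DA (\<sigma> t x) h (x - x0) (u (\<sigma> t x)) + A (\<sigma> t x) h (u (\<sigma> t x))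
      + t *\<^sub>R A (\<sigma> t x) (x - x0) (d (\<sigma> t x) h)" for u d h x t
  have cI1: "continuous_on (U \<times> {0..1}) (\<lambda>p. I1 u (fst p) (snd p))" if "continuous_on U u" for u
    unfolding I1_def
    using \<sigma>_img U(5) by (intro A_continuous_on cont_\<sigma> cont_comp that continuous_intros) blast
  have cI2: "continuous_on (U \<times> {0..1}) (\<lambda>p. I2 u d h (fst p) (snd p))"
    if "continuous_on U u" "\<And>h. continuous_on U (\<lambda>x. d x h)" for u d h
    unfolding I2_def using \<sigma>_img U(5)
    by (intro continuous_intros A_continuous_on DA_continuous_on cont_\<sigma> cont_comp that) blast+
  have bA: "norm (A y v e) \<le> K * norm v * norm e" if "y \<in> U" for y v e
    using K(2) U(4) that by auto
  have bA': "norm (A (\<sigma> t x) (x - x0) e) \<le> 1/4 * m"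
    if "x \<in> U" "t \<in> {0..1}" "norm e \<le> m" for x t e m
  proof -
    have "norm (A (\<sigma> t x) (x - x0) e) \<le> K * norm (x - x0) * norm e"
      by (rule bA[OF \<sigma>U[OF that(1,2)]])
    also have "\<dots> \<le> (K * \<rho>) * m"
      using diffU[OF that(1)] K(1) that(3) \<rho>(1) by (intro mult_mono) auto
    also have "\<dots> \<le> 1/4 * m" using K\<rho> order_trans[OF norm_ge_zero that(3)] by (intro mult_right_mono)
    finally show ?thesis .
  qed
  have bDA: "norm (DA (\<sigma> t x) h (x - x0) e) \<le> K' * \<rho> * m * norm h"
    if "x \<in> U" "t \<in> {0..1}" "norm e \<le> m" for x t e m h
  proof -
    have "norm (DA (\<sigma> t x) h (x - x0) e) \<le> K' * norm h * norm (x - x0) * norm e"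
      using K'(2) \<sigma>U[OF that(1,2)] U(4) by auto
    also have "\<dots> \<le> K' * norm h * \<rho> * m"
      using diffU[OF that(1)] K'(1) that(3) \<rho>(1) by (intro mult_mono) auto
    finally show ?thesis by (simp add: mult_ac)
  qed
  have A_diff: "A y v (e - e') = A y v e - A y v e'" if "y \<in> U" for y v e e'
    using A_linear(1) U(5) that by (metis linear_diff subsetD)
  have DA_diff: "DA y h v (e - e') = DA y h v e - DA y h v e'" if "y \<in> U" for y v e e' h
    unfolding DA_expand[OF subsetD[OF U(5) that], of v "e - e'"]
      DA_expand[OF subsetD[OF U(5) that], of v e] DA_expand[OF subsetD[OF U(5) that], of v e']
    by (simp add: inner_diff_left scaleR_diff_left scaleR_diff_right sum_subtractf)
  have int_bound: "norm (integral {0..1} g) \<le> B" if "continuous_on {0..1} g" "\<And>t. t \<in> {0..1} \<Longrightarrow> norm (g t) \<le> B"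
    for g :: "real \<Rightarrow> 'e" and B
    using integral_bound[of 0 1 g B] that by simp
  have int_diff_bound: "norm (integral {0..1} g - integral {0..1} g') \<le> B"
    if "continuous_on {0..1} g" "continuous_on {0..1} g'" "\<And>t. t \<in> {0..1} \<Longrightarrow> norm (g t - g' t) \<le> B"
    for g g' :: "real \<Rightarrow> 'e" and B
  proof -
    have "integral {0..1} g - integral {0..1} g' = integral {0..1} (\<lambda>t. g t - g' t)"
      using that by (intro integral_diff[symmetric] integrable_continuous_interval)
    then show ?thesis using int_bound[of "\<lambda>t. g t - g' t" B] that by (simp add: continuous_on_diff)
  qed
  \<comment> \<open>Bounds the dependence of \<open>I2\<close> on u; its dependence on d is bounded
    by 1/4.\<close>
  define c where "c = K' * \<rho> + K"
  have c: "c \<ge> 0" using K(1) K'(1) \<rho>(1) by (simp add: c_def)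
  have E1: "norm (integral {0..1} (I1 u x) - integral {0..1} (I1 w x)) \<le> 1/4 * m"
    if "continuous_on U u" "continuous_on U w" and uw: "\<And>y. y \<in> U \<Longrightarrow> norm (u y - w y) \<le> m" and "x \<in> U" for u w m x
  proof (rule int_diff_bound)
    show "continuous_on {0..1} (I1 u x)" "continuous_on {0..1} (I1 w x)"
      by (rule slice[OF cI1[OF that(1)] \<open>x \<in> U\<close>], rule slice[OF cI1[OF that(2)] \<open>x \<in> U\<close>])
    show "norm (I1 u x t - I1 w x t) \<le> 1/4 * m" if t: "t \<in> {0..1}" for t
      using bA'[OF \<open>x \<in> U\<close> t uw[OF \<sigma>U[OF \<open>x \<in> U\<close> t]]]
      by (simp add: I1_def A_diff[OF \<sigma>U[OF \<open>x \<in> U\<close> t]])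
  qed
  have E2: "norm (integral {0..1} (I2 u d h x) - integral {0..1} (I2 w d' h x)) \<le> (c * m + 1/4 * n) * norm h"
    if "continuous_on U u" "continuous_on U w"
      and "\<And>h. continuous_on U (\<lambda>x. d x h)" "\<And>h. continuous_on U (\<lambda>x. d' x h)"
      and uw: "\<And>y. y \<in> U \<Longrightarrow> norm (u y - w y) \<le> m"
      and dd: "\<And>y. y \<in> U \<Longrightarrow> norm (d y h - d' y h) \<le> n * norm h" and x: "x \<in> U"
    for u w d d' h m n x
  proof (rule int_diff_bound)
    show "continuous_on {0..1} (I2 u d h x)" "continuous_on {0..1} (I2 w d' h x)"
      by (rule slice[OF cI2[OF that(1,3)] x], rule slice[OF cI2[OF that(2,4)] x])
    fix t :: real assume t: "t \<in> {0..1}"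
    let ?y = "\<sigma> t x"
    have y: "?y \<in> U" by (rule \<sigma>U[OF x t])
    have "I2 u d h x t - I2 w d' h x t = t *\<^sub>R DA ?y h (x - x0) (u ?y - w ?y) + A ?y h (u ?y - w ?y)
      + t *\<^sub>R A ?y (x - x0) (d ?y h - d' ?y h)"
      by (simp add: I2_def A_diff[OF y] DA_diff[OF y] algebra_simps)
    then have "norm (I2 u d h x t - I2 w d' h x t) \<le> norm (t *\<^sub>R DA ?y h (x - x0) (u ?y - w ?y)) + norm (A ?y h (u ?y - w ?y))
      + norm (t *\<^sub>R A ?y (x - x0) (d ?y h - d' ?y h))"
      by (simp only:) (rule order_trans[OF norm_triangle_ineq add_right_mono[OF norm_triangle_ineq]])
    also have "\<dots> \<le> K' * \<rho> * m * norm h + K * m * norm h + 1/4 * (n * norm h)"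
    proof (intro add_mono)
      have *: "norm (t *\<^sub>R z) \<le> norm z" for z :: 'e using t by (simp add: mult_left_le_one_le)
      show "norm (t *\<^sub>R DA ?y h (x - x0) (u ?y - w ?y)) \<le> K' * \<rho> * m * norm h"
        using order_trans[OF * bDA[OF x t uw[OF y]]] .
      show "norm (t *\<^sub>R A ?y (x - x0) (d ?y h - d' ?y h)) \<le> 1/4 * (n * norm h)"
        using order_trans[OF * bA'[OF x t dd[OF y]]] .
      have "norm (A ?y h (u ?y - w ?y)) \<le> K * norm h * norm (u ?y - w ?y)" by (rule bA[OF y])
      also have "\<dots> \<le> K * norm h * m" using uw[OF y] K(1) by (intro mult_left_mono) auto
      finally show "norm (A ?y h (u ?y - w ?y)) \<le> K * m * norm h" by (simp add: mult_ac)
    qed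
    also have "\<dots> = (c * m + 1/4 * n) * norm h" by (simp add: c_def algebra_simps)
    finally show "norm (I2 u d h x t - I2 w d' h x t) \<le> (c * m + 1/4 * n) * norm h" .
  qed
  have DI1: "((\<lambda>x. u0 + integral {0..1} (I1 u x)) has_derivative (\<lambda>h. integral {0..1} (I2 u d h x))) (at x)"
    if "\<And>x. x \<in> U \<Longrightarrow> (u has_derivative d x) (at x)" "\<And>h. continuous_on U (\<lambda>x. d x h)" "x \<in> U" for u d x u0
  proof -
    have cu: "continuous_on U u"
      using that(1) by (auto intro!: continuous_at_imp_continuous_on has_derivative_continuous)
    have "((\<lambda>x. integral {0..1} (I1 u x)) has_derivative (\<lambda>h. integral {0..1} (\<lambda>t. I2 u d h x t))) (at x)"
    proof (rule has_derivative_integral_param[OF U(1,2) that(3)])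
      fix y t assume y: "y \<in> U" and t: "t \<in> {0..1::real}"
      have \<sigma>': "(\<sigma> t has_derivative (\<lambda>h. t *\<^sub>R h)) (at y)" for y
        unfolding \<sigma>_def by (auto intro!: derivative_eq_intros)
      have "((\<lambda>x. A (\<sigma> t x) (x - x0) (u (\<sigma> t x))) has_derivative
         (\<lambda>h. DA (\<sigma> t y) (t *\<^sub>R h) (y - x0) (u (\<sigma> t y)) + A (\<sigma> t y) h (u (\<sigma> t y))
            + A (\<sigma> t y) (y - x0) (d (\<sigma> t y) (t *\<^sub>R h)))) (at y)"
      proof (rule A_has_derivative[OF U(1) y _ \<sigma>'])
        show "\<sigma> t ` U \<subseteq> S" using \<sigma>U t U(5) by auto
        show "((\<lambda>x. x - x0) has_derivative (\<lambda>h. h)) (at y)" by (auto intro!: derivative_eq_intros)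
        show "((\<lambda>x. u (\<sigma> t x)) has_derivative (\<lambda>h. d (\<sigma> t y) (t *\<^sub>R h))) (at y)"
          by (rule has_derivative_compose[OF \<sigma>' that(1)[OF \<sigma>U[OF y t]]])
      qed
      moreover have "DA (\<sigma> t y) (t *\<^sub>R h) v e = t *\<^sub>R DA (\<sigma> t y) h v e" for h v e
        using has_derivative_linear[OF A_deriv] \<sigma>U[OF y t] U(5) by (metis linear_cmul subsetD)
      moreover have "A (\<sigma> t y) (y - x0) (d (\<sigma> t y) (t *\<^sub>R h)) = t *\<^sub>R A (\<sigma> t y) (y - x0) (d (\<sigma> t y) h)" for h
        using has_derivative_linear[OF that(1)[OF \<sigma>U[OF y t]]] A_linear(1) \<sigma>U[OF y t] U(5)
        by (metis linear_cmul subsetD)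
      ultimately show "((\<lambda>x. I1 u x t) has_derivative (\<lambda>h. I2 u d h y t)) (at y)"
        by (simp add: I1_def I2_def)
    next
      show "continuous_on {0..1} (I1 u y)" if "y \<in> U" for y using slice[OF cI1[OF cu] that] .
      show "continuous_on (U \<times> {0..1}) (\<lambda>(x, t). I2 u d h x t)" for h
        using cI2[OF cu that(2)] by (simp add: split_beta)
    qed
    then show ?thesis by (auto intro!: derivative_eq_intros)
  qed
  \<comment> \<open>U has been fixed before u0 enters: linearity makes the radius independent of the
    initial value.\<close>
  have "\<exists>u. u x0 = u0 \<and> (\<forall>x\<in>U. (u has_derivative (\<lambda>v. A x v (u x))) (at x))" for u0
  proof -
    \<comment> \<open>Function and derivative are iterated as a pair, so that the second sequence
      consists of the derivatives of the first and both can be estimated together.\<close>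
    define step where "step p = (\<lambda>x. u0 + integral {0..1} (I1 (fst p) x), \<lambda>x h. integral {0..1} (I2 (fst p) (snd p) h x))"
      for p :: "('a \<Rightarrow> 'e) \<times> ('a \<Rightarrow> 'a \<Rightarrow> 'e)"
    define P where "P k = (step ^^ k) (\<lambda>x. u0, \<lambda>x h. 0)" for k
    define u where "u k = fst (P k)" for k
    define d where "d k = snd (P k)" for k
    have u0': "u 0 = (\<lambda>x. u0)" "d 0 = (\<lambda>x h. 0)" by (simp_all add: u_def d_def P_def)
    have uS: "u (Suc k) = (\<lambda>x. u0 + integral {0..1} (I1 (u k) x))"
      and dS: "d (Suc k) = (\<lambda>x h. integral {0..1} (I2 (u k) (d k) h x))" for k
      by (simp_all add: u_def d_def P_def step_def)
    have cont_of_deriv: "continuous_on U f" if "\<And>x. x \<in> U \<Longrightarrow> (f has_derivative f' x) (at x)"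
      for f :: "'a \<Rightarrow> 'e" and f'
      using that by (auto intro!: continuous_at_imp_continuous_on has_derivative_continuous)
    have ud: "(\<forall>x\<in>U. (u k has_derivative d k x) (at x)) \<and> (\<forall>h. continuous_on U (\<lambda>x. d k x h))" for k
    proof (induction k)
      case 0
      then show ?case by (simp add: u0')
    next
      case (Suc k)
      have "continuous_on U (u k)" using Suc cont_of_deriv by blast
      then have "continuous_on (U \<times> cbox 0 1) (\<lambda>(x, t). I2 (u k) (d k) h x t)" for h
        using cI2[of "u k" "d k" h] Suc by (simp add: split_beta)
      then have "continuous_on U (\<lambda>x. d (Suc k) x h)" for h
        unfolding dS using integral_continuous_on_param[of U 0 1 "I2 (u k) (d k) h"] by simp
      moreover have "(u (Suc k) has_derivative d (Suc k) x) (at x)" if "x \<in> U" for x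
        unfolding uS dS using Suc that by (intro DI1) auto
      ultimately show ?case by blast
    qed
    then have der: "\<And>k x. x \<in> U \<Longrightarrow> (u k has_derivative d k x) (at x)" and cd: "\<And>k h. continuous_on U (\<lambda>x. d k x h)"
      by blast+
    have cu: "continuous_on U (u k)" for k using der cont_of_deriv by blast
    define M where "M = norm u0"
    have udiff: "norm (u (Suc k) x - u k x) \<le> M / 2 ^ k" if "x \<in> U" for k x
      using that
    proof (induction k arbitrary: x)
      case 0
      have "norm (integral {0..1} (I1 (u 0) x)) \<le> 1/4 * M"
        using slice[OF cI1[OF cu[of 0]] 0] bA'[OF 0] by (intro int_bound) (auto simp: I1_def u0' M_def)
      also have "\<dots> \<le> M" by (simp add: M_def)
      finally show ?case by (simp add: uS u0')
    next
      case (Suc k)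
      have "norm (u (Suc (Suc k)) x - u (Suc k) x) \<le> 1/4 * (M / 2 ^ k)"
        unfolding uS[of "Suc k"] uS[of k]
        using E1[OF cu[of "Suc k"] cu[of k] Suc.IH Suc.prems] by (simp add: uS)
      also have "\<dots> \<le> M / 2 ^ Suc k" by (simp add: M_def field_simps)
      finally show ?case .
    qed
    \<comment> \<open>Solves c M + C/4 = C/2, which is what the induction step for the derivatives
      requires.\<close>
    define C where "C = 4 * c * M"
    have C: "C \<ge> 0" "M \<ge> 0" using c by (auto simp: C_def M_def)
    have ddiff: "norm (d (Suc k) x h - d k x h) \<le> C * norm h / 2 ^ k" if "x \<in> U" for k x h
      using that
    proof (induction k arbitrary: x)
      case 0
      \<comment> \<open>\<open>I2\<close> is homogeneous in the pair (u, d), so comparing with the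
        zero pair bounds the first iterate.\<close>
      have z: "integral {0..1} (I2 (\<lambda>x. 0) (\<lambda>x h. 0) h x) = 0"
      proof -
        have "I2 (\<lambda>x. 0) (\<lambda>x h. 0) h x t = 0" if "t \<in> {0..1}" for t
        proof -
          have y: "\<sigma> t x \<in> U" by (rule \<sigma>U[OF 0 that])
          show ?thesis using A_diff[OF y, where e=0 and e'=0] DA_diff[OF y, where e=0 and e'=0] by (simp add: I2_def)
        qed
        then have "integral {0..1} (I2 (\<lambda>x. 0) (\<lambda>x h. 0) h x) = integral {0..1} (\<lambda>t::real. 0::'e)"
          by (intro integral_cong) auto
        then show ?thesis by simp
      qed
      have "norm (d (Suc 0) x h - 0) \<le> (c * M + 1/4 * 0) * norm h"
        using E2[of "u 0" "\<lambda>x. 0" "d 0" "\<lambda>x h. 0" M h 0 x] 0 cu[of 0] z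
        by (simp add: dS u0' M_def)
      also have "\<dots> \<le> C * norm h"
        using c C(2) by (intro mult_right_mono) (auto simp: C_def)
      finally show ?case by (simp add: u0')
    next
      case (Suc k)
      have 1: "d (Suc (Suc k)) x h = integral {0..1} (I2 (u (Suc k)) (d (Suc k)) h x)"
        and 2: "d (Suc k) x h = integral {0..1} (I2 (u k) (d k) h x)"
        by (simp_all only: dS[of "Suc k"] dS[of k])
      have "norm (integral {0..1} (I2 (u (Suc k)) (d (Suc k)) h x) - integral {0..1} (I2 (u k) (d k) h x))
          \<le> (c * (M / 2 ^ k) + 1/4 * (C / 2 ^ k)) * norm h"
      proof (rule E2[OF cu cu cd cd _ _ Suc.prems])
        show "norm (u (Suc k) y - u k y) \<le> M / 2 ^ k" if "y \<in> U" for y by (rule udiff[OF that])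
        show "norm (d (Suc k) y h - d k y h) \<le> C / 2 ^ k * norm h" if "y \<in> U" for y
          using Suc.IH[OF that] by simp
      qed
      then have "norm (d (Suc (Suc k)) x h - d (Suc k) x h) \<le> (c * (M / 2 ^ k) + 1/4 * (C / 2 ^ k)) * norm h"
        by (simp only: 1[symmetric] 2[symmetric])
      also have "c * (M / 2 ^ k) + 1/4 * (C / 2 ^ k) = C / 2 ^ Suc k"
        by (simp add: C_def field_simps)
      finally show ?case by simp
    qed
    define g where "g x = lim (\<lambda>k. u k x)" for x
    define g' where "g' x h = lim (\<lambda>k. d k x h)" for x h
    have ug: "norm (u k x - g x) \<le> 2 * M / 2 ^ k" "(\<lambda>k. u k x) \<longlonglongrightarrow> g x" if "x \<in> U" for k x
      unfolding g_def using geometric_Cauchy_convergent[OF udiff[OF that]] by blast+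
    have dg: "norm (d k x h - g' x h) \<le> 2 * C / 2 ^ k * norm h" "(\<lambda>k. d k x h) \<longlonglongrightarrow> g' x h" if "x \<in> U" for k x h
      unfolding g'_def using geometric_Cauchy_convergent[of "\<lambda>k. d k x h" "C * norm h"] ddiff[OF that] by (simp_all add: mult.assoc)
    have small: "\<forall>\<^sub>F k in sequentially. B / 2 ^ k < \<epsilon>" if "\<epsilon> > 0" for B \<epsilon> :: real
    proof (rule order_tendstoD(2)[OF _ that])
      have "(\<lambda>k. B * (1/2) ^ k) \<longlonglongrightarrow> B * 0" by (intro tendsto_intros LIMSEQ_power_zero) simp
      then show "(\<lambda>k. B / 2 ^ k) \<longlonglongrightarrow> 0" by (simp add: power_divide)
    qed
    have zero: "z = 0" if "\<And>k. norm z \<le> B / 2 ^ k" for z :: 'e and B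
    proof (rule ccontr)
      assume "z \<noteq> 0"
      then have "\<forall>\<^sub>F k in sequentially. B / 2 ^ k < norm z" by (intro small) simp
      then obtain k where "B / 2 ^ k < norm z" using eventually_happens by force
      then show False using that[of k] by simp
    qed
    have der_g: "(g has_derivative g' x) (at x)" if "x \<in> U" for x
    proof -
      \<comment> \<open>The theorem on sequences of derivatives yields some limit function;
        uniqueness of limits identifies it with g.\<close>
      have "\<exists>g. \<forall>x\<in>U. (\<lambda>n. u n x) \<longlonglongrightarrow> g x \<and> (g has_derivative g' x) (at x within U)"
      proof (rule has_derivative_sequence[OF U(2)])
        show "(u n has_derivative d n x) (at x within U)" if "x \<in> U" for n x
          using der[OF that] by (rule has_derivative_at_withinI)
        show "\<forall>\<^sub>F n in sequentially. \<forall>x\<in>U. \<forall>h. norm (d n x h - g' x h) \<le> e * norm h" if "e > 0" for e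
          using small[OF that, of "2 * C"]
          by eventually_elim (meson dg(1) less_imp_le mult_right_mono norm_ge_zero order_trans)
        show "(\<lambda>n. u n x0) \<longlonglongrightarrow> g x0" using ug(2)[OF U(3)] .
      qed (rule U(3))
      then obtain f where f: "\<And>x. x \<in> U \<Longrightarrow> (\<lambda>n. u n x) \<longlonglongrightarrow> f x" "\<And>x. x \<in> U \<Longrightarrow> (f has_derivative g' x) (at x within U)"
        by blast
      have fg: "f x = g x" if "x \<in> U" for x using LIMSEQ_unique[OF f(1)[OF that] ug(2)[OF that]] .
      have "(f has_derivative g' x) (at x)" using f(2)[OF that] at_within_open[OF that U(1)] by simp
      then show ?thesis by (rule has_derivative_transform_within_open[OF _ U(1) that fg])
    qed
    have cg: "continuous_on U g" using der_g cont_of_deriv by blast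
    have cg': "continuous_on U (\<lambda>x. g' x h)" for h
    proof (rule uniform_limit_theorem[where F=sequentially and f="\<lambda>k x. d k x h"])
      show "uniform_limit U (\<lambda>k x. d k x h) (\<lambda>x. g' x h) sequentially"
      proof (rule uniform_limitI)
        fix e :: real assume "e > 0"
        show "\<forall>\<^sub>F n in sequentially. \<forall>x\<in>U. dist (d n x h) (g' x h) < e"
          using small[OF \<open>e > 0\<close>, of "2 * C * norm h"]
        proof eventually_elim
          case (elim n)
          show ?case
          proof
            fix x assume "x \<in> U"
            have "dist (d n x h) (g' x h) \<le> 2 * C / 2 ^ n * norm h"
              unfolding dist_norm by (rule dg(1)[OF \<open>x \<in> U\<close>])
            then show "dist (d n x h) (g' x h) < e" using elim by simp
          qed
        qed
      qed
    qed (use cd in auto)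
    have g_eq: "g x = u0 + integral {0..1} (I1 g x)" if "x \<in> U" for x
    proof -
      have "norm (g x - (u0 + integral {0..1} (I1 g x))) \<le> (3 * M) / 2 ^ k" for k
      proof -
        have "norm (integral {0..1} (I1 (u k) x) - integral {0..1} (I1 g x)) \<le> 1/4 * (2 * M / 2 ^ k)"
          by (rule E1[OF cu cg ug(1) that])
        then have 1: "norm (u (Suc k) x - (u0 + integral {0..1} (I1 g x))) \<le> M / 2 ^ Suc k"
          by (simp add: uS)
        have 2: "norm (g x - u (Suc k) x) \<le> 2 * M / 2 ^ Suc k"
          using ug(1)[OF that, of "Suc k"] by (simp add: norm_minus_commute)
        have "norm (g x - (u0 + integral {0..1} (I1 g x))) \<le> 2 * M / 2 ^ Suc k + M / 2 ^ Suc k"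
          by (rule norm_diff_triangle_le[OF 2 1])
        also have "\<dots> \<le> (3 * M) / 2 ^ k" using C(2) by (simp add: field_simps)
        finally show ?thesis .
      qed
      from zero[OF this] show ?thesis by simp
    qed
    have g'_eq: "g' x h = integral {0..1} (I2 g g' h x)" if "x \<in> U" for x h
    proof -
      have "norm (g' x h - integral {0..1} (I2 g g' h x)) \<le> (2 * C + 2 * C) * norm h / 2 ^ k" for k
      proof -
        have "norm (integral {0..1} (I2 (u k) (d k) h x) - integral {0..1} (I2 g g' h x))
            \<le> (c * (2 * M / 2 ^ k) + 1/4 * (2 * C / 2 ^ k)) * norm h"
          by (rule E2[OF cu cg cd cg' ug(1) dg(1) that])
        also have "\<dots> = C * norm h / 2 ^ k" by (simp add: C_def field_simps)
        finally have 1: "norm (d (Suc k) x h - integral {0..1} (I2 g g' h x)) \<le> C * norm h / 2 ^ k"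
          by (simp add: dS)
        have 2: "norm (g' x h - d (Suc k) x h) \<le> C * norm h / 2 ^ k"
          using dg(1)[OF that, of "Suc k" h] by (simp add: norm_minus_commute)
        have "norm (g' x h - integral {0..1} (I2 g g' h x)) \<le> C * norm h / 2 ^ k + C * norm h / 2 ^ k"
          by (rule norm_diff_triangle_le[OF 2 1])
        also have "\<dots> \<le> (2 * C + 2 * C) * norm h / 2 ^ k" using C(1) by (simp add: field_simps)
        finally show ?thesis .
      qed
      from zero[OF this] show ?thesis by simp
    qed
    \<comment> \<open>The function t A(\<sigma> t x) h (g (\<sigma> t x)) is 0 at t = 0 and A x h (g
      x) at t = 1. Its derivative gives an integral comparable with the one for g' x h.\<close>
    have ftc: "A x h (g x) = integral {0..1} (\<lambda>t. A (\<sigma> t x) h (g (\<sigma> t x))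
        + t *\<^sub>R (DA (\<sigma> t x) (x - x0) h (g (\<sigma> t x)) + A (\<sigma> t x) h (g' (\<sigma> t x) (x - x0))))" if x: "x \<in> U" for x h
    proof -
      let ?f = "\<lambda>t. t *\<^sub>R A (\<sigma> t x) h (g (\<sigma> t x))"
      have "((\<lambda>t. A (\<sigma> t x) h (g (\<sigma> t x))
        + t *\<^sub>R (DA (\<sigma> t x) (x - x0) h (g (\<sigma> t x)) + A (\<sigma> t x) h (g' (\<sigma> t x) (x - x0))))
        has_integral (?f 1 - ?f 0)) {0..1}"
      proof (rule fundamental_theorem_of_calculus)
        fix t :: real assume t: "t \<in> {0..1}"
        have y: "\<sigma> t x \<in> U" by (rule \<sigma>U[OF x t])
        let ?V = "(\<lambda>t. \<sigma> t x) -` U"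
        have \<sigma>': "((\<lambda>t. \<sigma> t x) has_derivative (\<lambda>s. s *\<^sub>R (x - x0))) (at t)"
          unfolding \<sigma>_def by (auto intro!: derivative_eq_intros)
        have "open ?V" unfolding \<sigma>_def by (intro open_vimage U(1) continuous_intros)
        have "((\<lambda>t. A (\<sigma> t x) h (g (\<sigma> t x))) has_derivative
          (\<lambda>s. DA (\<sigma> t x) (s *\<^sub>R (x - x0)) h (g (\<sigma> t x)) + A (\<sigma> t x) 0 (g (\<sigma> t x))
            + A (\<sigma> t x) h (g' (\<sigma> t x) (s *\<^sub>R (x - x0))))) (at t)"
          by (rule A_has_derivative[OF \<open>open ?V\<close> _ _ \<sigma>' has_derivative_const
                has_derivative_compose[OF \<sigma>' der_g[OF y]]]) (use y U(5) in auto)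
        moreover have "DA (\<sigma> t x) (s *\<^sub>R (x - x0)) h (g (\<sigma> t x)) + A (\<sigma> t x) 0 (g (\<sigma> t x))
            + A (\<sigma> t x) h (g' (\<sigma> t x) (s *\<^sub>R (x - x0))) =
            s *\<^sub>R (DA (\<sigma> t x) (x - x0) h (g (\<sigma> t x)) + A (\<sigma> t x) h (g' (\<sigma> t x) (x - x0)))" for s
        proof -
          have yS: "\<sigma> t x \<in> S" using y U(5) by auto
          show ?thesis
            by (simp add: linear_cmul[OF has_derivative_linear[OF A_deriv[OF yS]]] linear_0[OF A_linear(2)[OF yS]]
                linear_cmul[OF has_derivative_linear[OF der_g[OF y]]] linear_cmul[OF A_linear(1)[OF yS]] scaleR_add_right)
        qed
        ultimately have "((\<lambda>t. A (\<sigma> t x) h (g (\<sigma> t x))) has_vector_derivative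
          (DA (\<sigma> t x) (x - x0) h (g (\<sigma> t x)) + A (\<sigma> t x) h (g' (\<sigma> t x) (x - x0)))) (at t)"
          by (simp add: has_vector_derivative_def)
        from has_vector_derivative_scaleR[OF DERIV_ident this]
        show "(?f has_vector_derivative (A (\<sigma> t x) h (g (\<sigma> t x))
        + t *\<^sub>R (DA (\<sigma> t x) (x - x0) h (g (\<sigma> t x)) + A (\<sigma> t x) h (g' (\<sigma> t x) (x - x0))))) (at t within {0..1})"
          by (auto intro!: has_vector_derivative_at_within simp: add.commute)
      qed simp
      then show ?thesis by (simp add: integral_unique \<sigma>_def)
    qed
    \<comment> \<open>In the radial direction h = x - x0 the integrands of \<open>g'_eq\<close> and
      \<open>ftc\<close> are identical, so the equation holds there before integrability is
      invoked.\<close>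
    have radial: "g' x (x - x0) = A x (x - x0) (g x)" if "x \<in> U" for x
      unfolding g'_eq[OF that] ftc[OF that]
      by (intro integral_cong) (simp add: I2_def algebra_simps)
    define e where "e x h = g' x h - A x h (g x)" for x h
    have e_eq: "e x h = integral {0..1} (\<lambda>t. t *\<^sub>R A (\<sigma> t x) (x - x0) (e (\<sigma> t x) h))" if x: "x \<in> U" for x h
    proof -
      let ?F = "\<lambda>t. A (\<sigma> t x) h (g (\<sigma> t x))
        + t *\<^sub>R (DA (\<sigma> t x) (x - x0) h (g (\<sigma> t x)) + A (\<sigma> t x) h (g' (\<sigma> t x) (x - x0)))"
      have cF: "continuous_on {0..1} ?F"
      proof -
        have "continuous_on (U \<times> {0..1}) (\<lambda>p. A (\<sigma> (snd p) (fst p)) h (g (\<sigma> (snd p) (fst p)))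
          + snd p *\<^sub>R (DA (\<sigma> (snd p) (fst p)) (x - x0) h (g (\<sigma> (snd p) (fst p)))
              + A (\<sigma> (snd p) (fst p)) h (g' (\<sigma> (snd p) (fst p)) (x - x0))))"
          using \<sigma>_img U(5)
          by (intro continuous_intros A_continuous_on DA_continuous_on cont_\<sigma> cont_comp cg cg') blast+
        from slice[where g="\<lambda>y t. A (\<sigma> t y) h (g (\<sigma> t y))
          + t *\<^sub>R (DA (\<sigma> t y) (x - x0) h (g (\<sigma> t y)) + A (\<sigma> t y) h (g' (\<sigma> t y) (x - x0)))", OF this x]
        show ?thesis .
      qed
      have "e x h = integral {0..1} (I2 g g' h x) - integral {0..1} ?F"
        unfolding e_def using g'_eq[OF x] ftc[OF x] by simp
      also have "\<dots> = integral {0..1} (\<lambda>t. I2 g g' h x t - ?F t)"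
        using slice[OF cI2[OF cg cg'] x] cF
        by (intro integral_diff[symmetric] integrable_continuous_interval) auto
      also have "\<dots> = integral {0..1} (\<lambda>t. t *\<^sub>R A (\<sigma> t x) (x - x0) (e (\<sigma> t x) h))"
      proof (rule integral_cong)
        fix t :: real assume t: "t \<in> {0..1}"
        let ?y = "\<sigma> t x" and ?\<xi> = "x - x0"
        have y: "?y \<in> U" by (rule \<sigma>U[OF x t])
        then have yS: "?y \<in> S" using U(5) by auto
        \<comment> \<open>Keeping the factor t, which satisfies t \<xi> = \<sigma> t x - x0, avoids
          a division at t = 0.\<close>
        have "t *\<^sub>R g' ?y ?\<xi> = g' ?y (?y - x0)"
          by (simp add: \<sigma>_def linear_cmul[OF has_derivative_linear[OF der_g[OF y]], unfolded \<sigma>_def])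
        also have "\<dots> = A ?y (?y - x0) (g ?y)" by (rule radial[OF y])
        also have "\<dots> = t *\<^sub>R A ?y ?\<xi> (g ?y)"
          by (simp add: linear_cmul[OF A_linear(2)[OF yS], symmetric]) (simp add: \<sigma>_def)
        finally have "A ?y h (t *\<^sub>R g' ?y ?\<xi>) = A ?y h (t *\<^sub>R A ?y ?\<xi> (g ?y))" by (rule arg_cong)
        then have rad: "t *\<^sub>R A ?y h (g' ?y ?\<xi>) = t *\<^sub>R A ?y h (A ?y ?\<xi> (g ?y))"
          by (simp add: linear_cmul[OF A_linear(1)[OF yS]])
        \<comment> \<open>The only use of integrability: it exchanges the two directions in the
          derivative of A, and the quadratic term with A h (A \<xi> g) cancels against the radial
          equation.\<close>
        have int: "t *\<^sub>R DA ?y h ?\<xi> (g ?y) - t *\<^sub>R DA ?y ?\<xi> h (g ?y) =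
            t *\<^sub>R A ?y h (A ?y ?\<xi> (g ?y)) - t *\<^sub>R A ?y ?\<xi> (A ?y h (g ?y))"
          using integrable[OF yS, where v=h and w="?\<xi>" and e="g ?y"] by (metis scaleR_diff_right)
        have "I2 g g' h x t - ?F t = (t *\<^sub>R DA ?y h ?\<xi> (g ?y) - t *\<^sub>R DA ?y ?\<xi> h (g ?y))
            - t *\<^sub>R A ?y h (g' ?y ?\<xi>) + t *\<^sub>R A ?y ?\<xi> (g' ?y h)"
          by (simp add: I2_def scaleR_add_right)
        also have "\<dots> = t *\<^sub>R A ?y ?\<xi> (g' ?y h) - t *\<^sub>R A ?y ?\<xi> (A ?y h (g ?y))"
          unfolding int rad by simp
        also have "\<dots> = t *\<^sub>R A ?y ?\<xi> (e ?y h)"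
          by (simp add: e_def A_diff[OF y] scaleR_diff_right)
        finally show "I2 g g' h x t - ?F t = t *\<^sub>R A ?y ?\<xi> (e ?y h)" .
      qed
      finally show ?thesis .
    qed
    have ce: "continuous_on U (\<lambda>x. e x h)" for h
      unfolding e_def using U(5) by (intro continuous_intros A_continuous_on cg cg') auto
    have e0: "e x h = 0" if "x \<in> U" for x h
    proof -
      \<comment> \<open>A bound for e on all of U, from |g' h| \<le> 2 C |h| and |g| \<le> 3 M;
        feeding it repeatedly into \<open>e_eq\<close> shrinks it to 0.\<close>
      define N where "N = 2 * C * norm h + K * norm h * (3 * M)"
      have "norm (e x h) \<le> N / 2 ^ k" if "x \<in> U" for k x
        using that
      proof (induction k arbitrary: x)
        case 0
        have "norm (g' x h) \<le> 2 * C * norm h" using dg(1)[OF 0, of 0 h] by (simp add: u0')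
        moreover have "norm (g x) \<le> 3 * M"
          using ug(1)[OF 0, of 0] norm_triangle_ineq2[of "g x" u0] by (simp add: u0' M_def norm_minus_commute)
        then have "norm (A x h (g x)) \<le> K * norm h * (3 * M)"
          using bA[OF 0, of h "g x"] K(1) by (meson mult_left_mono mult_nonneg_nonneg norm_ge_zero order_trans)
        ultimately show ?case
          using norm_triangle_ineq4[of "g' x h" "A x h (g x)"] by (simp add: e_def N_def)
      next
        case (Suc k)
        have cont: "continuous_on {0..1} (\<lambda>t. t *\<^sub>R A (\<sigma> t x) (x - x0) (e (\<sigma> t x) h))"
        proof -
          have "continuous_on (U \<times> {0..1}) (\<lambda>p. snd p *\<^sub>R A (\<sigma> (snd p) (fst p)) (fst p - x0) (e (\<sigma> (snd p) (fst p)) h))"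
            using \<sigma>_img U(5) by (intro continuous_intros A_continuous_on cont_\<sigma> cont_comp ce) blast
          from slice[where g="\<lambda>y t. t *\<^sub>R A (\<sigma> t y) (y - x0) (e (\<sigma> t y) h)", OF this Suc.prems]
          show ?thesis .
        qed
        have "norm (e x h) \<le> 1/4 * (N / 2 ^ k)"
          unfolding e_eq[OF Suc.prems]
        proof (rule int_bound[OF cont])
          fix t :: real assume t: "t \<in> {0..1}"
          have "norm (t *\<^sub>R A (\<sigma> t x) (x - x0) (e (\<sigma> t x) h)) \<le> norm (A (\<sigma> t x) (x - x0) (e (\<sigma> t x) h))"
            using t by (simp add: mult_left_le_one_le)
          also have "\<dots> \<le> 1/4 * (N / 2 ^ k)"
            by (rule bA'[OF Suc.prems t Suc.IH[OF \<sigma>U[OF Suc.prems t]]])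
          finally show "norm (t *\<^sub>R A (\<sigma> t x) (x - x0) (e (\<sigma> t x) h)) \<le> 1/4 * (N / 2 ^ k)" .
        qed
        also have "\<dots> \<le> N / 2 ^ Suc k" using C K(1) by (simp add: N_def field_simps)
        finally show ?case .
      qed
      from zero[OF this[OF that]] show ?thesis .
    qed
    have "g x0 = u0"
    proof -
      have "I1 g x0 t = 0" for t
        using linear_0[OF A_linear(2)[OF x0], of "g x0"] by (simp add: I1_def \<sigma>_def)
      then have "I1 g x0 = (\<lambda>t. 0)" by auto
      then show ?thesis using g_eq[OF U(3)] by simp
    qed
    moreover have "(g has_derivative (\<lambda>v. A x v (g x))) (at x)" if "x \<in> U" for x
    proof -
      have "g' x = (\<lambda>v. A x v (g x))" using e0[OF that] by (auto simp: e_def fun_eq_iff)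
      then show ?thesis using der_g[OF that] by simp
    qed
    ultimately show ?thesis by blast
  qed
  then show ?thesis using \<rho>(1) U(5) unfolding U_def by blast
qed

text \<open>A Gronwall argument for total derivatives. Near a zero, the mean value inequality bounds
  the maximum of the summed norms over a small closed ball by half of itself, so it is 0;
  connectedness does the rest. It serves both for solutions of total systems and for components of
  parallel forms.\<close>

lemma linear_differential_inequality_zero:
  fixes f :: "'i \<Rightarrow> 'a::euclidean_space \<Rightarrow> 'b::real_normed_vector"
  assumes S: "connected S" "open S" and I: "finite I"
    and der: "\<And>i x. i \<in> I \<Longrightarrow> x \<in> S \<Longrightarrow> (f i has_derivative f' i x) (at x)"
    and bound: "\<And>X. compact X \<Longrightarrow> X \<subseteq> S \<Longrightarrow>
      \<exists>C. \<forall>x\<in>X. \<forall>i\<in>I. \<forall>h. norm (f' i x h) \<le> C * (\<Sum>j\<in>I. norm (f j x)) * norm h"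
    and zero: "a \<in> S" "\<forall>i\<in>I. f i a = 0" and x: "x \<in> S"
  shows "\<forall>i\<in>I. f i x = 0"
proof (rule connected_induction_simple[where P="\<lambda>x. \<forall>i\<in>I. f i x = 0", OF S(1) zero(1) x zero(2)])
  fix p assume p: "p \<in> S"
  obtain r where r: "r > 0" "cball p r \<subseteq> S" using S(2) p open_contains_cball by blast
  obtain C0 where C0: "\<forall>x\<in>cball p r. \<forall>i\<in>I. \<forall>h. norm (f' i x h) \<le> C0 * (\<Sum>j\<in>I. norm (f j x)) * norm h"
    using bound[OF compact_cball r(2)] by blast
  \<comment> \<open>The bound from compactness may be negative when all norms vanish; monotonicity
    arguments need C \<ge> 0.\<close>
  define C where "C = max C0 0"
  have C: "norm (f' i x h) \<le> C * (\<Sum>j\<in>I. norm (f j x)) * norm h" if "x \<in> cball p r" "i \<in> I" for x i h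
  proof -
    have "norm (f' i x h) \<le> C0 * (\<Sum>j\<in>I. norm (f j x)) * norm h" using C0 that by blast
    also have "\<dots> \<le> C * (\<Sum>j\<in>I. norm (f j x)) * norm h"
      by (intro mult_right_mono) (auto simp: C_def intro: sum_nonneg)
    finally show ?thesis .
  qed
  define N where "N x = (\<Sum>j\<in>I. norm (f j x))" for x
  \<comment> \<open>Two points of the ball are at most 2 \<delta> apart; the mean value bounds,
    summed over I, then carry a factor at most 1/2.\<close>
  define \<delta> where "\<delta> = min r (1 / (4 * (real (card I) * C + 1)))"
  have nC: "real (card I) * C \<ge> 0" by (simp add: C_def)
  have \<delta>: "\<delta> > 0" "\<delta> \<le> r" using r(1) nC by (auto simp: \<delta>_def add_nonneg_pos)
  have n\<delta>: "real (card I) * C * (2 * \<delta>) \<le> 1/2"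
  proof -
    have "real (card I) * C * (2 * \<delta>) \<le> real (card I) * C * (2 * (1 / (4 * (real (card I) * C + 1))))"
      using nC by (intro mult_left_mono) (auto simp: \<delta>_def)
    also have "\<dots> \<le> 1/2" using nC by (simp add: field_simps)
    finally show ?thesis .
  qed
  have sub: "cball p \<delta> \<subseteq> cball p r" "cball p \<delta> \<subseteq> S" using \<delta>(2) r(2) by auto
  have "continuous_on (cball p \<delta>) N"
    unfolding N_def using sub(2)
    by (intro continuous_intros continuous_at_imp_continuous_on ballI)
       (auto intro!: has_derivative_continuous[OF der])
  then obtain m where m: "m \<in> cball p \<delta>" "\<forall>x\<in>cball p \<delta>. N x \<le> N m"
    using continuous_attains_sup[OF compact_cball, of p \<delta> N] \<delta>(1) by auto
  have "\<forall>i\<in>I. f i y = 0" if x: "x \<in> ball p \<delta>" and fx: "\<forall>i\<in>I. f i x = 0" and y: "y \<in> ball p \<delta>" for x y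
  proof -
    have "norm (f i m - f i x) \<le> (C * N m) * norm (m - x)" if i: "i \<in> I" for i
    proof (rule differentiable_bound[OF convex_cball])
      fix z assume z: "z \<in> cball p \<delta>"
      show "(f i has_derivative f' i z) (at z within cball p \<delta>)"
        using der[OF i] z sub(2) by (blast intro: has_derivative_at_withinI)
      show "onorm (f' i z) \<le> C * N m"
      proof (rule onorm_le)
        fix h
        have "norm (f' i z h) \<le> C * N z * norm h" using C[of z i h] z sub(1) i by (auto simp: N_def)
        also have "\<dots> \<le> C * N m * norm h" using m(2) z by (intro mult_right_mono mult_left_mono) (auto simp: C_def)
        finally show "norm (f' i z h) \<le> C * N m * norm h" .
      qed
    qed (use m x in auto)
    moreover have "norm (m - x) \<le> 2 * \<delta>"
      using m(1) x norm_triangle_ineq[of "m - p" "p - x"] by (simp add: dist_norm norm_minus_commute)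
    moreover have N0: "N m \<ge> 0" by (simp add: N_def sum_nonneg)
    ultimately have "norm (f i m) \<le> (C * N m) * (2 * \<delta>)" if "i \<in> I" for i
      using that fx by (smt (verit) C_def mult_left_mono mult_nonneg_nonneg diff_zero max.cobounded2)
    then have "N m \<le> real (card I) * ((C * N m) * (2 * \<delta>))"
      unfolding N_def by (intro sum_bounded_above) (simp add: N_def)
    also have "\<dots> = (real (card I) * C * (2 * \<delta>)) * N m" by simp
    also have "\<dots> \<le> 1/2 * N m" using n\<delta> N0 by (intro mult_right_mono)
    finally have "N m = 0" using N0 by simp
    then have "N y \<le> 0" using m(2) y by (metis ball_subset_cball subsetD)
    then have "N y = 0" using sum_nonneg[of I "\<lambda>j. norm (f j y)"] by (simp add: N_def)
    then show ?thesis by (simp add: N_def sum_nonneg_eq_0_iff I)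
  qed
  then show "\<exists>T. openin (top_of_set S) T \<and> p \<in> T \<and> (\<forall>x\<in>T. \<forall>y\<in>T. (\<forall>i\<in>I. f i x = 0) \<longrightarrow> (\<forall>i\<in>I. f i y = 0))"
    using \<delta>(1) sub(2) S(2)
    by (intro exI[of _ "ball p \<delta>"]) (auto simp: openin_open_eq intro: subsetD[OF ball_subset_cball])
qed

section \<open>Uniqueness of solutions, and initial values at arbitrary points of a ball\<close>

context total_system
begin

definition solves :: "'a set \<Rightarrow> ('a \<Rightarrow> 'e) \<Rightarrow> bool" where
  "solves T u \<longleftrightarrow> (\<forall>x\<in>T. (u has_derivative (\<lambda>v. A x v (u x))) (at x))"

lemma solves_subset: "solves T u \<Longrightarrow> T' \<subseteq> T \<Longrightarrow> solves T' u"
  unfolding solves_def by blast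

lemma solves_lincomb:
  assumes "solves T u" "solves T w" "T \<subseteq> S"
  shows "solves T (\<lambda>x. a *\<^sub>R u x + b *\<^sub>R w x)"
  unfolding solves_def
proof
  fix x assume x: "x \<in> T"
  then have "x \<in> S" using assms(3) by auto
  from A_linear(1)[OF this] have "A x v (a *\<^sub>R u x + b *\<^sub>R w x) = a *\<^sub>R A x v (u x) + b *\<^sub>R A x v (w x)" for v
    by (simp add: linear_add linear_cmul)
  then show "((\<lambda>x. a *\<^sub>R u x + b *\<^sub>R w x) has_derivative (\<lambda>v. A x v (a *\<^sub>R u x + b *\<^sub>R w x))) (at x)"
    using assms(1,2) x unfolding solves_def by (auto intro!: derivative_eq_intros)
qed

lemma solves_zero:
  assumes "solves T u" "T \<subseteq> S" "open T" "connected T" "a \<in> T" "u a = 0" "x \<in> T"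
  shows "u x = 0"
proof -
  have "\<forall>i\<in>{()}. u x = 0"
  proof (rule linear_differential_inequality_zero[OF assms(4,3), where a=a and f="\<lambda>i. u" and f'="\<lambda>i x v. A x v (u x)"])
    show "(u has_derivative (\<lambda>v. A x v (u x))) (at x)" if "x \<in> T" for x
      using assms(1) that unfolding solves_def by blast
    show "\<exists>C. \<forall>x\<in>X. \<forall>i\<in>{()}. \<forall>h. norm (A x h (u x)) \<le> C * (\<Sum>j\<in>{()}. norm (u x)) * norm h"
      if X: "compact X" "X \<subseteq> T" for X
    proof -
      have "X \<subseteq> S" using X(2) assms(2) by auto
      from A_bound[OF X(1) this] obtain K
        where K: "K \<ge> 0" "\<And>x v e. x \<in> X \<Longrightarrow> norm (A x v e) \<le> K * norm v * norm e" by blast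
      have "\<forall>x\<in>X. \<forall>i\<in>{()}. \<forall>h. norm (A x h (u x)) \<le> K * (\<Sum>j\<in>{()}. norm (u x)) * norm h"
      proof (intro ballI allI)
        fix x i h assume "x \<in> X"
        from K(2)[OF this, of h "u x"]
        show "norm (A x h (u x)) \<le> K * (\<Sum>j\<in>{()}. norm (u x)) * norm h" by (simp add: mult_ac)
      qed
      then show ?thesis by blast
    qed
  qed (use assms in auto)
  then show ?thesis by simp
qed

lemma solves_unique:
  assumes "solves T u" "solves T w" "T \<subseteq> S" "open T" "connected T" "a \<in> T" "u a = w a" "x \<in> T"
  shows "u x = w x"
  using solves_zero[OF solves_lincomb[OF assms(1,2,3), of 1 "-1"] assms(3-6), of x] assms(7,8) by simp

text \<open>By uniqueness, the map from the value at x0 to the value at q is linear and injective,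
  hence onto in finite dimension. So one ball serves every initial point q in it, as continuation
  requires.\<close>

theorem frobenius_ball:
  assumes integrable: "\<And>x v w e. x \<in> S \<Longrightarrow> DA x v w e - DA x w v e = A x v (A x w e) - A x w (A x v e)"
    and x0: "x0 \<in> S"
  obtains r where "r > 0" "ball x0 r \<subseteq> S"
    "\<And>q e. q \<in> ball x0 r \<Longrightarrow> \<exists>u. u q = e \<and> solves (ball x0 r) u"
proof -
  obtain r where r: "r > 0" "ball x0 r \<subseteq> S"
    "\<And>u0. \<exists>u. u x0 = u0 \<and> solves (ball x0 r) u"
    using frobenius[OF integrable x0] unfolding solves_def by blast
  from choice[of "\<lambda>u0 u. u x0 = u0 \<and> solves (ball x0 r) u"] r(3)
  obtain sol where sol: "\<And>u0. sol u0 x0 = u0" "\<And>u0. solves (ball x0 r) (sol u0)" by blast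
  have "\<exists>u. u q = e \<and> solves (ball x0 r) u" if q: "q \<in> ball x0 r" for q e
  proof -
    have lin: "linear (\<lambda>u0. sol u0 q)"
    proof (rule linearI)
      fix u w
      have "sol (u + w) q = 1 *\<^sub>R sol u q + 1 *\<^sub>R sol w q"
        by (rule solves_unique[OF sol(2) solves_lincomb[OF sol(2) sol(2) r(2)] r(2) open_ball connected_ball centre_in_ball[THEN iffD2, OF r(1)] _ q])
           (simp add: sol(1))
      then show "sol (u + w) q = sol u q + sol w q" by simp
    next
      fix c u
      have "sol (c *\<^sub>R u) q = c *\<^sub>R sol u q + 0 *\<^sub>R sol u q"
        by (rule solves_unique[OF sol(2) solves_lincomb[OF sol(2) sol(2) r(2)] r(2) open_ball connected_ball centre_in_ball[THEN iffD2, OF r(1)] _ q])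
           (simp add: sol(1))
      then show "sol (c *\<^sub>R u) q = c *\<^sub>R sol u q" by simp
    qed
    \<comment> \<open>A solution vanishing at q vanishes on the whole ball, in particular at
      x0.\<close>
    have "inj (\<lambda>u0. sol u0 q)"
    proof (subst linear_injective_0[OF lin], intro allI impI)
      fix u0 assume "sol u0 q = 0"
      have "sol u0 x0 = 0"
        by (rule solves_zero[OF sol(2) r(2) open_ball connected_ball q \<open>sol u0 q = 0\<close>]) (use r(1) in simp)
      then show "u0 = 0" by (simp add: sol(1))
    qed
    then have "surj (\<lambda>u0. sol u0 q)" by (rule linear_inj_imp_surj[OF lin])
    then obtain u0 where "e = sol u0 q" by (rule surjE)
    then show ?thesis using sol(2) by (intro exI[of _ "sol u0"]) simp
  qed
  then show ?thesis by (rule that[OF r(1,2)])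
qed

end

section \<open>Continuation along paths\<close>

definition same_germ :: "'m::topological_space \<Rightarrow> ('m \<Rightarrow> 'b) \<Rightarrow> ('m \<Rightarrow> 'b) \<Rightarrow> bool" where
  "same_germ p f g \<longleftrightarrow> (\<exists>V. open V \<and> p \<in> V \<and> (\<forall>x\<in>V. f x = g x))"

lemma same_germ_refl [simp]: "same_germ p f f"
  unfolding same_germ_def using open_UNIV by blast

lemma same_germ_sym: "same_germ p f g \<Longrightarrow> same_germ p g f"
  unfolding same_germ_def by metis

lemma same_germ_trans: "same_germ p f g \<Longrightarrow> same_germ p g h \<Longrightarrow> same_germ p f h"
proof -
  assume "same_germ p f g" "same_germ p g h"
  then obtain V V' where "open V" "p \<in> V" "\<forall>x\<in>V. f x = g x" "open V'" "p \<in> V'" "\<forall>x\<in>V'. g x = h x"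
    unfolding same_germ_def by blast
  then show ?thesis
    unfolding same_germ_def by (intro exI[of _ "V \<inter> V'"]) auto
qed

lemma same_germ_value: "same_germ p f g \<Longrightarrow> f p = g p"
  unfolding same_germ_def by blast

lemma continuous_on_real_nbhd:
  fixes c :: "real \<Rightarrow> 'm::topological_space"
  assumes "continuous_on K c" "t \<in> K" "open W" "c t \<in> W"
  obtains \<epsilon> where "\<epsilon> > 0" "\<And>s. s \<in> K \<Longrightarrow> \<bar>s - t\<bar> < \<epsilon> \<Longrightarrow> c s \<in> W"
proof -
  obtain B where B: "open B" "t \<in> B" "\<forall>y\<in>K. y \<in> B \<longrightarrow> c y \<in> W"
    using assms unfolding continuous_on_topological by metis
  then obtain \<epsilon> where "\<epsilon> > 0" "ball t \<epsilon> \<subseteq> B" using open_contains_ball by blast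
  then show ?thesis using that[of \<epsilon>] B(3) by (auto simp: subset_iff dist_real_def abs_minus_commute)
qed

lemma real_connected_induction:
  fixes K :: "real set"
  assumes "connected K" "a \<in> K" "b \<in> K" "P a"
    and step: "\<And>t. t \<in> K \<Longrightarrow> \<exists>\<epsilon>>0. \<forall>x\<in>K. \<forall>y\<in>K. \<bar>x - t\<bar> < \<epsilon> \<longrightarrow> \<bar>y - t\<bar> < \<epsilon> \<longrightarrow> P x \<longrightarrow> P y"
  shows "P b"
proof (rule connected_induction_simple[where P=P, OF assms(1-4)])
  fix t assume "t \<in> K"
  then obtain \<epsilon> where e: "\<epsilon> > 0"
    "\<forall>x\<in>K. \<forall>y\<in>K. \<bar>x - t\<bar> < \<epsilon> \<longrightarrow> \<bar>y - t\<bar> < \<epsilon> \<longrightarrow> P x \<longrightarrow> P y"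
    using step by blast
  show "\<exists>T. openin (top_of_set K) T \<and> t \<in> T \<and> (\<forall>x\<in>T. \<forall>y\<in>T. P x \<longrightarrow> P y)"
    using e \<open>t \<in> K\<close>
    by (intro exI[of _ "K \<inter> ball t \<epsilon>"]) (auto simp: openin_open_Int dist_real_def abs_minus_commute)
qed

text \<open>\<open>S U f\<close> reads: f is a section over U. The axioms are gluing and local
  triviality: over suitable W each germ extends to exactly one section. In other words, the space of
  germs is a covering space.\<close>

locale continuation =
  fixes S :: "'m::topological_space set \<Rightarrow> ('m \<Rightarrow> 'b) \<Rightarrow> bool"
  assumes local: "\<And>U f. open U \<Longrightarrow>
      (\<And>p. p \<in> U \<Longrightarrow> \<exists>V g. open V \<and> p \<in> V \<and> S V g \<and> (\<forall>q\<in>V. f q = g q)) \<Longrightarrow> S U f"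
    and nbhd: "\<And>p. \<exists>W. open W \<and> p \<in> W \<and> path_connected W \<and>
      (\<forall>q V f. q \<in> W \<longrightarrow> open V \<longrightarrow> q \<in> V \<longrightarrow> S V f \<longrightarrow> (\<exists>g. S W g \<and> same_germ q g f)) \<and>
      (\<forall>g h q. S W g \<longrightarrow> S W h \<longrightarrow> q \<in> W \<longrightarrow> same_germ q g h \<longrightarrow> (\<forall>x\<in>W. g x = h x))"
begin

definition section_at :: "'m \<Rightarrow> ('m \<Rightarrow> 'b) \<Rightarrow> bool" where
  "section_at p f \<longleftrightarrow> (\<exists>V. open V \<and> p \<in> V \<and> S V f)"

definition germ_nbhd :: "'m set \<Rightarrow> bool" where
  "germ_nbhd W \<longleftrightarrow> open W \<and> path_connected W \<and>
     (\<forall>q f. q \<in> W \<longrightarrow> section_at q f \<longrightarrow> (\<exists>g. S W g \<and> same_germ q g f)) \<and>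
     (\<forall>g h q x. S W g \<longrightarrow> S W h \<longrightarrow> q \<in> W \<longrightarrow> same_germ q g h \<longrightarrow> x \<in> W \<longrightarrow> g x = h x)"

lemma germ_nbhdD:
  assumes "germ_nbhd W"
  shows "open W" "path_connected W"
    "q \<in> W \<Longrightarrow> section_at q f \<Longrightarrow> \<exists>g. S W g \<and> same_germ q g f"
    "S W g \<Longrightarrow> S W h \<Longrightarrow> q \<in> W \<Longrightarrow> same_germ q g h \<Longrightarrow> x \<in> W \<Longrightarrow> g x = h x"
  using assms unfolding germ_nbhd_def by blast+

lemma germ_nbhd_exists: "\<exists>W. germ_nbhd W \<and> p \<in> W"
proof -
  obtain W where W: "open W" "p \<in> W" "path_connected W"
      "\<forall>q V f. q \<in> W \<longrightarrow> open V \<longrightarrow> q \<in> V \<longrightarrow> S V f \<longrightarrow> (\<exists>g. S W g \<and> same_germ q g f)"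
      "\<forall>g h q. S W g \<longrightarrow> S W h \<longrightarrow> q \<in> W \<longrightarrow> same_germ q g h \<longrightarrow> (\<forall>x\<in>W. g x = h x)"
    using nbhd[of p] by blast
  have "\<exists>g. S W g \<and> same_germ q g f" if q: "q \<in> W" and f: "section_at q f" for q f
  proof -
    obtain V where "open V" "q \<in> V" "S V f" using f unfolding section_at_def by blast
    then show ?thesis using W(4) q by simp
  qed
  moreover have "g x = h x" if "S W g" "S W h" "q \<in> W" "same_germ q g h" "x \<in> W" for g h q x
    using W(5) that by simp
  ultimately have "germ_nbhd W" unfolding germ_nbhd_def using W(1,3) by simp
  then show ?thesis using W(2) by (intro exI[of _ W]) simp
qed

text \<open>A lift of c to the space of germs without a topology on that space: F t represents the
  germ over c t, and continuity means that the germs at nearby parameters all come from the one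
  function F t.\<close>

definition lift_on :: "(real \<Rightarrow> 'm) \<Rightarrow> real set \<Rightarrow> (real \<Rightarrow> 'm \<Rightarrow> 'b) \<Rightarrow> bool" where
  "lift_on c K F \<longleftrightarrow> (\<forall>t\<in>K. section_at (c t) (F t) \<and>
     (\<exists>\<epsilon>>0. \<forall>s\<in>K. \<bar>s - t\<bar> < \<epsilon> \<longrightarrow> same_germ (c s) (F s) (F t)))"

lemma lift_onD: "lift_on c K F \<Longrightarrow> t \<in> K \<Longrightarrow> section_at (c t) (F t)"
  unfolding lift_on_def by blast

lemma lift_on_subset: "lift_on c K F \<Longrightarrow> L \<subseteq> K \<Longrightarrow> lift_on c L F"
  unfolding lift_on_def by (meson subsetD)

lemma lift_on_const:
  assumes "S W g" "open W" "c ` K \<subseteq> W"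
  shows "lift_on c K (\<lambda>t. g)"
  unfolding lift_on_def section_at_def using assms by (auto intro: exI[of _ 1])

text \<open>Near a parameter t both lifts are germs of sections f and g over a common W, so
  agreement at one nearby parameter forces f = g on W and agreement at all others.\<close>

lemma lift_on_unique:
  assumes F: "lift_on c K F" and G: "lift_on c K G" and c: "continuous_on K c" "connected K"
    and "a \<in> K" "b \<in> K" "same_germ (c a) (F a) (G a)"
  shows "same_germ (c b) (F b) (G b)"
proof (rule real_connected_induction[OF c(2) assms(5,6), where P="\<lambda>t. same_germ (c t) (F t) (G t)"])
  show "same_germ (c a) (F a) (G a)" by fact
  fix t assume t: "t \<in> K"
  obtain W where W0: "germ_nbhd W" "c t \<in> W" using germ_nbhd_exists by blast
    note W = germ_nbhdD(1)[OF W0(1)] W0(2) germ_nbhdD(2-4)[OF W0(1)]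
  obtain f where f: "S W f" "same_germ (c t) f (F t)" using W(4)[OF W(2) lift_onD[OF F t]] by blast
  obtain g where g: "S W g" "same_germ (c t) g (G t)" using W(4)[OF W(2) lift_onD[OF G t]] by blast
  obtain V where V: "open V" "c t \<in> V" "\<forall>x\<in>V. f x = F t x" using f(2) unfolding same_germ_def by blast
  obtain V' where V': "open V'" "c t \<in> V'" "\<forall>x\<in>V'. g x = G t x" using g(2) unfolding same_germ_def by blast
  obtain e1 where e1: "e1 > 0" "\<And>s. s \<in> K \<Longrightarrow> \<bar>s - t\<bar> < e1 \<Longrightarrow> c s \<in> W \<inter> V \<inter> V'"
    using continuous_on_real_nbhd[OF c(1) t, of "W \<inter> V \<inter> V'"] W V V' by (metis IntI open_Int)
  obtain e2 where e2: "e2 > 0" "\<And>s. s \<in> K \<Longrightarrow> \<bar>s - t\<bar> < e2 \<Longrightarrow> same_germ (c s) (F s) (F t)"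
    using F t unfolding lift_on_def by blast
  obtain e3 where e3: "e3 > 0" "\<And>s. s \<in> K \<Longrightarrow> \<bar>s - t\<bar> < e3 \<Longrightarrow> same_germ (c s) (G s) (G t)"
    using G t unfolding lift_on_def by blast
  define \<epsilon> where "\<epsilon> = min e1 (min e2 e3)"
  have Ff: "same_germ (c s) (F s) f" and Gg: "same_germ (c s) (G s) g" and cW: "c s \<in> W"
    if "s \<in> K" "\<bar>s - t\<bar> < \<epsilon>" for s
  proof -
    have s: "\<bar>s - t\<bar> < e1" "\<bar>s - t\<bar> < e2" "\<bar>s - t\<bar> < e3" using that(2) by (auto simp: \<epsilon>_def)
    show "c s \<in> W" using e1(2)[OF that(1) s(1)] by blast
    have "same_germ (c s) (F t) f" "same_germ (c s) (G t) g"
      using e1(2)[OF that(1) s(1)] V V' unfolding same_germ_def by (metis IntD1 IntD2)+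
    then show "same_germ (c s) (F s) f" "same_germ (c s) (G s) g"
      using same_germ_trans e2(2)[OF that(1) s(2)] e3(2)[OF that(1) s(3)] by blast+
  qed
  show "\<exists>\<epsilon>>0. \<forall>x\<in>K. \<forall>y\<in>K. \<bar>x - t\<bar> < \<epsilon> \<longrightarrow> \<bar>y - t\<bar> < \<epsilon> \<longrightarrow>
      same_germ (c x) (F x) (G x) \<longrightarrow> same_germ (c y) (F y) (G y)"
  proof (intro exI[of _ \<epsilon>] conjI ballI impI)
    show "\<epsilon> > 0" using e1(1) e2(1) e3(1) by (simp add: \<epsilon>_def)
    fix x y assume x: "x \<in> K" "\<bar>x - t\<bar> < \<epsilon>" and y: "y \<in> K" "\<bar>y - t\<bar> < \<epsilon>"
      and "same_germ (c x) (F x) (G x)"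
    then have "same_germ (c x) f g"
      using Ff[OF x] Gg[OF x] same_germ_trans same_germ_sym by blast
    then have "f z = g z" if "z \<in> W" for z using W(5)[OF f(1) g(1) cW[OF x] _ that] by blast
    then have "same_germ (c y) f g" using W(1) cW[OF y] unfolding same_germ_def by blast
    then show "same_germ (c y) (F y) (G y)"
      using Ff[OF y] Gg[OF y] same_germ_trans same_germ_sym by blast
  qed
qed

text \<open>Induction over the end time of the lift: the step near t is possible in both directions
  because W contains the path near t.\<close>

lemma lift_exists:
  assumes c: "continuous_on {0..1} c" and f0: "section_at (c 0) f0"
  obtains F where "lift_on c {0..1} F" "F 0 = f0"
proof -
  let ?P = "\<lambda>T. \<exists>F. lift_on c {0..T} F \<and> F 0 = f0"
  have "?P 1"
  proof (rule real_connected_induction[where K="{0..1}" and a=0 and P="?P"])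
    show "?P 0" using f0 by (intro exI[of _ "\<lambda>t. f0"]) (auto simp: lift_on_def intro: exI[of _ 1])
    fix t :: real assume t: "t \<in> {0..1}"
    obtain W where W0: "germ_nbhd W" "c t \<in> W" using germ_nbhd_exists by blast
    note W = germ_nbhdD(1)[OF W0(1)] W0(2) germ_nbhdD(2-4)[OF W0(1)]
    obtain \<epsilon> where \<epsilon>: "\<epsilon> > 0" "\<And>s. s \<in> {0..1} \<Longrightarrow> \<bar>s - t\<bar> < \<epsilon> \<Longrightarrow> c s \<in> W"
      using continuous_on_real_nbhd[OF c t W(1,2)] by metis
    have "?P y" if x: "x \<in> {0..1}" "\<bar>x - t\<bar> < \<epsilon>" and y: "y \<in> {0..1}" "\<bar>y - t\<bar> < \<epsilon>" and Px: "?P x" for x y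
    proof -
      from Px obtain F where F: "lift_on c {0..x} F" "F 0 = f0" by blast
      show "?P y"
      proof (cases "y \<le> x")
        case True
        then have "lift_on c {0..y} F" by (intro lift_on_subset[OF F(1)]) auto
        then show ?thesis using F(2) by blast
      next
        case False
        have x0: "x \<in> {0..x}" using x by simp
        obtain g where g: "S W g" "same_germ (c x) g (F x)"
          using W(4)[OF \<epsilon>(2)[OF x] lift_onD[OF F(1) x0]] by blast
        obtain V where V: "open V" "c x \<in> V" "\<forall>z\<in>V. g z = F x z" using g(2) unfolding same_germ_def by blast
        obtain e1 where e1: "e1 > 0" "\<And>s. s \<in> {0..1} \<Longrightarrow> \<bar>s - x\<bar> < e1 \<Longrightarrow> c s \<in> V"
          using continuous_on_real_nbhd[OF c x(1) V(1,2)] by metis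
        \<comment> \<open>Past x the lift is carried on by the single section g, which agrees with F
          x near c x.\<close>
        define F' where "F' s = (if s \<le> x then F s else g)" for s
        have "lift_on c {0..y} F'"
          unfolding lift_on_def
        proof (intro ballI conjI)
          fix s assume s: "s \<in> {0..y}"
          have sW: "c s \<in> W" if "s > x"
            using \<epsilon>(2)[of s] s y x that by auto
          show "section_at (c s) (F' s)"
          proof (cases "s \<le> x")
            case True
            then show ?thesis using lift_onD[OF F(1), of s] s by (simp add: F'_def)
          next
            case False
            then show ?thesis using g(1) W(1) sW by (auto simp: F'_def section_at_def)
          qed
          show "\<exists>\<epsilon>>0. \<forall>s'\<in>{0..y}. \<bar>s' - s\<bar> < \<epsilon> \<longrightarrow> same_germ (c s') (F' s') (F' s)"
          proof (cases "s > x")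
            case True
            then show ?thesis by (intro exI[of _ "s - x"]) (auto simp: F'_def)
          next
            case False
            then have "s \<in> {0..x}" using s by auto
            then obtain e2 where e2: "e2 > 0"
              "\<And>s'. s' \<in> {0..x} \<Longrightarrow> \<bar>s' - s\<bar> < e2 \<Longrightarrow> same_germ (c s') (F s') (F s)"
              using F(1) unfolding lift_on_def by blast
            \<comment> \<open>Left of x only F matters, so the radius stops at x. At s = x it must
              also keep the path where g and F x agree.\<close>
            define e3 where "e3 = (if s < x then min e2 (x - s) else min e1 e2)"
            have "same_germ (c s') (F' s') (F' s)" if s': "s' \<in> {0..y}" "\<bar>s' - s\<bar> < e3" for s'
            proof (cases "s' \<le> x")
              case True
              then show ?thesis using e2(2)[of s'] s' False by (auto simp: F'_def e3_def split: if_splits)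
            next
              case False': False
              then have "s = x" "\<bar>s' - x\<bar> < e1" using s' False by (auto simp: e3_def split: if_splits)
              then have "c s' \<in> V" using e1(2)[of s'] s' y by auto
              then have "same_germ (c s') g (F x)" using V unfolding same_germ_def by blast
              then show ?thesis using False' \<open>s = x\<close> by (simp add: F'_def)
            qed
            moreover have "e3 > 0" using e1 e2 by (simp add: e3_def)
            ultimately show ?thesis by blast
          qed
        qed
        moreover have "F' 0 = f0" using F(2) x by (simp add: F'_def)
        ultimately show ?thesis by blast
      qed
    qed
    then show "\<exists>\<epsilon>>0. \<forall>x\<in>{0..1}. \<forall>y\<in>{0..1}. \<bar>x - t\<bar> < \<epsilon> \<longrightarrow> \<bar>y - t\<bar> < \<epsilon> \<longrightarrow> ?P x \<longrightarrow> ?P y"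
      using \<epsilon>(1) by blast
  qed auto
  then show ?thesis using that by blast
qed

text \<open>Lifts along the paths of a free homotopy from a loop to a constant loop: the end values of
  the lifts form a lift of the track of the base point.\<close>

lemma loop_lift_trivial:
  assumes hom: "homotopic_loops UNIV c (\<lambda>t. c 0)" and F: "lift_on c {0..1} F"
  shows "same_germ (c 0) (F 1) (F 0)"
proof -
  obtain h :: "real \<times> real \<Rightarrow> 'm" where h': "continuous_on ({0..1} \<times> {0..1}) h" "\<forall>x\<in>{0..1}. h (0, x) = c x"
    "\<forall>x\<in>{0..1}. h (1, x) = c 0" "\<forall>s\<in>{0..1}. h (s, 1) = h (s, 0)"
    using hom unfolding homotopic_loops pathstart_def pathfinish_def comp_def by blast
  have h: "continuous_on ({0..1} \<times> {0..1}) h" "\<And>x. x \<in> {0..1} \<Longrightarrow> h (0, x) = c x"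
    "\<And>x. x \<in> {0..1} \<Longrightarrow> h (1, x) = c 0" "\<And>s. s \<in> {0..1} \<Longrightarrow> h (s, 1) = h (s, 0)"
    using h' by blast+
  have c_loop: "c 1 = c 0" using h(4)[of 0] h(2)[of 1] h(2)[of 0] by simp
  have hs: "continuous_on {0..1} (\<lambda>s. h (s, t))" if "t \<in> {0..1}" for t
    by (rule continuous_on_compose2[OF h(1)]) (use that in \<open>auto intro!: continuous_intros\<close>)
  have ht: "continuous_on {0..1} (\<lambda>t. h (s, t))" if "s \<in> {0..1}" for s
    by (rule continuous_on_compose2[OF h(1)]) (use that in \<open>auto intro!: continuous_intros\<close>)
  have zero: "(0::real) \<in> {0..1}" and one: "(1::real) \<in> {0..1}" by auto
  have "section_at (h (0, 0)) (F 0)" using lift_onD[OF F zero] h(2)[OF zero] by simp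
  \<comment> \<open>The homotopy is free, so the base point h(s, 0) itself runs along a loop, which
    has to be lifted too.\<close>
  then obtain G where G: "lift_on (\<lambda>s. h (s, 0)) {0..1} G" "G 0 = F 0"
    using lift_exists[OF hs[OF zero]] by metis
  have "\<exists>H. lift_on (\<lambda>t. h (s, t)) {0..1} H \<and> H 0 = G s" if "s \<in> {0..1}" for s
    using lift_exists[OF ht[OF that] lift_onD[OF G(1) that]] by metis
  then obtain H where H: "\<And>s. s \<in> {0..1} \<Longrightarrow> lift_on (\<lambda>t. h (s, t)) {0..1} (H s)" "\<And>s. s \<in> {0..1} \<Longrightarrow> H s 0 = G s"
    by metis
  \<comment> \<open>The end germs of the row lifts depend continuously on s. The claim is carried
    from time 0 to time 1 by induction on the time, for fixed s0; the size of \<epsilon> may shrink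
    on the way.\<close>
  have R: "\<exists>\<epsilon>>0. \<forall>s\<in>{0..1}. \<bar>s - s0\<bar> < \<epsilon> \<longrightarrow> same_germ (h (s, 1)) (H s 1) (H s0 1)"
    if s0: "s0 \<in> {0..1}" for s0
  proof -
    let ?P = "\<lambda>T. \<exists>\<epsilon>>0. \<forall>s\<in>{0..1}. \<bar>s - s0\<bar> < \<epsilon> \<longrightarrow> same_germ (h (s, T)) (H s T) (H s0 T)"
    have base: "\<exists>\<epsilon>>0. \<forall>s\<in>{0..1}. \<bar>s - s0\<bar> < \<epsilon> \<longrightarrow> same_germ (h (s, 0)) (H s 0) (H s0 0)"
      using G(1) s0 H(2) unfolding lift_on_def by auto
    have "\<exists>\<epsilon>>0. \<forall>x\<in>{0..1}. \<forall>y\<in>{0..1}. \<bar>x - t\<bar> < \<epsilon> \<longrightarrow> \<bar>y - t\<bar> < \<epsilon> \<longrightarrow> ?P x \<longrightarrow> ?P y"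
      if t: "t \<in> {0..1}" for t
    proof -
    obtain W where W0: "germ_nbhd W" "h (s0, t) \<in> W" using germ_nbhd_exists by blast
    note W = germ_nbhdD(1)[OF W0(1)] W0(2) germ_nbhdD(2-4)[OF W0(1)]
    have "\<exists>\<epsilon>>0. \<forall>s\<in>{0..1}. \<forall>T\<in>{0..1}. \<bar>s - s0\<bar> < \<epsilon> \<longrightarrow> \<bar>T - t\<bar> < \<epsilon> \<longrightarrow> h (s, T) \<in> W"
    proof -
      obtain B where B: "open B" "(s0, t) \<in> B" "\<forall>y\<in>{0..1} \<times> {0..1}. y \<in> B \<longrightarrow> h y \<in> W"
        using h(1) W(1,2) s0 t unfolding continuous_on_topological by (metis SigmaI)
      then obtain C D where "open C" "open D" "s0 \<in> C" "t \<in> D" "C \<times> D \<subseteq> B"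
        by (metis open_prod_elim mem_Sigma_iff)
      then obtain e e' where "e > 0" "ball s0 e \<subseteq> C" "e' > 0" "ball t e' \<subseteq> D"
        by (meson open_contains_ball)
      then show ?thesis using B(3) \<open>C \<times> D \<subseteq> B\<close>
        by (intro exI[of _ "min e e'"]) (auto simp: subset_iff dist_real_def abs_minus_commute)
    qed
    then obtain e where e: "e > 0"
      "\<And>s T. s \<in> {0..1} \<Longrightarrow> T \<in> {0..1} \<Longrightarrow> \<bar>s - s0\<bar> < e \<Longrightarrow> \<bar>T - t\<bar> < e \<Longrightarrow> h (s, T) \<in> W" by blast
    have "\<exists>\<epsilon>>0. \<forall>s\<in>{0..1}. \<bar>s - s0\<bar> < \<epsilon> \<longrightarrow> same_germ (h (s, y)) (H s y) (H s0 y)"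
      if x: "x \<in> {0..1}" "\<bar>x - t\<bar> < e" and y: "y \<in> {0..1}" "\<bar>y - t\<bar> < e"
        and Rx: "\<exists>\<epsilon>>0. \<forall>s\<in>{0..1}. \<bar>s - s0\<bar> < \<epsilon> \<longrightarrow> same_germ (h (s, x)) (H s x) (H s0 x)" for x y
    proof -
      obtain e2 where e2: "e2 > 0"
        "\<And>s. s \<in> {0..1} \<Longrightarrow> \<bar>s - s0\<bar> < e2 \<Longrightarrow> same_germ (h (s, x)) (H s x) (H s0 x)"
        using Rx by blast
      have "h (s0, x) \<in> W" using e(2)[OF s0 x(1)] e(1) x(2) by simp
      then obtain g where g: "S W g" "same_germ (h (s0, x)) g (H s0 x)"
        using W(4) lift_onD[OF H(1)[OF s0] x(1)] by blast
      obtain V where V: "open V" "h (s0, x) \<in> V" "\<forall>z\<in>V. g z = H s0 x z" using g(2) unfolding same_germ_def by blast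
      obtain e3 where e3: "e3 > 0" "\<And>s. s \<in> {0..1} \<Longrightarrow> \<bar>s - s0\<bar> < e3 \<Longrightarrow> h (s, x) \<in> V"
        using continuous_on_real_nbhd[OF hs[OF x(1)] s0 V(1,2)] by metis
      let ?K = "{min x y..max x y}"
      have K: "?K \<subseteq> {0..1}" "x \<in> ?K" "y \<in> ?K" "connected ?K" using x y by auto
      have Kt: "\<bar>T - t\<bar> < e" if "T \<in> ?K" for T using that x(2) y(2) by (auto simp: min_def max_def split: if_splits)
      \<comment> \<open>For s near s0 the piece of the row between x and y stays in W, so the
        constant lift g represents H s along it.\<close>
      have near: "same_germ (h (s, y)) (H s y) g" if s: "s \<in> {0..1}" "\<bar>s - s0\<bar> < min e (min e2 e3)" for s
      proof -
        have "lift_on (\<lambda>t. h (s, t)) ?K (\<lambda>t. g)"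
        proof (rule lift_on_const[OF g(1) W(1)], rule image_subsetI)
          fix T assume T: "T \<in> ?K"
          show "h (s, T) \<in> W"
            by (rule e(2)[OF s(1) subsetD[OF K(1) T] _ Kt[OF T]]) (use s(2) in simp)
        qed
        moreover have "lift_on (\<lambda>t. h (s, t)) ?K (H s)" using lift_on_subset[OF H(1)[OF s(1)] K(1)] .
        moreover have "same_germ (h (s, x)) (H s x) g"
        proof -
          have "same_germ (h (s, x)) (H s0 x) g"
            using e3(2)[OF s(1)] s(2) V unfolding same_germ_def by (metis min_less_iff_conj)
          then show ?thesis using e2(2)[OF s(1)] s(2) same_germ_trans by (meson min_less_iff_conj)
        qed
        ultimately show ?thesis
          using lift_on_unique[of "\<lambda>t. h (s, t)" ?K "H s" "\<lambda>t. g" x y] K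
            continuous_on_subset[OF ht[OF s(1)] K(1)] by blast
      qed
      have "same_germ (h (s0, y)) (H s0 y) g" using near[OF s0] e(1) e2(1) e3(1) by simp
      then obtain V' where V': "open V'" "h (s0, y) \<in> V'" "\<forall>z\<in>V'. H s0 y z = g z"
        unfolding same_germ_def by blast
      obtain e4 where e4: "e4 > 0" "\<And>s. s \<in> {0..1} \<Longrightarrow> \<bar>s - s0\<bar> < e4 \<Longrightarrow> h (s, y) \<in> V'"
        using continuous_on_real_nbhd[OF hs[OF y(1)] s0 V'(1,2)] by metis
      show ?thesis
      proof (intro exI[of _ "min e4 (min e (min e2 e3))"] conjI ballI impI)
        show "min e4 (min e (min e2 e3)) > 0" using e(1) e2(1) e3(1) e4(1) by simp
        fix s assume s: "s \<in> {0..1}" "\<bar>s - s0\<bar> < min e4 (min e (min e2 e3))"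
        have "same_germ (h (s, y)) (H s0 y) g"
          using e4(2)[OF s(1)] s(2) V' unfolding same_germ_def by (metis min_less_iff_conj)
        moreover have "same_germ (h (s, y)) (H s y) g" using near[OF s(1)] s(2) by simp
        ultimately show "same_germ (h (s, y)) (H s y) (H s0 y)"
          using same_germ_trans same_germ_sym by blast
      qed
    qed
    note step = this
    show ?thesis
      by (rule exI[of _ e], intro conjI e(1) ballI impI) (rule step)
    qed
    then show ?thesis
      by (intro real_connected_induction[where K="{0..1}" and a=0 and b=1 and P="?P"] base) auto
  qed
  \<comment> \<open>Since h(s, 1) = h(s, 0), the end germs form a second lift of the same track that
    G lifts.\<close>
  have L: "lift_on (\<lambda>s. h (s, 0)) {0..1} (\<lambda>s. H s 1)"
    unfolding lift_on_def
  proof (intro ballI conjI)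
    fix s :: real assume s: "s \<in> {0..1}"
    show "section_at (h (s, 0)) (H s 1)" using lift_onD[OF H(1)[OF s] one] h(4)[OF s] by simp
    show "\<exists>\<epsilon>>0. \<forall>s'\<in>{0..1}. \<bar>s' - s\<bar> < \<epsilon> \<longrightarrow> same_germ (h (s', 0)) (H s' 1) (H s 1)"
      using R[OF s] h(4) by auto
  qed
  \<comment> \<open>The last row is constant, so its lift is constant. Hence the two lifts of the
    track agree at s = 1, and by uniqueness also at s = 0, where the row is c.\<close>
  have "same_germ (h (1, 1)) (H 1 1) (G 1)"
  proof (rule lift_on_unique[where G="\<lambda>t. G 1", OF H(1)[OF one] _ ht[OF one] connected_Icc zero one])
    obtain V where "open V" "c 0 \<in> V" "S V (G 1)"
      using lift_onD[OF G(1) one] h(3)[OF zero] unfolding section_at_def by auto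
    then show "lift_on (\<lambda>t. h (1, t)) {0..1} (\<lambda>t. G 1)"
      using h(3) by (intro lift_on_const[of V]) auto
    show "same_germ (h (1, 0)) (H 1 0) (G 1)" using H(2)[OF one] by simp
  qed
  then have "same_germ (h (1, 0)) (H 1 1) (G 1)" using h(4)[OF one] by simp
  from lift_on_unique[OF L G(1) hs[OF zero] connected_Icc one zero this]
  have 1: "same_germ (c 0) (H 0 1) (F 0)" using G(2) h(2)[OF zero] by simp
  have "same_germ (h (0, 1)) (H 0 1) (F 1)"
  proof (rule lift_on_unique[OF H(1)[OF zero] _ ht[OF zero] connected_Icc zero one])
    show "lift_on (\<lambda>t. h (0, t)) {0..1} F" using F h(2) unfolding lift_on_def by auto
    show "same_germ (h (0, 0)) (H 0 0) (F 0)" using H(2)[OF zero] G(2) by simp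
  qed
  then have "same_germ (c 0) (H 0 1) (F 1)" using h(2)[OF one] c_loop by simp
  from same_germ_trans[OF same_germ_sym[OF this] 1] show ?thesis .
qed

lemma lift_on_join:
  assumes F: "lift_on c {0..1} F" and H: "lift_on d {0..1} H" and "c 1 = d 0" "H 0 = F 1"
  shows "lift_on (c +++ d) {0..1} (\<lambda>t. if t \<le> 1/2 then F (2 * t) else H (2 * t - 1))"
  unfolding lift_on_def
proof (intro ballI conjI)
  let ?F = "\<lambda>t. if t \<le> 1/2 then F (2 * t) else H (2 * t - 1)"
  fix t :: real assume t: "t \<in> {0..1}"
  show "section_at ((c +++ d) t) (?F t)"
    using lift_onD[OF F, of "2 * t"] lift_onD[OF H, of "2 * t - 1"] t by (auto simp: joinpaths_def)
  have left: "\<exists>\<epsilon>>0. \<forall>s\<in>{0..1/2}. \<bar>s - t\<bar> < \<epsilon> \<longrightarrow> same_germ ((c +++ d) s) (?F s) (?F t)" if "t \<le> 1/2"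
  proof -
    have "2 * t \<in> {0..1}" using t that by auto
    then obtain e where e: "e > 0" "\<And>s. s \<in> {0..1} \<Longrightarrow> \<bar>s - 2 * t\<bar> < e \<Longrightarrow> same_germ (c s) (F s) (F (2 * t))"
      using F unfolding lift_on_def by blast
    have "same_germ ((c +++ d) s) (?F s) (?F t)" if "s \<in> {0..1/2}" "\<bar>s - t\<bar> < e / 2" for s
    proof -
      have "\<bar>2 * s - 2 * t\<bar> = 2 * \<bar>s - t\<bar>" by (auto simp: abs_if)
      then show ?thesis using e(2)[of "2 * s"] that \<open>t \<le> 1/2\<close> by (auto simp: joinpaths_def)
    qed
    then show ?thesis using e(1) by (intro exI[of _ "e / 2"]) auto
  qed
  have right: "\<exists>\<epsilon>>0. \<forall>s\<in>{1/2..1}. \<bar>s - t\<bar> < \<epsilon> \<longrightarrow> same_germ ((c +++ d) s) (?F s) (?F t)" if "1/2 \<le> t"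
  proof -
    have "2 * t - 1 \<in> {0..1}" using t that by auto
    then obtain e where e: "e > 0"
      "\<And>s. s \<in> {0..1} \<Longrightarrow> \<bar>s - (2 * t - 1)\<bar> < e \<Longrightarrow> same_germ (d s) (H s) (H (2 * t - 1))"
      using H unfolding lift_on_def by blast
    \<comment> \<open>At s = 1/2 both branches agree by the junction conditions, so the right-hand
      formulas hold on the closed half; equality of the functions \<open>H 0\<close> and
      \<open>F 1\<close>, not only of germs, is used.\<close>
    have eq: "(c +++ d) s = d (2 * s - 1)" "?F s = H (2 * s - 1)" if "1/2 \<le> s" for s
    proof -
      show "(c +++ d) s = d (2 * s - 1)"
      proof (cases "s = 1/2")
        case True
        show ?thesis unfolding True using assms(3) by (simp add: joinpaths_def)
      qed (use that in \<open>simp add: joinpaths_def\<close>)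
      show "?F s = H (2 * s - 1)"
      proof (cases "s = 1/2")
        case True
        show ?thesis unfolding True using assms(4) by simp
      qed (use that in simp)
    qed
    have "same_germ ((c +++ d) s) (?F s) (?F t)" if "s \<in> {1/2..1}" "\<bar>s - t\<bar> < e / 2" for s
    proof -
      have s': "1/2 \<le> s" using that(1) by simp
      have 1: "2 * s - 1 \<in> {0..1}" using that(1) by simp
      have "\<bar>(2 * s - 1) - (2 * t - 1)\<bar> = 2 * \<bar>s - t\<bar>" by (auto simp: abs_if)
      then have 2: "\<bar>(2 * s - 1) - (2 * t - 1)\<bar> < e" using that(2) by linarith
      show ?thesis
        unfolding eq(1)[OF s'] eq(2)[OF s'] eq(2)[OF \<open>1/2 \<le> t\<close>] by (rule e(2)[OF 1 2])
    qed
    then show ?thesis using e(1) by (intro exI[of _ "e / 2"]) auto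
  qed
  show "\<exists>\<epsilon>>0. \<forall>s\<in>{0..1}. \<bar>s - t\<bar> < \<epsilon> \<longrightarrow> same_germ ((c +++ d) s) (?F s) (?F t)"
  proof (cases t "1/2 :: real" rule: linorder_cases)
    case less
    then obtain e where "e > 0" "\<forall>s\<in>{0..1/2}. \<bar>s - t\<bar> < e \<longrightarrow> same_germ ((c +++ d) s) (?F s) (?F t)"
      using left by auto
    then show ?thesis using less by (intro exI[of _ "min e (1/2 - t)"]) auto
  next
    case greater
    then obtain e where "e > 0" "\<forall>s\<in>{1/2..1}. \<bar>s - t\<bar> < e \<longrightarrow> same_germ ((c +++ d) s) (?F s) (?F t)"
      using right by auto
    then show ?thesis using greater by (intro exI[of _ "min e (t - 1/2)"]) auto
  next
    case equal
    then have t2: "t \<le> 1/2" "1/2 \<le> t" by auto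
    obtain e where e: "e > 0" "\<forall>s\<in>{1/2..1}. \<bar>s - t\<bar> < e \<longrightarrow> same_germ ((c +++ d) s) (?F s) (?F t)"
      using right[OF t2(2)] by blast
    obtain e' where e': "e' > 0" "\<forall>s\<in>{0..1/2}. \<bar>s - t\<bar> < e' \<longrightarrow> same_germ ((c +++ d) s) (?F s) (?F t)"
      using left[OF t2(1)] by blast
    show ?thesis
    proof (intro exI[of _ "min e e'"] conjI ballI impI)
      show "min e e' > 0" using e(1) e'(1) by simp
      fix s :: real assume s: "s \<in> {0..1}" "\<bar>s - t\<bar> < min e e'"
      then have "s \<in> {0..1/2} \<or> s \<in> {1/2..1}" "\<bar>s - t\<bar> < e" "\<bar>s - t\<bar> < e'" by auto
      then show "same_germ ((c +++ d) s) (?F s) (?F t)" using e(2) e'(2) by blast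
    qed
  qed
qed

text \<open>The monodromy theorem. Along c followed by d reversed, the lift returns to its initial
  germ; its second half, read backwards, is a lift of d starting like G and ending like F.\<close>

lemma lift_end_unique:
  assumes sc: "simply_connected (UNIV :: 'm set)"
    and c: "path c" and d: "path d" and ends: "c 0 = d 0" "c 1 = d 1"
    and F: "lift_on c {0..1} F" and G: "lift_on d {0..1} G" and FG: "same_germ (c 0) (F 0) (G 0)"
  shows "same_germ (c 1) (F 1) (G 1)"
proof -
  have zero: "(0::real) \<in> {0..1}" and one: "(1::real) \<in> {0..1}" by auto
  have rd: "path (reversepath d)" using d by simp
  have "section_at (reversepath d 0) (F 1)" using lift_onD[OF F one] ends by (simp add: reversepath_def)
  then obtain H where H: "lift_on (reversepath d) {0..1} H" "H 0 = F 1"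
    using lift_exists[of "reversepath d"] rd unfolding path_def by metis
  let ?c = "c +++ reversepath d" and ?F = "\<lambda>t. if t \<le> 1/2 then F (2 * t) else H (2 * t - 1)"
  have join: "c 1 = reversepath d 0" using ends by (simp add: reversepath_def)
  have L: "lift_on ?c {0..1} ?F" by (rule lift_on_join[OF F H(1) join H(2)])
  have c0: "?c 0 = c 0" by (simp add: joinpaths_def)
  have "path ?c" using c rd join by (simp add: pathfinish_def pathstart_def)
  moreover have "pathfinish ?c = pathstart ?c"
    using ends by (simp add: pathfinish_def pathstart_def joinpaths_def reversepath_def)
  moreover have "path (\<lambda>t::real. c 0)" by (simp add: path_def)
  \<comment> \<open>Simple connectedness means here that any two loops are freely homotopic.\<close>
  ultimately have "homotopic_loops UNIV ?c (\<lambda>t. c 0)"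
    by (intro sc[unfolded simply_connected_def, rule_format]) (simp add: pathfinish_def pathstart_def)
  then have "same_germ (c 0) (?F 1) (?F 0)"
    using loop_lift_trivial[OF _ L] c0 by simp
  then have H1: "same_germ (d 0) (H 1) (F 0)" using ends by simp
  have "lift_on d {0..1} (\<lambda>t. H (1 - t))"
    unfolding lift_on_def
  proof (intro ballI conjI)
    fix t :: real assume t: "t \<in> {0..1}"
    then have t': "1 - t \<in> {0..1}" by auto
    show "section_at (d t) (H (1 - t))" using lift_onD[OF H(1) t'] by (simp add: reversepath_def)
    obtain e where e: "e > 0"
      "\<And>s. s \<in> {0..1} \<Longrightarrow> \<bar>s - (1 - t)\<bar> < e \<Longrightarrow> same_germ (reversepath d s) (H s) (H (1 - t))"
      using H(1) t' unfolding lift_on_def by blast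
    have "same_germ (d s) (H (1 - s)) (H (1 - t))" if "s \<in> {0..1}" "\<bar>s - t\<bar> < e" for s
      using e(2)[of "1 - s"] that by (simp add: reversepath_def abs_minus_commute)
    then show "\<exists>\<epsilon>>0. \<forall>s\<in>{0..1}. \<bar>s - t\<bar> < \<epsilon> \<longrightarrow> same_germ (d s) (H (1 - s)) (H (1 - t))"
      using e(1) by blast
  qed
  moreover have "same_germ (d 0) (H (1 - 0)) (G 0)" using H1 FG ends same_germ_trans by auto
  ultimately have "same_germ (d 1) (H (1 - 1)) (G 1)"
    by (intro lift_on_unique[OF _ G d[unfolded path_def] connected_Icc zero one])
  then show ?thesis using H(2) ends by simp
qed

text \<open>The value at p is read off from the lift along a chosen path from p0 to p. The choice is
  not continuous in p; independence of the path repairs this.\<close>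

theorem global_section:
  assumes sc: "simply_connected (UNIV :: 'm set)" and f0: "section_at p0 f0"
  obtains f where "S UNIV f" "same_germ p0 f f0"
proof -
  have zero: "(0::real) \<in> {0..1}" and one: "(1::real) \<in> {0..1}" by auto
  have "\<forall>p. \<exists>c. path c \<and> c 0 = p0 \<and> c 1 = p"
  proof
    fix p
    \<comment> \<open>Two constant loops are freely homotopic, and the track of the base point is a
      path from p0 to p.\<close>
    have "homotopic_loops UNIV (\<lambda>t::real. p0) (\<lambda>t. p)"
      by (rule sc[unfolded simply_connected_def, THEN spec[of _ "\<lambda>t. p0"], THEN spec[of _ "\<lambda>t. p"], THEN mp])
         (simp add: pathfinish_def pathstart_def path_def)
    then obtain h :: "real \<times> real \<Rightarrow> 'm" where h: "continuous_on ({0..1} \<times> {0..1}) h" "\<forall>x\<in>{0..1}. h (0, x) = p0"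
      "\<forall>x\<in>{0..1}. h (1, x) = p"
      unfolding homotopic_loops by blast
    have "continuous_on {0..1} (\<lambda>s. h (s, 0))"
      by (rule continuous_on_compose2[OF h(1)]) (auto intro!: continuous_intros)
    then show "\<exists>c. path c \<and> c 0 = p0 \<and> c 1 = p"
      using h(2,3) by (intro exI[of _ "\<lambda>s. h (s, 0)"]) (simp add: path_def)
  qed
  from choice[OF this] obtain c where c: "\<And>p. path (c p)" "\<And>p. c p 0 = p0" "\<And>p. c p 1 = p" by blast
  have "\<forall>p. \<exists>F. lift_on (c p) {0..1} F \<and> F 0 = f0"
  proof
    fix p
    have "section_at (c p 0) f0" using f0 c(2) by simp
    then show "\<exists>F. lift_on (c p) {0..1} F \<and> F 0 = f0"
      using lift_exists[OF c(1)[of p, unfolded path_def]] by blast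
  qed
  from choice[OF this] obtain F where F: "\<And>p. lift_on (c p) {0..1} (F p)" "\<And>p. F p 0 = f0" by blast
  define f where "f p = F p 1 p" for p
  \<comment> \<open>For q near p the chosen path to q is compared with the path to p prolonged
    inside W, along which the lift is the fixed section g.\<close>
  have key: "\<exists>W g. open W \<and> p \<in> W \<and> S W g \<and> same_germ p g (F p 1) \<and> (\<forall>q\<in>W. f q = g q)" for p
  proof -
    obtain W where W0: "germ_nbhd W" "p \<in> W" using germ_nbhd_exists by blast
    note W = germ_nbhdD(1)[OF W0(1)] W0(2) germ_nbhdD(2-4)[OF W0(1)]
    have s1: "section_at p (F p 1)" using lift_onD[OF F(1)[of p] one] c(3)[of p] by simp
    then obtain g where g: "S W g" "same_germ p g (F p 1)" using W(4)[OF W(2)] by blast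
    have "f q = g q" if q: "q \<in> W" for q
    proof -
      obtain d where d: "path d" "path_image d \<subseteq> W" "d 0 = p" "d 1 = q"
        using W(3)[unfolded path_connected_def, rule_format, OF W(2) q]
        unfolding pathstart_def pathfinish_def by blast
      then obtain H where H: "lift_on d {0..1} H" "H 0 = F p 1"
        using lift_exists[of d "F p 1"] s1 unfolding path_def by metis
      have "lift_on d {0..1} (\<lambda>t. g)"
        using d(2) by (intro lift_on_const[OF g(1) W(1)]) (auto simp: path_image_def)
      moreover have "same_germ (d 0) (H 0) g" using same_germ_sym[OF g(2)] d(3) H(2) by simp
      ultimately have "same_germ (d 1) (H 1) g"
        by (rule lift_on_unique[where G="\<lambda>t. g", OF H(1) _ d(1)[unfolded path_def] connected_Icc zero one])
      then have Hg: "same_germ q (H 1) g" using d(4) by simp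
      have jn: "c p 1 = d 0" using c(3) d(3) by simp
      have "same_germ (c q 1) (F q 1) ((\<lambda>t. if t \<le> 1/2 then F p (2 * t) else H (2 * t - 1)) 1)"
      proof (rule lift_end_unique[OF sc c(1)[of q] _ _ _ F(1)[of q] lift_on_join[OF F(1)[of p] H(1) jn H(2)]])
        show "path (c p +++ d)" using c(1)[of p] d(1) jn by (simp add: pathfinish_def pathstart_def)
        show "c q 0 = (c p +++ d) 0" "c q 1 = (c p +++ d) 1"
          using c(2,3) d(4) by (auto simp: joinpaths_def)
      qed (use F(2) in simp)
      then have "same_germ q (F q 1) (H 1)" using c(3)[of q] by simp
      from same_germ_trans[OF this Hg] have "same_germ q (F q 1) g" .
      then show ?thesis unfolding f_def by (rule same_germ_value)
    qed
    then show ?thesis using W g by blast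
  qed
  have "S UNIV f"
  proof (rule local)
    show "\<exists>V g. open V \<and> p \<in> V \<and> S V g \<and> (\<forall>q\<in>V. f q = g q)" for p using key[of p] by blast
  qed simp
  moreover have "same_germ p0 f f0"
  proof -
    obtain W g where W: "open W" "p0 \<in> W" "same_germ p0 g (F p0 1)" "\<forall>q\<in>W. f q = g q" using key[of p0] by blast
    then have "same_germ p0 f g" unfolding same_germ_def by blast
    then have "same_germ p0 f (F p0 1)" using W(3) by (rule same_germ_trans)
    moreover have "same_germ p0 (F p0 1) f0"
    proof -
      have "same_germ (c p0 1) (F p0 1) f0"
      proof (rule lift_end_unique[where d="\<lambda>t. p0" and G="\<lambda>t. f0", OF sc c(1)[of p0] _ _ _ F(1)[of p0]])
        obtain V where "open V" "p0 \<in> V" "S V f0" using f0 unfolding section_at_def by blast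
        then show "lift_on (\<lambda>t. p0) {0..1} (\<lambda>t. f0)" by (intro lift_on_const[of V]) auto
      qed (use c F(2) in \<open>auto simp: path_def\<close>)
      then show ?thesis using c(3)[of p0] by simp
    qed
    ultimately show ?thesis by (rule same_germ_trans)
  qed
  ultimately show ?thesis by (rule that)
qed

end

section \<open>Symmetry of the second derivative\<close>

text \<open>F(y + s w) - F(y) is s times an integral of the derivative along w. Differentiating it
  along v under the integral sign, dividing by s and letting s tend to 0 gives one mixed derivative;
  the same quotient tends to the other by definition.\<close>

lemma second_derivative_symmetric_real:
  fixes F :: "'a::euclidean_space \<Rightarrow> real"
  assumes S: "open S" "x \<in> S" and F: "C_k_on (Suc (Suc 0)) S F"
  shows "frechet_derivative (\<lambda>y. frechet_derivative F (at y) w) (at x) v =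
    frechet_derivative (\<lambda>y. frechet_derivative F (at y) v) (at x) w"
proof -
  define F' where "F' w y = frechet_derivative F (at y) w" for w y
  define F'' where "F'' w y = frechet_derivative (F' w) (at y)" for w y
  have dF: "(F has_derivative (\<lambda>w. F' w y)) (at y)" if "y \<in> S" for y
    using C_k_on_Suc_has_derivative[OF F that] by (simp add: F'_def)
  have F1: "C_k_on (Suc 0) S (F' w)" for w
    unfolding F'_def using F C_k_on.simps(2)[of "Suc 0" S F] by blast
  have dF': "(F' w has_derivative F'' w y) (at y)" if "y \<in> S" for w y
    using C_k_on_Suc_has_derivative[OF F1 that] by (simp add: F''_def)
  have cF'': "continuous_on S (\<lambda>y. F'' w y v)" for w v
    using F1[of w] by (simp add: F''_def)
  have cF': "continuous_on S (F' w)" for w using C_k_on_imp_continuous_on[OF F1] .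
  obtain r where r: "r > 0" "ball x r \<subseteq> S" using S openE by blast
  define e where "e = r / (2 * (norm w + 1))"
  have e: "e > 0" using r(1) by (simp add: e_def add_nonneg_pos)
  have in_S: "y + (t * s) *\<^sub>R w \<in> S" if "y \<in> ball x (r/2)" "t \<in> {0..1}" "s \<in> ball 0 e" for y t s
  proof -
    have "\<bar>t * s\<bar> \<le> 1 * e" unfolding abs_mult using that(2,3) by (intro mult_mono) auto
    then have "norm ((t * s) *\<^sub>R w) \<le> e * norm w" by (simp add: mult_right_mono)
    also have "\<dots> < e * (norm w + 1)" using e by simp
    also have "\<dots> = r/2"
    proof -
      have "norm w + 1 \<noteq> 0" using norm_ge_zero[of w] by linarith
      then show ?thesis by (simp add: e_def divide_simps)
    qed
    finally have "norm ((t * s) *\<^sub>R w) < r/2" .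
    then have "dist x (y + (t * s) *\<^sub>R w) < r"
      using that(1) norm_triangle_ineq4[of "x - y" "(t * s) *\<^sub>R w"] by (simp add: dist_norm algebra_simps)
    then show ?thesis using r(2) by auto
  qed
  have x_half: "x \<in> ball x (r/2)" using r(1) by simp
  have ftc: "F (y + s *\<^sub>R w) - F y = integral {0..1} (\<lambda>t. s * F' w (y + (t * s) *\<^sub>R w))"
    if y: "y \<in> ball x (r/2)" and s: "s \<in> ball 0 e" for y s
  proof -
    have "((\<lambda>t. s * F' w (y + (t * s) *\<^sub>R w)) has_integral F (y + (1 * s) *\<^sub>R w) - F (y + (0 * s) *\<^sub>R w)) {0..1}"
    proof (rule fundamental_theorem_of_calculus)
      fix t :: real assume t: "t \<in> {0..1}"
      have 1: "((\<lambda>t. y + (t * s) *\<^sub>R w) has_derivative (\<lambda>h. (h * s) *\<^sub>R w)) (at t)"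
        by (auto intro!: derivative_eq_intros)
      have "((\<lambda>t. F (y + (t * s) *\<^sub>R w)) has_derivative (\<lambda>h. F' ((h * s) *\<^sub>R w) (y + (t * s) *\<^sub>R w))) (at t)"
        by (rule has_derivative_compose[OF 1 dF[OF in_S[OF y t s]]])
      moreover have "F' ((h * s) *\<^sub>R w) (y + (t * s) *\<^sub>R w) = h *\<^sub>R (s * F' w (y + (t * s) *\<^sub>R w))" for h
        using linear_cmul[OF has_derivative_linear[OF dF[OF in_S[OF y t s]]]] by simp
      ultimately show "((\<lambda>t. F (y + (t * s) *\<^sub>R w)) has_vector_derivative s * F' w (y + (t * s) *\<^sub>R w)) (at t within {0..1})"
        unfolding has_vector_derivative_def by (auto intro: has_derivative_at_withinI)
    qed simp
    from integral_unique[OF this] show ?thesis by simp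
  qed
  have line: "continuous_on X (\<lambda>p. f (a p + (b p * c p) *\<^sub>R w))"
    if "continuous_on S f" "continuous_on X a" "continuous_on X b" "continuous_on X c"
      "\<And>p. p \<in> X \<Longrightarrow> a p + (b p * c p) *\<^sub>R w \<in> S"
    for f :: "'a \<Rightarrow> real" and X :: "('p::topological_space) set" and a b c
    by (rule continuous_on_compose2[OF that(1)]) (use that in \<open>auto intro!: continuous_intros\<close>)
  have quotient: "F' v (x + s *\<^sub>R w) - F' v x = s * integral {0..1} (\<lambda>t. F'' w (x + (t * s) *\<^sub>R w) v)"
    if s: "s \<in> ball 0 e" for s
  proof -
    have sy: "y + s *\<^sub>R w \<in> S" "y \<in> S" if "y \<in> ball x (r/2)" for y
      using in_S[OF that, of 1 s] in_S[OF that, of 0 s] s by auto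
    have 1: "((\<lambda>y. integral {0..1} (\<lambda>t. s * F' w (y + (t * s) *\<^sub>R w))) has_derivative
        (\<lambda>v. integral {0..1} (\<lambda>t. s * F'' w (x + (t * s) *\<^sub>R w) v))) (at x)"
    proof (rule has_derivative_integral_param[OF open_ball convex_ball x_half])
      fix y t assume y: "y \<in> ball x (r/2)" and t: "t \<in> {0..1::real}"
      have "((\<lambda>y. F' w (y + (t * s) *\<^sub>R w)) has_derivative F'' w (y + (t * s) *\<^sub>R w)) (at y)"
        by (rule has_derivative_compose[where f="\<lambda>y. y + (t * s) *\<^sub>R w" and f'="\<lambda>h. h", OF _ dF'[OF in_S[OF y t s]]])
           (auto intro!: derivative_eq_intros)
      then show "((\<lambda>y. s * F' w (y + (t * s) *\<^sub>R w)) has_derivative (\<lambda>v. s * F'' w (y + (t * s) *\<^sub>R w) v)) (at y)"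
        by (rule has_derivative_mult_right)
    next
      fix y assume y: "y \<in> ball x (r/2)"
      show "continuous_on {0..1} (\<lambda>t. s * F' w (y + (t * s) *\<^sub>R w))"
        using in_S[OF y _ s] by (intro continuous_on_mult continuous_on_const line[OF cF'] continuous_intros) auto
    next
      fix v
      show "continuous_on (ball x (r/2) \<times> {0..1}) (\<lambda>(y, t). s * F'' w (y + (t * s) *\<^sub>R w) v)"
        unfolding split_beta using in_S[OF _ _ s]
        by (intro continuous_on_mult continuous_on_const line[OF cF''] continuous_intros) auto
    qed
    have "((\<lambda>y. F (y + s *\<^sub>R w)) has_derivative (\<lambda>v. F' v (x + s *\<^sub>R w))) (at x)"
      by (rule has_derivative_compose[where f="\<lambda>y. y + s *\<^sub>R w" and f'="\<lambda>h. h", OF _ dF[OF sy(1)[OF x_half]]])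
         (auto intro!: derivative_eq_intros)
    from has_derivative_diff[OF this dF[OF S(2)]]
    have "((\<lambda>y. integral {0..1} (\<lambda>t. s * F' w (y + (t * s) *\<^sub>R w))) has_derivative
        (\<lambda>v. F' v (x + s *\<^sub>R w) - F' v x)) (at x)"
      by (rule has_derivative_transform_within_open[OF _ open_ball x_half]) (rule ftc[OF _ s])
    from fun_cong[OF has_derivative_unique[OF this 1], of v] show ?thesis by simp
  qed
  let ?R = "\<lambda>s. integral {0..1} (\<lambda>t. F'' w (x + (t * s) *\<^sub>R w) v)"
  have "continuous_on (ball 0 e \<times> cbox 0 1) (\<lambda>(s, t). F'' w (x + (t * s) *\<^sub>R w) v)"
    unfolding split_beta using in_S[OF x_half]
    by (intro line[OF cF''] continuous_intros) auto
  from integral_continuous_on_param[OF this] have "continuous_on (ball 0 e) ?R" by simp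
  then have "isCont ?R 0" using e by (simp add: continuous_on_eq_continuous_at)
  then have "?R \<midarrow>0\<rightarrow> F'' w x v" by (simp add: isCont_def)
  then have R: "(\<lambda>s. (F' v (x + s *\<^sub>R w) - F' v x) / s) \<midarrow>0\<rightarrow> F'' w x v"
  proof (rule Lim_transform_within[OF _ e])
    fix s :: real assume "0 < dist s 0" "dist s 0 < e"
    then show "?R s = (F' v (x + s *\<^sub>R w) - F' v x) / s" using quotient[of s] by simp
  qed
  \<comment> \<open>The second evaluation of the limit: the difference quotient of F' v in the
    direction w.\<close>
  have "((\<lambda>s. F' v (x + s *\<^sub>R w)) has_derivative (\<lambda>s. F'' v x (s *\<^sub>R w))) (at 0)"
  proof (rule has_derivative_compose[where f="\<lambda>s. x + s *\<^sub>R w" and f'="\<lambda>s. s *\<^sub>R w"])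
    show "(F' v has_derivative F'' v x) (at (x + 0 *\<^sub>R w))" using dF'[OF S(2)] by simp
  qed (auto intro!: derivative_eq_intros)
  also have "(\<lambda>s. F'' v x (s *\<^sub>R w)) = (*) (F'' v x w)"
    using linear_cmul[OF has_derivative_linear[OF dF'[OF S(2)]]] by (auto simp: mult.commute)
  finally have "(\<lambda>s. (F' v (x + s *\<^sub>R w) - F' v x) / s) \<midarrow>0\<rightarrow> F'' v x w"
    unfolding has_field_derivative_def[symmetric] DERIV_def by simp
  then have "F'' v x w = F'' w x v" using R by (rule LIM_unique)
  then show ?thesis by (simp add: F''_def F'_def[abs_def])
qed

lemma second_derivative_symmetric:
  fixes F :: "'a::euclidean_space \<Rightarrow> 'b::euclidean_space"
  assumes S: "open S" "x \<in> S" and F: "C_k_on (Suc (Suc 0)) S F"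
  shows "frechet_derivative (\<lambda>y. frechet_derivative F (at y) w) (at x) v =
    frechet_derivative (\<lambda>y. frechet_derivative F (at y) v) (at x) w"
proof (rule euclidean_eqI)
  fix b :: 'b assume "b \<in> Basis"
  have C: "C_k_on (Suc (Suc 0)) S (\<lambda>y. F y \<bullet> b)"
    by (rule C_k_on_bounded_linear[OF S(1) bounded_linear_inner_left F])
  have 1: "frechet_derivative (\<lambda>y. F y \<bullet> b) (at y) u = frechet_derivative F (at y) u \<bullet> b" if "y \<in> S" for y u
    using frechet_derivative_at[OF has_derivative_inner_left[OF C_k_on_Suc_has_derivative[OF F that]]]
    by (metis (no_types))
  have C1: "C_k_on (Suc 0) S (\<lambda>y. frechet_derivative F (at y) u)" for u
    using F C_k_on.simps(2)[of "Suc 0" S F] by blast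
  have 2: "frechet_derivative (\<lambda>y. frechet_derivative F (at y) u) (at x) v \<bullet> b =
      frechet_derivative (\<lambda>y. frechet_derivative (\<lambda>y. F y \<bullet> b) (at y) u) (at x) v" for u v
  proof -
    have "((\<lambda>y. frechet_derivative (\<lambda>y. F y \<bullet> b) (at y) u) has_derivative
        (\<lambda>v. frechet_derivative (\<lambda>y. frechet_derivative F (at y) u) (at x) v \<bullet> b)) (at x)"
      by (rule has_derivative_transform_within_open[OF has_derivative_inner_left[OF C_k_on_Suc_has_derivative[OF C1 S(2)]] S])
         (simp add: 1)
    then show ?thesis using frechet_derivative_at by metis
  qed
  show "frechet_derivative (\<lambda>y. frechet_derivative F (at y) w) (at x) v \<bullet> b =
    frechet_derivative (\<lambda>y. frechet_derivative F (at y) v) (at x) w \<bullet> b"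
    unfolding 2 by (rule second_derivative_symmetric_real[OF S C])
qed

section \<open>Vector-valued holomorphic maps\<close>

lemma Basis_vecE:
  assumes "b \<in> (Basis :: ('x::euclidean_space ^ 'n) set)"
  obtains j d where "b = axis j d" "d \<in> Basis"
  using assms unfolding Basis_vec_def by auto

lemma cvec_holomorphic_on_componentwise:
  fixes f :: "complex ^ 'n \<Rightarrow> complex ^ 'k"
  shows "cvec_holomorphic_on S f \<longleftrightarrow> (\<forall>j. c_holomorphic_on S (\<lambda>z. f z $ j))"
proof
  assume f: "cvec_holomorphic_on S f"
  show "\<forall>j. c_holomorphic_on S (\<lambda>z. f z $ j)"
    unfolding c_holomorphic_on_def
  proof (intro allI ballI)
    fix j z assume "z \<in> S"
    then obtain L where L: "(f has_derivative L) (at z)" "\<forall>c v. L (c *s v) = c *s L v"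
      using f unfolding cvec_holomorphic_on_def by blast
    show "\<exists>L. ((\<lambda>z. f z $ j) has_derivative L) (at z) \<and> (\<forall>c v. L (c *s v) = c * L v)"
      using bounded_linear.has_derivative[OF bounded_linear_vec_nth L(1)] L(2)
      by (intro exI[of _ "\<lambda>v. L v $ j"]) simp
  qed
next
  assume f: "\<forall>j. c_holomorphic_on S (\<lambda>z. f z $ j)"
  show "cvec_holomorphic_on S f"
    unfolding cvec_holomorphic_on_def
  proof
    fix z assume z: "z \<in> S"
    let ?L = "\<lambda>v. \<chi> j. frechet_derivative (\<lambda>z. f z $ j) (at z) v"
    have "(f has_derivative ?L) (at z)"
    proof (subst has_derivative_componentwise_within, rule ballI)
      fix b :: "complex ^ 'k" assume "b \<in> Basis"
      then obtain j d where b: "b = axis j d" by (rule Basis_vecE)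
      show "((\<lambda>x. f x \<bullet> b) has_derivative (\<lambda>x. ?L x \<bullet> b)) (at z)"
        using has_derivative_inner_left[OF c_holomorphic_on_derivative(1)[OF f[rule_format] z, of j]]
        by (simp add: b inner_axis)
    qed
    moreover have "?L (c *s v) = c *s ?L v" for c v
      using c_holomorphic_on_derivative(2)[OF f[rule_format] z] by (simp add: vec_eq_iff)
    ultimately show "\<exists>L. (f has_derivative L) (at z) \<and> (\<forall>c v. L (c *s v) = c *s L v)" by blast
  qed
qed

lemma cvec_holomorphic_on_imp_C_k_on:
  fixes f :: "complex ^ 'n \<Rightarrow> complex ^ 'k"
  assumes "cvec_holomorphic_on S f" "open S"
  shows "C_k_on k S f"
proof (rule iffD2[OF C_k_on_componentwise[OF assms(2)]], rule ballI)
  fix b :: "complex ^ 'k" assume "b \<in> Basis"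
  then obtain j d where b: "b = axis j d" by (rule Basis_vecE)
  have "C_k_on k S (\<lambda>z. f z $ j)"
    by (rule c_holomorphic_on_imp_C_k_on[OF assms(1)[unfolded cvec_holomorphic_on_componentwise, rule_format] assms(2)])
  then show "C_k_on k S (\<lambda>z. f z \<bullet> b)"
    using C_k_on_bounded_linear[OF assms(2) bounded_linear_inner_left] by (simp add: b inner_axis)
qed

lemma c_holomorphic_on_compose:
  assumes "c_holomorphic_on T h" "cvec_holomorphic_on S f" "f ` S \<subseteq> T"
  shows "c_holomorphic_on S (\<lambda>z. h (f z))"
  unfolding c_holomorphic_on_def
proof
  fix z assume z: "z \<in> S"
  then obtain L where L: "(f has_derivative L) (at z)" "\<forall>c v. L (c *s v) = c *s L v"
    using assms(2) unfolding cvec_holomorphic_on_def by blast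
  have fz: "f z \<in> T" using assms(3) z by blast
  show "\<exists>L. ((\<lambda>z. h (f z)) has_derivative L) (at z) \<and> (\<forall>c v. L (c *s v) = c * L v)"
    using has_derivative_compose[OF L(1) c_holomorphic_on_derivative(1)[OF assms(1) fz]]
      c_holomorphic_on_derivative(2)[OF assms(1) fz] L(2)
    by (intro exI[of _ "\<lambda>v. frechet_derivative h (at (f z)) (L v)"]) simp
qed

section \<open>Vector fields in charts\<close>

text \<open>\<open>field_in c h\<close> is the vector field whose coordinates in the chart \<open>c\<close> are given by \<open>h\<close>;
  \<open>rep A c X\<close> are the coordinates of the field \<open>X\<close> in \<open>c\<close>.\<close>

definition transition_deriv ::
    "('m, 'n::finite) chart \<Rightarrow> ('m, 'n) chart \<Rightarrow> 'm \<Rightarrow> complex ^ 'n \<Rightarrow> complex ^ 'n" where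
  "transition_deriv c d p = frechet_derivative (snd d \<circ> inv_chart c) (at (snd c p))"

definition field_in ::
    "('m, 'n::finite) chart set \<Rightarrow> ('m, 'n) chart \<Rightarrow> (complex ^ 'n \<Rightarrow> complex ^ 'n) \<Rightarrow> 'm \<Rightarrow> complex ^ 'n" where
  "field_in A c h p = transition_deriv c (chart_at A p) p (h (snd c p))"

definition rep ::
    "('m, 'n::finite) chart set \<Rightarrow> ('m, 'n) chart \<Rightarrow> ('m \<Rightarrow> complex ^ 'n) \<Rightarrow> complex ^ 'n \<Rightarrow> complex ^ 'n" where
  "rep A c X x = differential A (snd c) (inv_chart c x) (X (inv_chart c x))"

locale charted =
  fixes A :: "('m::{t2_space, second_countable_topology}, 'n::finite) chart set"
  assumes complex_manifold: "complex_manifold A"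
begin

lemma chart_at: "chart_at A p \<in> A" "p \<in> fst (chart_at A p)"
proof -
  have "\<exists>c. c \<in> A \<and> p \<in> fst c" using complex_manifold unfolding complex_manifold_def by blast
  from someI_ex[OF this] show "chart_at A p \<in> A" "p \<in> fst (chart_at A p)"
    unfolding chart_at_def by auto
qed

lemma chart_homeo:
  assumes "c \<in> A"
  shows "open (fst c)" "open (snd c ` fst c)" "homeomorphism (fst c) (snd c ` fst c) (snd c) (inv_chart c)"
  using complex_manifold assms unfolding complex_manifold_def by auto

lemma inv_chart [simp]: "c \<in> A \<Longrightarrow> p \<in> fst c \<Longrightarrow> inv_chart c (snd c p) = p"
  using chart_homeo(3) unfolding homeomorphism_def by blast

lemma chart_inv:
  assumes "c \<in> A" "x \<in> snd c ` (fst c \<inter> U)"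
  shows "snd c (inv_chart c x) = x" "inv_chart c x \<in> fst c" "inv_chart c x \<in> U"
  using assms by auto

lemma open_image:
  assumes "c \<in> A" "open U"
  shows "open (snd c ` (fst c \<inter> U))"
proof -
  have "continuous_on (snd c ` fst c) (inv_chart c)" using chart_homeo(3)[OF assms(1)] unfolding homeomorphism_def by blast
  then have "open (inv_chart c -` U \<inter> snd c ` fst c)"
    using assms chart_homeo(2) by (simp add: continuous_on_open_vimage)
  also have "inv_chart c -` U \<inter> snd c ` fst c = snd c ` (fst c \<inter> U)" using assms(1) by auto
  finally show ?thesis .
qed

lemma open_preimage:
  assumes "c \<in> A" "open B"
  shows "open {p \<in> fst c. snd c p \<in> B}"
proof -
  have "continuous_on (fst c) (snd c)" using chart_homeo(3)[OF assms(1)] unfolding homeomorphism_def by blast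
  then have "open (snd c -` B \<inter> fst c)" using assms chart_homeo(1) by (simp add: continuous_on_open_vimage)
  also have "snd c -` B \<inter> fst c = {p \<in> fst c. snd c p \<in> B}" by auto
  finally show ?thesis .
qed

lemma transition_holomorphic:
  "c \<in> A \<Longrightarrow> d \<in> A \<Longrightarrow> cvec_holomorphic_on (snd c ` (fst c \<inter> fst d)) (snd d \<circ> inv_chart c)"
  using complex_manifold unfolding complex_manifold_def by auto

lemma transition_deriv:
  assumes "c \<in> A" "d \<in> A" "p \<in> fst c" "p \<in> fst d"
  shows "((snd d \<circ> inv_chart c) has_derivative transition_deriv c d p) (at (snd c p))"
    and "transition_deriv c d p (z *s v) = z *s transition_deriv c d p v"
proof -
  have "snd c p \<in> snd c ` (fst c \<inter> fst d)" using assms by auto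
  then obtain L where L: "((snd d \<circ> inv_chart c) has_derivative L) (at (snd c p))" "\<forall>c v. L (c *s v) = c *s L v"
    using transition_holomorphic[OF assms(1,2)] unfolding cvec_holomorphic_on_def by blast
  have "transition_deriv c d p = L"
    unfolding transition_deriv_def using frechet_derivative_at[OF L(1)] by simp
  then show "((snd d \<circ> inv_chart c) has_derivative transition_deriv c d p) (at (snd c p))"
    "transition_deriv c d p (z *s v) = z *s transition_deriv c d p v" using L by simp_all
qed

lemma linear_transition_deriv:
  "c \<in> A \<Longrightarrow> d \<in> A \<Longrightarrow> p \<in> fst c \<Longrightarrow> p \<in> fst d \<Longrightarrow> linear (transition_deriv c d p)"
  using transition_deriv(1) has_derivative_linear by blast

lemma change_chart_deriv:
  assumes "c \<in> A" "d \<in> A" "p \<in> fst c" "p \<in> fst d"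
    and "((f \<circ> inv_chart d) has_derivative L) (at (snd d p))"
  shows "((f \<circ> inv_chart c) has_derivative (\<lambda>v. L (transition_deriv c d p v))) (at (snd c p))"
proof -
  have "((f \<circ> inv_chart d) has_derivative L) (at ((snd d \<circ> inv_chart c) (snd c p)))"
    using assms by simp
  from has_derivative_compose[OF transition_deriv(1)[OF assms(1-4)] this]
  show ?thesis
  proof (rule has_derivative_transform_within_open)
    show "open (snd c ` (fst c \<inter> fst d))" by (rule open_image[OF assms(1) chart_homeo(1)[OF assms(2)]])
    show "snd c p \<in> snd c ` (fst c \<inter> fst d)" using assms by auto
    fix x assume "x \<in> snd c ` (fst c \<inter> fst d)"
    from chart_inv[OF assms(1) this] show "(f \<circ> inv_chart d) ((snd d \<circ> inv_chart c) x) = (f \<circ> inv_chart c) x"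
      using assms(2) by simp
  qed
qed

lemma differential_chart: "differential A (snd d) p = transition_deriv (chart_at A p) d p"
  by (simp add: differential_def transition_deriv_def Let_def fun_eq_iff)

lemma linear_differential_chart: "d \<in> A \<Longrightarrow> p \<in> fst d \<Longrightarrow> linear (differential A (snd d) p)"
  unfolding differential_chart using linear_transition_deriv chart_at by blast

lemma differential_chart_scale: "d \<in> A \<Longrightarrow> p \<in> fst d \<Longrightarrow> differential A (snd d) p (z *s v) = z *s differential A (snd d) p v"
  unfolding differential_chart using transition_deriv(2) chart_at by blast

text \<open>Eliminates the selected chart: differentials at p can be computed in any chart d around
  p. The second claim supplies differentiability in the selected chart, without which
  \<open>differential\<close> would be a junk value.\<close>

lemma differential_eq:
  assumes "d \<in> A" "p \<in> fst d" "((f \<circ> inv_chart d) has_derivative L) (at (snd d p))"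
  shows "differential A f p v = L (differential A (snd d) p v)"
    and "((f \<circ> inv_chart (chart_at A p)) has_derivative differential A f p) (at (snd (chart_at A p) p))"
proof -
  note D = change_chart_deriv[OF chart_at(1) assms(1) chart_at(2) assms(2,3)]
  have "differential A f p = (\<lambda>v. L (differential A (snd d) p v))"
    unfolding differential_chart using frechet_derivative_at[OF D]
    by (simp add: differential_def Let_def fun_eq_iff)
  then show "differential A f p v = L (differential A (snd d) p v)"
    "((f \<circ> inv_chart (chart_at A p)) has_derivative differential A f p) (at (snd (chart_at A p) p))"
    using D by (simp_all add: differential_chart)
qed

lemma transition_deriv_self:
  assumes "c \<in> A" "p \<in> fst c" shows "transition_deriv c c p v = v"
proof -
  have "((\<lambda>x. x) has_derivative (\<lambda>v. v)) (at (snd c p))" by simp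
  then have "((snd c \<circ> inv_chart c) has_derivative (\<lambda>v. v)) (at (snd c p))"
    by (rule has_derivative_transform_within_open[OF _ chart_homeo(2)[OF assms(1)]]) (use assms in auto)
  from has_derivative_unique[OF transition_deriv(1)[OF assms(1,1,2,2)] this] show ?thesis by simp
qed

lemma transition_deriv_comp:
  assumes "c \<in> A" "d \<in> A" "e \<in> A" "p \<in> fst c" "p \<in> fst d" "p \<in> fst e"
  shows "transition_deriv d e p (transition_deriv c d p v) = transition_deriv c e p v"
  using has_derivative_unique[OF change_chart_deriv[OF assms(1,2,4,5) transition_deriv(1)[OF assms(2,3,5,6)]]
      transition_deriv(1)[OF assms(1,3,4,6)]] by (rule fun_cong)

lemma differential_change:
  assumes "c \<in> A" "d \<in> A" "p \<in> fst c" "p \<in> fst d"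
  shows "differential A (snd d) p v = transition_deriv c d p (differential A (snd c) p v)"
  unfolding differential_chart using transition_deriv_comp[OF chart_at(1) assms(1,2) chart_at(2) assms(3,4)] by simp

lemma differential_field_in:
  assumes "c \<in> A" "p \<in> fst c"
  shows "differential A (snd c) p (field_in A c h p) = h (snd c p)"
  unfolding differential_chart field_in_def
  using transition_deriv_comp[OF assms(1) chart_at(1) assms(1,2) chart_at(2) assms(2)] transition_deriv_self[OF assms]
  by simp

lemma field_in_differential:
  assumes "c \<in> A" "p \<in> fst c"
  shows "transition_deriv c (chart_at A p) p (differential A (snd c) p v) = v"
  unfolding differential_chart
  using transition_deriv_comp[OF chart_at(1) assms(1) chart_at(1) chart_at(2) assms(2) chart_at(2)]
    transition_deriv_self[OF chart_at] by simp

lemma differential_inj: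
  assumes "c \<in> A" "p \<in> fst c" "differential A (snd c) p v = differential A (snd c) p w"
  shows "v = w"
  using field_in_differential[OF assms(1,2)] assms(3) by metis

lemma rep_field_in: "c \<in> A \<Longrightarrow> x \<in> snd c ` fst c \<Longrightarrow> rep A c (field_in A c h) x = h x"
  unfolding rep_def using chart_inv[of c x UNIV] by (simp add: differential_field_in)

lemma rep_chart: "c \<in> A \<Longrightarrow> p \<in> fst c \<Longrightarrow> rep A c X (snd c p) = differential A (snd c) p (X p)"
  by (simp add: rep_def)

lemma vector_field_on_rep:
  "vector_field_on A U X \<longleftrightarrow> (\<forall>c\<in>A. \<forall>k. C_k_on k (snd c ` (fst c \<inter> U)) (rep A c X))"
  unfolding vector_field_on_def smooth_on_def rep_def comp_def by simp

lemma vector_field_on_subset: "vector_field_on A U X \<Longrightarrow> V \<subseteq> U \<Longrightarrow> vector_field_on A V X"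
  unfolding vector_field_on_rep using C_k_on_subset by (metis Int_mono image_mono order_refl)

lemma C_k_on_transition:
  assumes "c \<in> A" "d \<in> A" "open U"
  shows "C_k_on k (snd c ` (fst c \<inter> fst d \<inter> U)) (snd d \<circ> inv_chart c)"
  by (rule C_k_on_subset[OF cvec_holomorphic_on_imp_C_k_on[OF transition_holomorphic[OF assms(1,2)]
        open_image[OF assms(1) chart_homeo(1)[OF assms(2)]]]]) auto

lemma C_k_on_change_chart:
  assumes "c \<in> A" "d \<in> A" "open U" "U \<subseteq> fst c" "C_k_on k (snd c ` U) (f \<circ> inv_chart c)"
  shows "C_k_on k (snd d ` (fst d \<inter> U)) (f \<circ> inv_chart d)"
proof -
  have U: "fst d \<inter> fst c \<inter> U = fst d \<inter> U" "fst c \<inter> U = U" using assms(4) by auto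
  have o: "open (snd d ` (fst d \<inter> U))" "open (snd c ` U)"
    using open_image[OF assms(2,3)] open_image[OF assms(1,3)] U(2) by auto
  have "C_k_on k (snd d ` (fst d \<inter> U)) (\<lambda>y. (f \<circ> inv_chart c) ((snd c \<circ> inv_chart d) y))"
  proof (rule C_k_on_compose[OF o _ _ assms(5)])
    show "C_k_on k (snd d ` (fst d \<inter> U)) (snd c \<circ> inv_chart d)"
      using C_k_on_transition[OF assms(2,1,3)] U(1) by simp
    show "(snd c \<circ> inv_chart d) ` snd d ` (fst d \<inter> U) \<subseteq> snd c ` U"
      using assms(2) by auto
  qed
  also have "?this \<longleftrightarrow> C_k_on k (snd d ` (fst d \<inter> U)) (f \<circ> inv_chart d)"
    by (rule C_k_on_cong[OF o(1)]) (use assms(1,2,4) in auto)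
  finally show ?thesis .
qed

lemma smooth_map_onI:
  assumes "c \<in> A" "open U" "U \<subseteq> fst c" "\<And>k. C_k_on k (snd c ` U) (f \<circ> inv_chart c)"
  shows "smooth_map_on A U f"
  unfolding smooth_map_on_def smooth_on_def using C_k_on_change_chart[OF assms(1) _ assms(2,3,4)] by blast

text \<open>Smoothness in one chart covering U suffices: the coordinates in d are the transition
  derivative, at a moving point, applied to the coordinates in c.\<close>

lemma vector_field_onI:
  assumes "c \<in> A" "open U" "U \<subseteq> fst c" "\<And>k. C_k_on k (snd c ` U) (rep A c X)"
  shows "vector_field_on A U X"
  unfolding vector_field_on_rep
proof (intro ballI allI)
  fix d k assume d: "d \<in> A"
  have U: "fst d \<inter> fst c \<inter> U = fst d \<inter> U" "fst c \<inter> U = U" using assms(3) by auto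
  let ?D = "snd d ` (fst d \<inter> U)"
  have o: "open ?D" "open (snd c ` U)"
    using open_image[OF d assms(2)] open_image[OF assms(1,2)] U(2) by auto
  have tc: "C_k_on k ?D (snd c \<circ> inv_chart d)" for k
    using C_k_on_transition[OF d assms(1,2)] U(1) by simp
  have img: "(snd c \<circ> inv_chart d) ` ?D \<subseteq> snd c ` U" using d by auto
  have "C_k_on k ?D (\<lambda>y. transition_deriv c d (inv_chart d y) (rep A c X ((snd c \<circ> inv_chart d) y)))"
  proof (rule C_k_on_linear_apply[where L="\<lambda>y. transition_deriv c d (inv_chart d y)"
        and f="\<lambda>y. rep A c X ((snd c \<circ> inv_chart d) y)", OF o(1)])
    show "linear (transition_deriv c d (inv_chart d y))" if "y \<in> ?D" for y
      by (rule linear_transition_deriv[OF assms(1) d]) (use chart_inv[OF d that] assms(3) in auto)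
    show "C_k_on k ?D (\<lambda>y. rep A c X ((snd c \<circ> inv_chart d) y))"
      by (rule C_k_on_compose[OF o img tc assms(4)])
    fix b
    let ?E = "snd c ` (fst c \<inter> fst d \<inter> U)"
    have "open ?E" using open_image[OF assms(1), of "fst d \<inter> U"] chart_homeo(1)[OF d] assms(2) by (simp add: Int_assoc open_Int)
    have "C_k_on k ?D (\<lambda>y. frechet_derivative (snd d \<circ> inv_chart c) (at ((snd c \<circ> inv_chart d) y)) b)"
    proof (rule C_k_on_compose[OF o(1) \<open>open ?E\<close> _ tc])
      show "(snd c \<circ> inv_chart d) ` ?D \<subseteq> ?E" using d assms(3) by auto
      \<comment> \<open>One order is lost to the derivative of the transition map, hence
        \<open>Suc k\<close>; this is harmless because the map is smooth.\<close>
      show "C_k_on k ?E (\<lambda>x. frechet_derivative (snd d \<circ> inv_chart c) (at x) b)"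
        using C_k_on_transition[OF assms(1) d assms(2), of "Suc k"] by simp
    qed
    then show "C_k_on k ?D (\<lambda>y. transition_deriv c d (inv_chart d y) b)"
      by (simp add: transition_deriv_def comp_def)
  qed
  also have "?this \<longleftrightarrow> C_k_on k ?D (rep A d X)"
  proof (rule C_k_on_cong[OF o(1)])
    fix y assume y: "y \<in> ?D"
    note yi = chart_inv[OF d y]
    have pc: "inv_chart d y \<in> fst c" using yi(3) assms(3) by auto
    show "transition_deriv c d (inv_chart d y) (rep A c X ((snd c \<circ> inv_chart d) y)) = rep A d X y"
      using differential_change[OF assms(1) d pc yi(2)] pc assms(1) by (simp add: rep_def)
  qed
  finally show "C_k_on k ?D (rep A d X)" .
qed

lemma vector_field_on_field_in:
  assumes "c \<in> A" "open U" "U \<subseteq> fst c" "\<And>k. C_k_on k (snd c ` U) h"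
  shows "vector_field_on A U (field_in A c h)"
proof (rule vector_field_onI[OF assms(1-3)])
  fix k
  have o: "open (snd c ` U)" using open_image[OF assms(1,2)] assms(3) by (simp add: Int_absorb1)
  show "C_k_on k (snd c ` U) (rep A c (field_in A c h))"
    using assms(4)[of k] C_k_on_cong[OF o, of "rep A c (field_in A c h)" h k] rep_field_in[OF assms(1)] assms(3)
    by (auto simp: subset_iff)
qed

lemma deriv_along_eq:
  assumes "d \<in> A" "p \<in> fst d" "((f \<circ> inv_chart d) has_derivative L) (at (snd d p))"
  shows "deriv_along A X f p = L (rep A d X (snd d p))"
  unfolding deriv_along_def using differential_eq(1)[OF assms] assms(1,2) by (simp add: rep_chart)

end

section \<open>Connections in charts\<close>

text \<open>The Christoffel symbols as a coordinate-valued map, with the direction of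
  differentiation first; defined by the connection on fields with constant coordinates.\<close>

definition christoffel ::
    "('m, 'n::finite) chart set \<Rightarrow> ('m, 'n) conn \<Rightarrow> ('m, 'n) chart \<Rightarrow> complex ^ 'n \<Rightarrow>
     complex ^ 'n \<Rightarrow> complex ^ 'n \<Rightarrow> complex ^ 'n" where
  "christoffel A D c x v w = rep A c (cov_deriv D (field_in A c (\<lambda>_. v)) (field_in A c (\<lambda>_. w))) x"

context charted
begin

lemma rep_add:
  assumes "c \<in> A" "x \<in> snd c ` fst c"
  shows "rep A c (\<lambda>q. X q + Y q) x = rep A c X x + rep A c Y x"
  using linear_add[OF linear_differential_chart[OF assms(1) chart_inv(2)[OF assms(1), of x UNIV]]] assms(2)
  by (simp add: rep_def)

lemma rep_scaleR:
  assumes "c \<in> A" "x \<in> snd c ` fst c"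
  shows "rep A c (\<lambda>q. f q *\<^sub>R Y q) x = f (inv_chart c x) *\<^sub>R rep A c Y x"
  using linear_cmul[OF linear_differential_chart[OF assms(1) chart_inv(2)[OF assms(1), of x UNIV]]] assms(2)
  by (simp add: rep_def)

lemma rep_zero:
  assumes "c \<in> A" "x \<in> snd c ` fst c"
  shows "rep A c (\<lambda>q. 0) x = 0"
  using linear_0[OF linear_differential_chart[OF assms(1) chart_inv(2)[OF assms(1), of x UNIV]]] assms(2)
  by (simp add: rep_def)

lemma vector_field_on_add:
  assumes "open U" "vector_field_on A U X" "vector_field_on A U Y"
  shows "vector_field_on A U (\<lambda>q. X q + Y q)"
  unfolding vector_field_on_rep
proof (intro ballI allI)
  fix c k assume c: "c \<in> A"
  note o = open_image[OF c assms(1)]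
  have "C_k_on k (snd c ` (fst c \<inter> U)) (\<lambda>x. rep A c X x + rep A c Y x)"
    using assms(2,3) c unfolding vector_field_on_rep by (intro C_k_on_add[OF o]) auto
  also have "?this \<longleftrightarrow> C_k_on k (snd c ` (fst c \<inter> U)) (rep A c (\<lambda>q. X q + Y q))"
    by (rule C_k_on_cong[OF o]) (use rep_add[OF c, symmetric] in auto)
  finally show "C_k_on k (snd c ` (fst c \<inter> U)) (rep A c (\<lambda>q. X q + Y q))" .
qed

lemma vector_field_on_scaleR:
  assumes "open U" "smooth_map_on A U f" "vector_field_on A U Y"
  shows "vector_field_on A U (\<lambda>q. f q *\<^sub>R Y q)"
  unfolding vector_field_on_rep
proof (intro ballI allI)
  fix c k assume c: "c \<in> A"
  note o = open_image[OF c assms(1)]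
  have "C_k_on k (snd c ` (fst c \<inter> U)) (f \<circ> inv_chart c)" "C_k_on k (snd c ` (fst c \<inter> U)) (rep A c Y)"
    using assms(2,3) c unfolding vector_field_on_rep smooth_map_on_def smooth_on_def by blast+
  from C_k_on_scaleR[OF o this]
  have "C_k_on k (snd c ` (fst c \<inter> U)) (\<lambda>x. (f \<circ> inv_chart c) x *\<^sub>R rep A c Y x)" .
  also have "?this \<longleftrightarrow> C_k_on k (snd c ` (fst c \<inter> U)) (rep A c (\<lambda>q. f q *\<^sub>R Y q))"
    by (rule C_k_on_cong[OF o]) (use rep_scaleR[OF c] in auto)
  finally show "C_k_on k (snd c ` (fst c \<inter> U)) (rep A c (\<lambda>q. f q *\<^sub>R Y q))" .
qed

lemma vector_field_on_zero:
  assumes "open U"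
  shows "vector_field_on A U (\<lambda>q. 0)"
  unfolding vector_field_on_rep
proof (intro ballI allI)
  fix c k assume c: "c \<in> A"
  have "C_k_on k (snd c ` (fst c \<inter> U)) (\<lambda>x. 0 :: complex ^ 'n)" by simp
  also have "?this \<longleftrightarrow> C_k_on k (snd c ` (fst c \<inter> U)) (rep A c (\<lambda>q. 0))"
    by (rule C_k_on_cong[OF open_image[OF c assms]]) (use rep_zero[OF c, symmetric] in auto)
  finally show "C_k_on k (snd c ` (fst c \<inter> U)) (rep A c (\<lambda>q. 0))" .
qed

lemma constant_field: "c \<in> A \<Longrightarrow> vector_field_on A (fst c) (field_in A c (\<lambda>_. w))"
  by (rule vector_field_on_field_in) (auto simp: chart_homeo)

lemma smooth_map_on_const: "smooth_map_on A U (\<lambda>q. k)"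
  unfolding smooth_map_on_def smooth_on_def comp_def by simp

end

locale flat_special = charted A for A :: "('m::{t2_space, second_countable_topology}, 'n::finite) chart set" +
  fixes D :: "('m, 'n) conn"
  assumes special: "special_complex_manifold A D"
begin

lemma connection: "connection A D"
  using special unfolding special_complex_manifold_def by blast

lemmas conn_rules = connection[unfolded connection_def, THEN spec, THEN spec, THEN mp, THEN mp]

lemma conn_linear: "open U \<Longrightarrow> vector_field_on A U Y \<Longrightarrow> p \<in> U \<Longrightarrow> linear (\<lambda>v. D p v Y)"
  by (rule conn_rules[THEN conjunct1, THEN bspec])

lemma conn_local:
  "open U \<Longrightarrow> vector_field_on A U Y \<Longrightarrow> vector_field_on A U Z \<Longrightarrow> \<forall>q\<in>U. Y q = Z q \<Longrightarrow> p \<in> U \<Longrightarrow>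
   D p v Y = D p v Z"
  by (rule conn_rules[THEN conjunct2, THEN conjunct1, THEN spec, THEN mp, THEN mp, THEN bspec, THEN spec])

lemma conn_add:
  "open U \<Longrightarrow> vector_field_on A U Y \<Longrightarrow> vector_field_on A U Z \<Longrightarrow> p \<in> U \<Longrightarrow>
   D p v (\<lambda>q. Y q + Z q) = D p v Y + D p v Z"
  by (rule conn_rules[THEN conjunct2, THEN conjunct2, THEN conjunct1, THEN spec, THEN mp, THEN bspec, THEN spec])

lemma conn_scaleR:
  "open U \<Longrightarrow> vector_field_on A U Y \<Longrightarrow> smooth_map_on A U f \<Longrightarrow> p \<in> U \<Longrightarrow>
   D p v (\<lambda>q. f q *\<^sub>R Y q) = differential A f p v *\<^sub>R Y p + f p *\<^sub>R D p v Y"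
  by (rule conn_rules[THEN conjunct2, THEN conjunct2, THEN conjunct2, THEN conjunct1, THEN spec, THEN mp,
        THEN bspec, THEN spec])

lemma conn_field:
  "open U \<Longrightarrow> vector_field_on A U X \<Longrightarrow> vector_field_on A U Y \<Longrightarrow> vector_field_on A U (cov_deriv D X Y)"
  by (rule conn_rules[THEN conjunct2, THEN conjunct2, THEN conjunct2, THEN conjunct2, THEN spec, THEN mp])

lemma differential_const:
  "differential A (\<lambda>q. k :: real) p v = 0"
proof -
  have "(((\<lambda>q. k) \<circ> inv_chart (chart_at A p)) has_derivative (\<lambda>v. 0)) (at (snd (chart_at A p) p))"
    by (simp add: comp_def)
  from differential_eq(1)[OF chart_at this] show ?thesis .
qed

lemma conn_zero:
  assumes "p \<in> U" "open U"
  shows "D p v (\<lambda>q. 0) = 0"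
proof -
  have "D p v (\<lambda>q. (0::real) *\<^sub>R (0::complex ^ 'n)) =
      differential A (\<lambda>q. 0 :: real) p v *\<^sub>R 0 + 0 *\<^sub>R D p v (\<lambda>q. 0)"
    by (rule conn_scaleR[OF assms(2) vector_field_on_zero[OF assms(2)] smooth_map_on_const assms(1)])
  then show ?thesis by simp
qed

lemma conn_sum:
  assumes "open U" "p \<in> U" "finite I" "\<And>i. i \<in> I \<Longrightarrow> vector_field_on A U (Y i)"
  shows "vector_field_on A U (\<lambda>q. \<Sum>i\<in>I. Y i q) \<and> D p v (\<lambda>q. \<Sum>i\<in>I. Y i q) = (\<Sum>i\<in>I. D p v (Y i))"
  using assms(3,4)
proof (induction I)
  case empty
  then show ?case using conn_zero[OF assms(2,1)] vector_field_on_zero[OF assms(1)] by simp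
next
  case (insert i I)
  then show ?case
    using conn_add[OF assms(1) _ _ assms(2), of "Y i" "\<lambda>q. \<Sum>i\<in>I. Y i q" v]
      vector_field_on_add[OF assms(1), of "Y i" "\<lambda>q. \<Sum>i\<in>I. Y i q"] by simp
qed

abbreviation \<Gamma> where "\<Gamma> c x v w \<equiv> christoffel A D c x v w"

lemma cov_deriv_const_field:
  assumes "c \<in> A" "p \<in> fst c"
  shows "differential A (snd c) p (D p v (field_in A c (\<lambda>_. w))) = \<Gamma> c (snd c p) (differential A (snd c) p v) w"
  unfolding christoffel_def rep_chart[OF assms] cov_deriv_def
  by (simp add: field_in_def field_in_differential[OF assms])

lemma C_k_on_christoffel:
  assumes c: "c \<in> A"
  shows "C_k_on k (snd c ` fst c) (\<lambda>x. \<Gamma> c x v w)"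
proof -
  have "vector_field_on A (fst c) (cov_deriv D (field_in A c (\<lambda>_. v)) (field_in A c (\<lambda>_. w)))"
    by (rule conn_field[OF chart_homeo(1)[OF c] constant_field[OF c] constant_field[OF c]])
  then have "C_k_on k (snd c ` (fst c \<inter> fst c)) (rep A c (cov_deriv D (field_in A c (\<lambda>_. v)) (field_in A c (\<lambda>_. w))))"
    using c unfolding vector_field_on_rep by blast
  then show ?thesis by (simp add: christoffel_def[abs_def])
qed

text \<open>On the overlap, Y is a combination of the constant-coordinate basis fields with its
  components as coefficients. The Leibniz rule then gives the derivative of the components plus the
  Christoffel term.\<close>

lemma cov_deriv_rep:
  assumes c: "c \<in> A" "p \<in> fst c" and U: "open U" "p \<in> U" and Y: "vector_field_on A U Y"
  shows "differential A (snd c) p (D p v Y) =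
    frechet_derivative (rep A c Y) (at (snd c p)) (differential A (snd c) p v) +
    \<Gamma> c (snd c p) (differential A (snd c) p v) (rep A c Y (snd c p))"
proof -
  let ?U = "U \<inter> fst c" and ?x = "snd c p" and ?\<delta> = "differential A (snd c) p"
  have oU: "open ?U" "p \<in> ?U" "?U \<subseteq> fst c" using U c chart_homeo(1)[OF c(1)] by auto
  have YU: "vector_field_on A ?U Y" by (rule vector_field_on_subset[OF Y]) auto
  have S: "open (snd c ` ?U)" "?x \<in> snd c ` ?U"
    using open_image[OF c(1) U(1)] oU(2) by (auto simp: Int_commute)
  have CY: "C_k_on k (snd c ` ?U) (rep A c Y)" for k
  proof -
    have "C_k_on k (snd c ` (fst c \<inter> ?U)) (rep A c Y)" using YU c(1) unfolding vector_field_on_rep by blast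
    moreover have "fst c \<inter> ?U = ?U" using oU(3) by auto
    ultimately show ?thesis by simp
  qed
  let ?E = "\<lambda>b. field_in A c (\<lambda>_. b)"
  define f where "f b q = rep A c Y (snd c q) \<bullet> b" for b q
  have E: "vector_field_on A ?U (?E b)" for b
    by (rule vector_field_on_subset[OF constant_field[OF c(1)] oU(3)])
  have f_eq: "(f b \<circ> inv_chart c) x = rep A c Y x \<bullet> b" if "x \<in> snd c ` ?U" for b x
    using that c(1) by (auto simp: f_def)
  have f: "smooth_map_on A ?U (f b)" for b
  proof (rule smooth_map_onI[OF c(1) oU(1,3)])
    fix k
    have "C_k_on k (snd c ` ?U) (\<lambda>x. rep A c Y x \<bullet> b)"
      by (rule C_k_on_bounded_linear[OF S(1) bounded_linear_inner_left CY])
    also have "?this \<longleftrightarrow> C_k_on k (snd c ` ?U) (f b \<circ> inv_chart c)"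
      by (rule C_k_on_cong[OF S(1)]) (rule f_eq[symmetric])
    finally show "C_k_on k (snd c ` ?U) (f b \<circ> inv_chart c)" .
  qed
  have fE: "vector_field_on A ?U (\<lambda>q. f b q *\<^sub>R ?E b q)" for b
    by (rule vector_field_on_scaleR[OF oU(1) f E])
  have Y_eq: "\<forall>q\<in>?U. Y q = (\<Sum>b\<in>Basis. f b q *\<^sub>R ?E b q)"
  proof
    fix q assume q: "q \<in> ?U"
    then have qc: "q \<in> fst c" by auto
    have "differential A (snd c) q (\<Sum>b\<in>Basis. f b q *\<^sub>R ?E b q) = (\<Sum>b\<in>Basis. f b q *\<^sub>R b)"
      using linear_differential_chart[OF c(1) qc]
      by (simp add: linear_sum linear_cmul differential_field_in[OF c(1) qc])
    also have "\<dots> = rep A c Y (snd c q)" by (simp add: f_def euclidean_representation)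
    also have "\<dots> = differential A (snd c) q (Y q)" by (rule rep_chart[OF c(1) qc])
    finally show "Y q = (\<Sum>b\<in>Basis. f b q *\<^sub>R ?E b q)"
      by (rule differential_inj[OF c(1) qc, THEN sym])
  qed
  have cs: "vector_field_on A ?U (\<lambda>q. \<Sum>b\<in>Basis. f b q *\<^sub>R ?E b q) \<and>
      D p v (\<lambda>q. \<Sum>b\<in>Basis. f b q *\<^sub>R ?E b q) = (\<Sum>b\<in>Basis. D p v (\<lambda>q. f b q *\<^sub>R ?E b q))"
    by (rule conn_sum[OF oU(1,2) finite_Basis fE])
  \<comment> \<open>The expansion equals Y only on \<open>?U\<close>; locality of the connection is
    what allows the replacement.\<close>
  have "D p v Y = D p v (\<lambda>q. \<Sum>b\<in>Basis. f b q *\<^sub>R ?E b q)"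
    by (rule conn_local[OF oU(1) YU conjunct1[OF cs] Y_eq oU(2)])
  also have "\<dots> = (\<Sum>b\<in>Basis. D p v (\<lambda>q. f b q *\<^sub>R ?E b q))" by (rule conjunct2[OF cs])
  also have "\<dots> = (\<Sum>b\<in>Basis. differential A (f b) p v *\<^sub>R ?E b p + f b p *\<^sub>R D p v (?E b))"
    by (intro sum.cong refl conn_scaleR[OF oU(1) E f oU(2)])
  finally have *: "?\<delta> (D p v Y) = (\<Sum>b\<in>Basis. differential A (f b) p v *\<^sub>R b + f b p *\<^sub>R \<Gamma> c ?x (?\<delta> v) b)"
    using linear_differential_chart[OF c]
    by (simp add: linear_sum linear_add linear_cmul differential_field_in[OF c] cov_deriv_const_field[OF c])
  have df: "differential A (f b) p v = frechet_derivative (rep A c Y) (at ?x) (?\<delta> v) \<bullet> b" for b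
  proof (rule differential_eq(1)[where L="\<lambda>h. frechet_derivative (rep A c Y) (at ?x) h \<bullet> b", OF c])
    show "((f b \<circ> inv_chart c) has_derivative (\<lambda>h. frechet_derivative (rep A c Y) (at ?x) h \<bullet> b)) (at ?x)"
      by (rule has_derivative_transform_within_open[OF has_derivative_inner_left[OF
            C_k_on_Suc_has_derivative[OF CY S(2)]] S f_eq[symmetric]])
  qed
  have "?\<delta> (D p v Y) = (\<Sum>b\<in>Basis. (frechet_derivative (rep A c Y) (at ?x) (?\<delta> v) \<bullet> b) *\<^sub>R b + f b p *\<^sub>R \<Gamma> c ?x (?\<delta> v) b)"
    unfolding * df ..
  also have "\<dots> =
      frechet_derivative (rep A c Y) (at ?x) (?\<delta> v) + (\<Sum>b\<in>Basis. (rep A c Y ?x \<bullet> b) *\<^sub>R \<Gamma> c ?x (?\<delta> v) b)"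
    by (simp add: sum.distrib euclidean_representation f_def)
  also have "(\<Sum>b\<in>Basis. (rep A c Y ?x \<bullet> b) *\<^sub>R \<Gamma> c ?x (?\<delta> v) b) = \<Gamma> c ?x (?\<delta> v) (rep A c Y ?x)"
  proof (rule linear_sum_Basis[symmetric])
    have "linear (\<lambda>w. ?\<delta> (D p v (?E w)))"
    proof (rule linearI)
      fix w w'
      have eq: "?E (w + w') q = ?E w q + ?E w' q" if "q \<in> ?U" for q
        using linear_add[OF linear_transition_deriv[OF c(1) chart_at(1) _ chart_at(2)]] that
        by (simp add: field_in_def)
      have "D p v (?E (w + w')) = D p v (\<lambda>q. ?E w q + ?E w' q)"
        by (rule conn_local[OF oU(1) E vector_field_on_add[OF oU(1) E E] _ oU(2)]) (use eq in blast)
      then show "?\<delta> (D p v (?E (w + w'))) = ?\<delta> (D p v (?E w)) + ?\<delta> (D p v (?E w'))"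
        using conn_add[OF oU(1) E E oU(2)] linear_add[OF linear_differential_chart[OF c]] by simp
    next
      fix k w
      have eq: "?E (k *\<^sub>R w) q = k *\<^sub>R ?E w q" if "q \<in> ?U" for q
        using linear_cmul[OF linear_transition_deriv[OF c(1) chart_at(1) _ chart_at(2)]] that
        by (simp add: field_in_def)
      have "D p v (?E (k *\<^sub>R w)) = D p v (\<lambda>q. k *\<^sub>R ?E w q)"
        by (rule conn_local[OF oU(1) E vector_field_on_scaleR[OF oU(1) smooth_map_on_const E] _ oU(2)]) (use eq in blast)
      then show "?\<delta> (D p v (?E (k *\<^sub>R w))) = k *\<^sub>R ?\<delta> (D p v (?E w))"
        using conn_scaleR[OF oU(1) E smooth_map_on_const oU(2)] linear_cmul[OF linear_differential_chart[OF c]]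
        by (simp add: differential_const)
    qed
    then show "linear (\<Gamma> c ?x (?\<delta> v))" by (simp add: cov_deriv_const_field[OF c])
  qed
  finally show ?thesis .
qed

end

section \<open>Christoffel symbols of a special connection\<close>

lemma J_J [simp]: "J (J v) = - v"
  by (simp add: J_def vec_eq_iff flip: mult.assoc)

lemma bounded_linear_J: "bounded_linear J"
  unfolding J_def[abs_def] by (rule bounded_linear_scale_vec_right)

lemma J_simps: "J (v + w) = J v + J w" "J (k *\<^sub>R v) = k *\<^sub>R J v" "J 0 = 0"
  using linear_add linear_cmul linear_0 bounded_linear.linear[OF bounded_linear_J] by blast+

context flat_special
begin

lemma christoffel_linear:
  assumes c: "c \<in> A" "x \<in> snd c ` fst c"
  shows "linear (\<lambda>v. \<Gamma> c x v w)" "linear (\<Gamma> c x v)"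
proof -
  obtain p where p: "p \<in> fst c" "x = snd c p" using c(2) by auto
  note L = linear_transition_deriv[OF c(1) chart_at(1) p(1) chart_at(2)]
  have eq: "\<Gamma> c x v w = differential A (snd c) p (D p (transition_deriv c (chart_at A p) p v) (field_in A c (\<lambda>_. w)))" for v w
    unfolding christoffel_def p(2) rep_chart[OF c(1) p(1)] cov_deriv_def by (simp add: field_in_def)
  have LD: "linear (\<lambda>v. D p v (field_in A c (\<lambda>_. w)))" for w
    by (rule conn_linear[OF chart_homeo(1)[OF c(1)] constant_field[OF c(1)] p(1)])
  show "linear (\<lambda>v. \<Gamma> c x v w)"
    unfolding eq using linear_compose[OF linear_compose[OF L LD] linear_differential_chart[OF c(1) p(1)]]
    by (simp add: comp_def)
  show "linear (\<Gamma> c x v)"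
  proof (rule linearI)
    fix w w'
    let ?u = "transition_deriv c (chart_at A p) p v" and ?E = "\<lambda>w. field_in A c (\<lambda>_. w)"
    have "D p ?u (?E (w + w')) = D p ?u (\<lambda>q. ?E w q + ?E w' q)"
      by (rule conn_local[OF chart_homeo(1)[OF c(1)] constant_field[OF c(1)]
            vector_field_on_add[OF chart_homeo(1)[OF c(1)] constant_field[OF c(1)] constant_field[OF c(1)]] _ p(1)])
         (simp add: field_in_def linear_add[OF linear_transition_deriv[OF c(1) chart_at(1) _ chart_at(2)]])
    also have "\<dots> = D p ?u (?E w) + D p ?u (?E w')"
      by (rule conn_add[OF chart_homeo(1)[OF c(1)] constant_field[OF c(1)] constant_field[OF c(1)] p(1)])
    finally show "\<Gamma> c x v (w + w') = \<Gamma> c x v w + \<Gamma> c x v w'"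
      unfolding eq by (simp add: linear_add[OF linear_differential_chart[OF c(1) p(1)]])
  next
    fix k w
    let ?u = "transition_deriv c (chart_at A p) p v" and ?E = "\<lambda>w. field_in A c (\<lambda>_. w)"
    have "D p ?u (?E (k *\<^sub>R w)) = D p ?u (\<lambda>q. k *\<^sub>R ?E w q)"
      by (rule conn_local[OF chart_homeo(1)[OF c(1)] constant_field[OF c(1)]
            vector_field_on_scaleR[OF chart_homeo(1)[OF c(1)] smooth_map_on_const constant_field[OF c(1)]] _ p(1)])
         (simp add: field_in_def linear_cmul[OF linear_transition_deriv[OF c(1) chart_at(1) _ chart_at(2)]])
    also have "\<dots> = differential A (\<lambda>q. k) p ?u *\<^sub>R ?E w p + k *\<^sub>R D p ?u (?E w)"
      by (rule conn_scaleR[OF chart_homeo(1)[OF c(1)] constant_field[OF c(1)] smooth_map_on_const p(1)])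
    finally show "\<Gamma> c x v (k *\<^sub>R w) = k *\<^sub>R \<Gamma> c x v w"
      unfolding eq by (simp add: linear_cmul[OF linear_differential_chart[OF c(1) p(1)]] differential_const)
  qed
qed

text \<open>The bracket is defined through the selected chart at p, in which these fields need not
  be constant. There it is the antisymmetrised second derivative of a transition map, which vanishes
  by symmetry.\<close>

lemma lie_bracket_constant_fields:
  assumes c: "c \<in> A" "p \<in> fst c"
  shows "lie_bracket A (field_in A c (\<lambda>_. v)) (field_in A c (\<lambda>_. w)) p = 0"
proof -
  let ?E = "\<lambda>w. field_in A c (\<lambda>_. w)" and ?d = "chart_at A p"
  let ?F = "snd ?d \<circ> inv_chart c" and ?S = "snd c ` (fst c \<inter> fst ?d)"
  note d = chart_at[of p]
  have S: "open ?S" "snd c p \<in> ?S"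
    using open_image[OF c(1) chart_homeo(1)[OF d(1)]] c d by auto
  have F: "C_k_on k ?S ?F" for k
    by (rule cvec_holomorphic_on_imp_C_k_on[OF transition_holomorphic[OF c(1) d(1)] S(1)])
  have F1: "C_k_on (Suc 0) ?S (\<lambda>y. frechet_derivative ?F (at y) u)" for u
    using F[of "Suc (Suc 0)"] C_k_on.simps(2)[of "Suc 0" ?S ?F] by blast
  have inner: "(deriv_along A (?E u) (snd ?d) \<circ> inv_chart c) x = frechet_derivative ?F (at x) u" if x: "x \<in> ?S" for u x
  proof -
    note ci = chart_inv[OF c(1) x]
    have 1: "(?F has_derivative frechet_derivative ?F (at x)) (at (snd c (inv_chart c x)))"
      unfolding ci(1) by (rule C_k_on_Suc_has_derivative[OF F x])
    have "rep A c (?E u) x = u" by (rule rep_field_in[OF c(1)]) (use x in auto)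
    then show ?thesis using deriv_along_eq[OF c(1) ci(2) 1] ci(1) by simp
  qed
  have outer: "deriv_along A (?E u') (deriv_along A (?E u) (snd ?d)) p =
      frechet_derivative (\<lambda>y. frechet_derivative ?F (at y) u) (at (snd c p)) u'" for u u'
  proof -
    have 2: "((deriv_along A (?E u) (snd ?d) \<circ> inv_chart c) has_derivative
        frechet_derivative (\<lambda>y. frechet_derivative ?F (at y) u) (at (snd c p))) (at (snd c p))"
      by (rule has_derivative_transform_within_open[OF C_k_on_Suc_has_derivative[OF F1 S(2)] S inner[symmetric]])
    have "rep A c (?E u') (snd c p) = u'" by (rule rep_field_in[OF c(1)]) (use c(2) in auto)
    then show ?thesis using deriv_along_eq[OF c 2] by simp
  qed
  show ?thesis
    unfolding lie_bracket_def Let_def outer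
    using second_derivative_symmetric[OF S F] by simp
qed

text \<open>On fields with constant coordinates the bracket term of the curvature drops out;
  \<open>cov_deriv_rep\<close>, applied to the field with coordinates \<Gamma>(w, z), gives the two
  sides.\<close>

lemma christoffel_flat:
  assumes c: "c \<in> A" "x \<in> snd c ` fst c"
  shows "frechet_derivative (\<lambda>y. \<Gamma> c y w z) (at x) v + \<Gamma> c x v (\<Gamma> c x w z) =
    frechet_derivative (\<lambda>y. \<Gamma> c y v z) (at x) w + \<Gamma> c x w (\<Gamma> c x v z)"
proof -
  obtain p where p: "p \<in> fst c" "x = snd c p" using c(2) by auto
  let ?E = "\<lambda>w. field_in A c (\<lambda>_. w)"
  note U = chart_homeo(1)[OF c(1)]
  note E = constant_field[OF c(1)]
  have rep_cov: "rep A c (cov_deriv D (?E w) (?E z)) = (\<lambda>y. \<Gamma> c y w z)" for w z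
    by (simp add: christoffel_def fun_eq_iff)
  have second: "differential A (snd c) p (cov_deriv D (?E v) (cov_deriv D (?E w) (?E z)) p) =
      frechet_derivative (\<lambda>y. \<Gamma> c y w z) (at x) v + \<Gamma> c x v (\<Gamma> c x w z)" for v w
    unfolding cov_deriv_def[of D "?E v"]
    using cov_deriv_rep[OF c(1) p(1) U p(1) conn_field[OF U E E], of "?E v p" w z]
    by (simp add: rep_cov differential_field_in[OF c(1) p(1)] p(2))
  have "flat A D" using special unfolding special_complex_manifold_def by blast
  from this[unfolded flat_def, THEN spec, THEN spec, THEN spec, THEN spec, THEN mp, THEN mp, THEN mp, THEN mp,
      THEN bspec, OF U E[of v] E[of w] E[of z] p(1)]
  have "cov_deriv D (?E v) (cov_deriv D (?E w) (?E z)) p - cov_deriv D (?E w) (cov_deriv D (?E v) (?E z)) p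
      - cov_deriv D (lie_bracket A (?E v) (?E w)) (?E z) p = 0" .
  moreover have "cov_deriv D (lie_bracket A (?E v) (?E w)) (?E z) p = 0"
    unfolding cov_deriv_def lie_bracket_constant_fields[OF c(1) p(1)]
    by (rule linear_0[OF conn_linear[OF U E p(1)]])
  ultimately have "cov_deriv D (?E v) (cov_deriv D (?E w) (?E z)) p = cov_deriv D (?E w) (cov_deriv D (?E v) (?E z)) p"
    by simp
  then show ?thesis using second by metis
qed

lemma christoffel_symmetric:
  assumes c: "c \<in> A" "x \<in> snd c ` fst c"
  shows "\<Gamma> c x v w = \<Gamma> c x w v"
proof -
  obtain p where p: "p \<in> fst c" "x = snd c p" using c(2) by auto
  let ?E = "\<lambda>w. field_in A c (\<lambda>_. w)"
  have "torsion_free A D" using special unfolding special_complex_manifold_def by blast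
  from this[unfolded torsion_free_def, THEN spec, THEN spec, THEN spec, THEN mp, THEN mp, THEN mp,
      THEN bspec, OF chart_homeo(1)[OF c(1)] constant_field[OF c(1), of v] constant_field[OF c(1), of w] p(1)]
  have "cov_deriv D (?E v) (?E w) p = cov_deriv D (?E w) (?E v) p"
    by (simp add: lie_bracket_constant_fields[OF c(1) p(1)])
  then show ?thesis unfolding christoffel_def p(2) rep_chart[OF c(1) p(1)] by simp
qed

text \<open>Holomorphy of the transition maps makes J send the field with constant coordinates w to
  the one with coordinates J w. The terms with J outside \<Gamma> cancel by symmetry.\<close>

lemma christoffel_J:
  assumes c: "c \<in> A" "x \<in> snd c ` fst c"
  shows "\<Gamma> c x v (J w) = \<Gamma> c x w (J v)"
proof -
  obtain p where p: "p \<in> fst c" "x = snd c p" using c(2) by auto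
  let ?E = "\<lambda>w. field_in A c (\<lambda>_. w)"
  note U = chart_homeo(1)[OF c(1)]
  have EJ: "J (?E w q) = ?E (J w) q" if "q \<in> fst c" for w q
    unfolding field_in_def J_def using transition_deriv(2)[OF c(1) chart_at(1) that chart_at(2)] by simp
  have JE: "vector_field_on A (fst c) (\<lambda>q. J (?E w q))" for w
  proof (rule vector_field_onI[OF c(1) U order_refl])
    fix k
    have o: "open (snd c ` fst c)" by (rule chart_homeo(2)[OF c(1)])
    have "C_k_on k (snd c ` fst c) (\<lambda>x. J w)" by simp
    also have "?this \<longleftrightarrow> C_k_on k (snd c ` fst c) (rep A c (\<lambda>q. J (?E w q)))"
      by (rule C_k_on_cong[OF o]) (use c(1) EJ in \<open>auto simp: rep_def differential_field_in\<close>)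
    finally show "C_k_on k (snd c ` fst c) (rep A c (\<lambda>q. J (?E w q)))" .
  qed
  have covJ: "cov_deriv_J D (?E v) (?E w) p = cov_deriv D (?E v) (?E (J w)) p - J (cov_deriv D (?E v) (?E w) p)" for v w
    unfolding cov_deriv_J_def cov_deriv_def
    using conn_local[OF U JE constant_field[OF c(1)] _ p(1)] EJ by simp
  have "\<forall>U X Y. open U \<longrightarrow> vector_field_on A U X \<longrightarrow> vector_field_on A U Y \<longrightarrow>
        (\<forall>p\<in>U. cov_deriv_J D X Y p = cov_deriv_J D Y X p)"
    using special unfolding special_complex_manifold_def by blast
  from this[THEN spec, THEN spec, THEN spec, THEN mp, THEN mp, THEN mp,
      THEN bspec, OF U constant_field[OF c(1), of v] constant_field[OF c(1), of w] p(1)]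
  have "differential A (snd c) p (cov_deriv D (?E v) (?E (J w)) p - J (cov_deriv D (?E v) (?E w) p)) =
      differential A (snd c) p (cov_deriv D (?E w) (?E (J v)) p - J (cov_deriv D (?E w) (?E v) p))"
    unfolding covJ by simp
  then have "\<Gamma> c x v (J w) - J (\<Gamma> c x v w) = \<Gamma> c x w (J v) - J (\<Gamma> c x w v)"
    using linear_diff[OF linear_differential_chart[OF c(1) p(1)]]
      differential_chart_scale[OF c(1) p(1)]
    unfolding christoffel_def p(2) rep_chart[OF c(1) p(1)] J_def by simp
  then show ?thesis using christoffel_symmetric[OF c, of v w] by simp
qed

text \<open>The system for a pair \<open>(\<alpha>, f)\<close>: \<open>\<alpha>\<close> is a parallel one-form, written as a vector via the
  inner product, and \<open>df = \<alpha> - \<i> \<alpha> \<circ> J\<close>, so that \<open>f\<close> is holomorphic with \<open>d (Re f) = \<alpha>\<close>.\<close>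

definition affine_system ::
    "('m, 'n) chart \<Rightarrow> complex ^ 'n \<Rightarrow> complex ^ 'n \<Rightarrow> (complex ^ 'n) \<times> complex \<Rightarrow> (complex ^ 'n) \<times> complex" where
  "affine_system c x v e = (\<Sum>b\<in>Basis. (fst e \<bullet> \<Gamma> c x v b) *\<^sub>R b, Complex (fst e \<bullet> v) (- (fst e \<bullet> J v)))"

text \<open>Shows that the sum in \<open>affine_system\<close> is the vector representing the
  functional z \<mapsto> \<alpha> \<bullet> \<Gamma>(v, z).\<close>

lemma inner_dual_christoffel:
  assumes "c \<in> A" "x \<in> snd c ` fst c"
  shows "(\<Sum>b\<in>Basis. (\<alpha> \<bullet> \<Gamma> c x v b) *\<^sub>R b) \<bullet> z = \<alpha> \<bullet> \<Gamma> c x v z"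
proof -
  have "\<alpha> \<bullet> \<Gamma> c x v z = \<alpha> \<bullet> (\<Sum>b\<in>Basis. (z \<bullet> b) *\<^sub>R \<Gamma> c x v b)"
    using linear_sum_Basis[OF christoffel_linear(2)[OF assms], of v z] by simp
  then show ?thesis by (simp add: inner_sum_left inner_sum_right mult.commute inner_commute)
qed

lemma affine_system_deriv:
  assumes "c \<in> A" "x \<in> snd c ` fst c"
  shows "((\<lambda>y. affine_system c y v e) has_derivative
    (\<lambda>h. (\<Sum>b\<in>Basis. (fst e \<bullet> frechet_derivative (\<lambda>y. \<Gamma> c y v b) (at x) h) *\<^sub>R b, 0))) (at x)"
  unfolding affine_system_def
  by (intro has_derivative_Pair has_derivative_const has_derivative_sum has_derivative_scaleR_left
      has_derivative_inner_right C_k_on_Suc_has_derivative[OF C_k_on_christoffel[OF assms(1)] assms(2)])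

lemma total_system_affine:
  assumes c: "c \<in> A"
  shows "total_system (affine_system c) (snd c ` fst c)"
proof
  show o: "open (snd c ` fst c)" by (rule chart_homeo(2)[OF c])
  show "bilinear (affine_system c x)" if x: "x \<in> snd c ` fst c" for x
  proof -
    have \<Gamma>1: "\<Gamma> c x (v + v') b = \<Gamma> c x v b + \<Gamma> c x v' b" "\<Gamma> c x (k *\<^sub>R v) b = k *\<^sub>R \<Gamma> c x v b" for v v' b k
      using linear_add[OF christoffel_linear(1)[OF c x]] linear_cmul[OF christoffel_linear(1)[OF c x]] by auto
    show ?thesis
      unfolding bilinear_def
      by (intro conjI allI linearI)
         (simp_all add: affine_system_def \<Gamma>1 inner_add_left inner_add_right J_simps scaleR_add_left
           sum.distrib scaleR_sum_right complex_eq_iff algebra_simps)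
  qed
  show "C_k_on (Suc 0) (snd c ` fst c) (\<lambda>x. affine_system c x v e)" for v e
  proof -
    have "C_k_on (Suc 0) (snd c ` fst c) (\<lambda>x. \<Sum>b\<in>Basis. (fst e \<bullet> \<Gamma> c x v b) *\<^sub>R b)"
      by (intro C_k_on_sum[OF o] C_k_on_scaleR[OF o] C_k_on_const
          C_k_on_bounded_linear[OF o bounded_linear_inner_right] C_k_on_christoffel[OF c])
    then have "C_k_on (Suc 0) (snd c ` fst c) (\<lambda>x. (\<Sum>b\<in>Basis. (fst e \<bullet> \<Gamma> c x v b) *\<^sub>R b, 0 :: complex))"
      by (rule C_k_on_bounded_linear[OF o bounded_linear_Pair[OF bounded_linear_ident bounded_linear_zero]])
    from C_k_on_add[OF o this C_k_on_const[of _ _ "(0, Complex (fst e \<bullet> v) (- (fst e \<bullet> J v)))"]]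
    show ?thesis by (simp add: affine_system_def)
  qed
qed

text \<open>The first component is flatness, transposed to covectors. In the second, the
  coefficients do not depend on the base point, and what remains vanishes by symmetry of \<Gamma>
  (real part) and by \<open>christoffel_J\<close> (imaginary part).\<close>

lemma affine_system_integrable:
  assumes c: "c \<in> A" "x \<in> snd c ` fst c"
  shows "frechet_derivative (\<lambda>y. affine_system c y w e) (at x) v - frechet_derivative (\<lambda>y. affine_system c y v e) (at x) w =
    affine_system c x v (affine_system c x w e) - affine_system c x w (affine_system c x v e)"
proof -
  have fd: "frechet_derivative (\<lambda>y. affine_system c y v e) (at x) h =
      (\<Sum>b\<in>Basis. (fst e \<bullet> frechet_derivative (\<lambda>y. \<Gamma> c y v b) (at x) h) *\<^sub>R b, 0)" for v h
    using frechet_derivative_at[OF affine_system_deriv[OF c]] by (simp add: fun_eq_iff)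
  have flat: "frechet_derivative (\<lambda>y. \<Gamma> c y w b) (at x) v - frechet_derivative (\<lambda>y. \<Gamma> c y v b) (at x) w =
      \<Gamma> c x w (\<Gamma> c x v b) - \<Gamma> c x v (\<Gamma> c x w b)" for b
    using christoffel_flat[OF c, of w b v] by (simp add: algebra_simps)
  \<comment> \<open>Passing to covectors reverses the order of the two Christoffel maps, which
    matches the reversed order in \<open>flat\<close>.\<close>
  have sys: "affine_system c x v (affine_system c x w e) =
      (\<Sum>b\<in>Basis. (fst e \<bullet> \<Gamma> c x w (\<Gamma> c x v b)) *\<^sub>R b,
       Complex (fst e \<bullet> \<Gamma> c x w v) (- (fst e \<bullet> \<Gamma> c x w (J v))))" for v w
    by (simp add: affine_system_def inner_dual_christoffel[OF c])
  have "(\<Sum>b\<in>Basis. (fst e \<bullet> frechet_derivative (\<lambda>y. \<Gamma> c y w b) (at x) v) *\<^sub>R b) -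
      (\<Sum>b\<in>Basis. (fst e \<bullet> frechet_derivative (\<lambda>y. \<Gamma> c y v b) (at x) w) *\<^sub>R b) =
      (\<Sum>b\<in>Basis. (fst e \<bullet> (frechet_derivative (\<lambda>y. \<Gamma> c y w b) (at x) v - frechet_derivative (\<lambda>y. \<Gamma> c y v b) (at x) w)) *\<^sub>R b)"
    by (simp only: inner_diff_right scaleR_diff_left sum_subtractf)
  also have "\<dots> = (\<Sum>b\<in>Basis. (fst e \<bullet> \<Gamma> c x w (\<Gamma> c x v b)) *\<^sub>R b) - (\<Sum>b\<in>Basis. (fst e \<bullet> \<Gamma> c x v (\<Gamma> c x w b)) *\<^sub>R b)"
    unfolding flat by (simp only: inner_diff_right scaleR_diff_left sum_subtractf)
  finally show ?thesis
    unfolding fd sys using christoffel_symmetric[OF c, of v w] christoffel_J[OF c, of v w] by simp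
qed

lemma affine_system_local_solution:
  assumes c: "c \<in> A" and x0: "x0 \<in> snd c ` fst c"
  obtains r where "r > 0" "ball x0 r \<subseteq> snd c ` fst c"
    "\<And>q e. q \<in> ball x0 r \<Longrightarrow> \<exists>u. u q = e \<and> total_system.solves (affine_system c) (ball x0 r) u"
  using total_system.frobenius_ball[OF total_system_affine[OF c] affine_system_integrable[OF c] x0] by blast

end

section \<open>Holomorphic functions with affine real part\<close>

lemma c_holomorphic_on_cong:
  assumes "open S" "\<And>x. x \<in> S \<Longrightarrow> f x = g x" "c_holomorphic_on S f"
  shows "c_holomorphic_on S g"
  unfolding c_holomorphic_on_def
proof
  fix z assume z: "z \<in> S"
  then obtain L where L: "(f has_derivative L) (at z)" "\<forall>c v. L (c *s v) = c * L v"
    using assms(3) unfolding c_holomorphic_on_def by blast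
  show "\<exists>L. (g has_derivative L) (at z) \<and> (\<forall>c v. L (c *s v) = c * L v)"
    using has_derivative_transform_within_open[OF L(1) assms(1) z assms(2)] L(2) by blast
qed

lemma inner_sum_Basis_left:
  "(\<Sum>b\<in>Basis. k b *\<^sub>R b) \<bullet> v = (\<Sum>b\<in>Basis. (v \<bullet> b) *\<^sub>R k b)" for v :: "'a::euclidean_space"
  unfolding inner_sum_left by (rule sum.cong) (simp_all add: inner_commute mult.commute)

lemma (in total_system) solves_cong:
  assumes "open T" "\<And>x. x \<in> T \<Longrightarrow> u x = w x" "solves T u"
  shows "solves T w"
  unfolding solves_def
proof
  fix x assume x: "x \<in> T"
  then have "(u has_derivative (\<lambda>v. A x v (u x))) (at x)" using assms(3) unfolding solves_def by blast
  from has_derivative_transform_within_open[OF this assms(1) x assms(2)]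
  show "(w has_derivative (\<lambda>v. A x v (w x))) (at x)" using assms(2)[OF x] by simp
qed

context charted
begin

lemma differential_cong:
  assumes "open V" "p \<in> V" "\<And>q. q \<in> V \<Longrightarrow> f q = g q"
  shows "differential A f p = differential A g p"
proof -
  let ?c = "chart_at A p"
  have "frechet_derivative (f \<circ> inv_chart ?c) (at (snd ?c p)) = frechet_derivative (g \<circ> inv_chart ?c) (at (snd ?c p))"
  proof (rule frechet_derivative_cong_open[OF open_image[OF chart_at(1) assms(1)]])
    show "snd ?c p \<in> snd ?c ` (fst ?c \<inter> V)" using chart_at assms(2) by auto
    show "(f \<circ> inv_chart ?c) y = (g \<circ> inv_chart ?c) y" if "y \<in> snd ?c ` (fst ?c \<inter> V)" for y
      using assms(3)[OF chart_inv(3)[OF chart_at(1) that]] by simp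
  qed
  then show ?thesis by (simp add: differential_def Let_def fun_eq_iff)
qed

end

context flat_special
begin

text \<open>A holomorphic function with affine real part. Affineness is tested with fields on
  arbitrary open subsets of U, so that the notion is local.\<close>

definition special_function :: "'m set \<Rightarrow> ('m \<Rightarrow> complex) \<Rightarrow> bool" where
  "special_function U f \<longleftrightarrow>
     (\<forall>c\<in>A. c_holomorphic_on (snd c ` (fst c \<inter> U)) (f \<circ> inv_chart c)) \<and>
     (\<forall>V X Y. open V \<longrightarrow> V \<subseteq> U \<longrightarrow> vector_field_on A V X \<longrightarrow> vector_field_on A V Y \<longrightarrow>
        (\<forall>p\<in>V. cov_deriv_form1 A D (differential A (Re \<circ> f)) X Y p = 0))"

text \<open>The pair that should solve \<open>affine_system c\<close>: the differential of Re f in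
  the coordinates of c, written as a vector, together with f.\<close>

definition jet :: "('m, 'n) chart \<Rightarrow> ('m \<Rightarrow> complex) \<Rightarrow> complex ^ 'n \<Rightarrow> (complex ^ 'n) \<times> complex" where
  "jet c f x = (\<Sum>b\<in>Basis. Re (frechet_derivative (f \<circ> inv_chart c) (at x) b) *\<^sub>R b, f (inv_chart c x))"

lemma special_function_subset:
  assumes "special_function U f" "V \<subseteq> U"
  shows "special_function V f"
  unfolding special_function_def
proof (intro conjI allI ballI impI)
  fix c assume "c \<in> A"
  then have "c_holomorphic_on (snd c ` (fst c \<inter> U)) (f \<circ> inv_chart c)"
    using assms(1) unfolding special_function_def by blast
  then show "c_holomorphic_on (snd c ` (fst c \<inter> V)) (f \<circ> inv_chart c)"
    using assms(2) unfolding c_holomorphic_on_def by auto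
next
  fix W X Y p assume "open W" "W \<subseteq> V" "vector_field_on A W X" "vector_field_on A W Y" "p \<in> W"
  moreover from this have "W \<subseteq> U" using assms(2) by blast
  ultimately show "cov_deriv_form1 A D (differential A (Re \<circ> f)) X Y p = 0"
    using assms(1) unfolding special_function_def by blast
qed

text \<open>Both conditions at a point depend on the germ of f alone; the test fields are restricted
  to the intersection with the neighbourhood on which f equals g.\<close>

lemma special_function_local:
  assumes loc: "\<And>p. p \<in> U \<Longrightarrow> \<exists>V g. open V \<and> p \<in> V \<and> special_function V g \<and> (\<forall>q\<in>V. f q = g q)"
  shows "special_function U f"
  unfolding special_function_def
proof (intro conjI allI ballI impI)
  fix c assume c: "c \<in> A"
  show "c_holomorphic_on (snd c ` (fst c \<inter> U)) (f \<circ> inv_chart c)"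
    unfolding c_holomorphic_on_def
  proof
    fix x assume x: "x \<in> snd c ` (fst c \<inter> U)"
    note ci = chart_inv[OF c x]
    obtain V g where V: "open V" "inv_chart c x \<in> V" "special_function V g" "\<forall>q\<in>V. f q = g q"
      using loc[OF ci(3)] by blast
    have xV: "x \<in> snd c ` (fst c \<inter> V)" using ci(1,2) V(2) by (metis IntI imageI)
    have "c_holomorphic_on (snd c ` (fst c \<inter> V)) (g \<circ> inv_chart c)"
      using V(3) c unfolding special_function_def by blast
    moreover have "(g \<circ> inv_chart c) y = (f \<circ> inv_chart c) y" if "y \<in> snd c ` (fst c \<inter> V)" for y
      using V(4) chart_inv(3)[OF c that] by simp
    ultimately have "c_holomorphic_on (snd c ` (fst c \<inter> V)) (f \<circ> inv_chart c)"
      using c_holomorphic_on_cong[OF open_image[OF c V(1)]] by blast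
    then show "\<exists>L. (f \<circ> inv_chart c has_derivative L) (at x) \<and> (\<forall>c v. L (c *s v) = c * L v)"
      using xV unfolding c_holomorphic_on_def by blast
  qed
next
  fix W X Y p assume W: "open W" "W \<subseteq> U" "vector_field_on A W X" "vector_field_on A W Y" "p \<in> W"
  have "p \<in> U" using W by blast
  from loc[OF this] obtain V g where V: "open V" "p \<in> V" "special_function V g" "\<forall>q\<in>V. f q = g q" by blast
  have d: "differential A (Re \<circ> f) q = differential A (Re \<circ> g) q" if "q \<in> V" for q
    by (rule differential_cong[OF V(1) that]) (use V(4) in simp)
  have "vector_field_on A (V \<inter> W) X" "vector_field_on A (V \<inter> W) Y"
    using vector_field_on_subset W(3,4) by auto
  then have "cov_deriv_form1 A D (differential A (Re \<circ> g)) X Y p = 0"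
    using V W unfolding special_function_def by (meson IntI inf_le1 open_Int)
  moreover have "deriv_along A X (\<lambda>q. differential A (Re \<circ> f) q (Y q)) p = deriv_along A X (\<lambda>q. differential A (Re \<circ> g) q (Y q)) p"
    unfolding deriv_along_def
    using differential_cong[OF V(1,2), of "\<lambda>q. differential A (Re \<circ> f) q (Y q)" "\<lambda>q. differential A (Re \<circ> g) q (Y q)"] d
    by simp
  ultimately show "cov_deriv_form1 A D (differential A (Re \<circ> f)) X Y p = 0"
    unfolding cov_deriv_form1_def using d[OF V(2)] by simp
qed

lemma differential_Re_eq:
  assumes c: "c \<in> A" "p \<in> fst c" and h: "((f \<circ> inv_chart c) has_derivative L) (at (snd c p))"
  shows "differential A (Re \<circ> f) p v = Re (L (differential A (snd c) p v))"
proof (rule differential_eq(1)[where L="\<lambda>v. Re (L v)", OF c])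
  show "((Re \<circ> f \<circ> inv_chart c) has_derivative (\<lambda>v. Re (L v))) (at (snd c p))"
    using bounded_linear.has_derivative[OF bounded_linear_Re h] by (simp add: comp_def)
qed

text \<open>Affineness of Re f, tested on constant-coordinate fields, is the equation for \<alpha>.
  Complex linearity recovers df from its real part and gives the equation for f.\<close>

lemma special_function_solves:
  assumes c: "c \<in> A" and U: "open U" "U \<subseteq> fst c" and f: "special_function U f"
  shows "total_system.solves (affine_system c) (snd c ` U) (jet c f)"
  unfolding total_system.solves_def[OF total_system_affine[OF c]]
proof
  let ?B = "snd c ` U" and ?h = "f \<circ> inv_chart c"
  let ?\<alpha> = "\<lambda>y. \<Sum>b\<in>Basis. Re (frechet_derivative ?h (at y) b) *\<^sub>R b"
  fix x assume x: "x \<in> ?B"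
  have U': "fst c \<inter> U = U" using U(2) by auto
  have B: "open ?B" using open_image[OF c U(1)] U' by simp
  have hol: "c_holomorphic_on ?B ?h" using f c U' unfolding special_function_def by force
  note dh = c_holomorphic_on_derivative[OF hol]
  have \<alpha>: "?\<alpha> y \<bullet> v = Re (frechet_derivative ?h (at y) v)" if "y \<in> ?B" for y v
  proof -
    have "linear (\<lambda>v. Re (frechet_derivative ?h (at y) v))"
      using linear_compose[OF has_derivative_linear[OF dh(1)[OF that]] bounded_linear.linear[OF bounded_linear_Re]]
      by (simp add: comp_def)
    from linear_sum_Basis[OF this, of v] show ?thesis
      unfolding inner_sum_Basis_left by (rule sym)
  qed
  \<comment> \<open>Complex linearity gives Im (df v) = - Re (i df v) = - Re (df (J v)).\<close>
  have dh_eq: "frechet_derivative ?h (at x) v = Complex (?\<alpha> x \<bullet> v) (- (?\<alpha> x \<bullet> J v))" for v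
    unfolding \<alpha>[OF x] J_def dh(2)[OF x] by (simp add: complex_eq_iff)
  obtain p where p: "p \<in> U" "x = snd c p" using x by auto
  then have pc: "p \<in> fst c" using U(2) by auto
  let ?E = "\<lambda>v. field_in A c (\<lambda>_. v)"
  have E: "vector_field_on A U (?E v)" for v by (rule vector_field_on_subset[OF constant_field[OF c] U(2)])
  have h2: "c_holomorphic_on ?B (\<lambda>y. frechet_derivative ?h (at y) b)" for b
    by (rule c_holomorphic_on_directional_derivative[OF hol B])
  have G: "Re (frechet_derivative (\<lambda>y. frechet_derivative ?h (at y) b) (at x) v) = ?\<alpha> x \<bullet> \<Gamma> c x v b" for b v
  proof -
    have dq: "differential A (Re \<circ> f) q w = Re (frechet_derivative ?h (at (snd c q)) (differential A (snd c) q w))"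
      if "q \<in> U" for q w
      by (rule differential_Re_eq[OF c _ dh(1)]) (use that U(2) in auto)
    have "((\<lambda>y. Re (frechet_derivative ?h (at y) b)) has_derivative
        (\<lambda>v. Re (frechet_derivative (\<lambda>y. frechet_derivative ?h (at y) b) (at x) v))) (at x)"
      by (rule bounded_linear.has_derivative[OF bounded_linear_Re c_holomorphic_on_derivative(1)[OF h2 x]])
    then have D1: "(((\<lambda>q. differential A (Re \<circ> f) q (?E b q)) \<circ> inv_chart c) has_derivative
        (\<lambda>v. Re (frechet_derivative (\<lambda>y. frechet_derivative ?h (at y) b) (at x) v))) (at (snd c p))"
      unfolding p(2)[symmetric]
    proof (rule has_derivative_transform_within_open[OF _ B x])
      fix y assume "y \<in> ?B"
      then obtain q where q: "q \<in> U" "y = snd c q" by auto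
      then have qc: "q \<in> fst c" using U(2) by auto
      show "Re (frechet_derivative ?h (at y) b) = ((\<lambda>q. differential A (Re \<circ> f) q (?E b q)) \<circ> inv_chart c) y"
        using dq[OF q(1)] c qc by (simp add: q(2) differential_field_in)
    qed
    have "cov_deriv_form1 A D (differential A (Re \<circ> f)) (?E v) (?E b) p = 0"
      using f U(1) E p(1) unfolding special_function_def by blast
    moreover have "deriv_along A (?E v) (\<lambda>q. differential A (Re \<circ> f) q (?E b q)) p =
        Re (frechet_derivative (\<lambda>y. frechet_derivative ?h (at y) b) (at x) v)"
      using deriv_along_eq[OF c pc D1] by (simp add: rep_chart[OF c pc] differential_field_in[OF c pc])
    moreover have "differential A (Re \<circ> f) p (cov_deriv D (?E v) (?E b) p) = ?\<alpha> x \<bullet> \<Gamma> c x v b"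
      using dq[OF p(1)] \<alpha>[OF x] by (simp add: p(2) christoffel_def rep_chart[OF c pc])
    ultimately show ?thesis unfolding cov_deriv_form1_def by simp
  qed
  have "(?\<alpha> has_derivative (\<lambda>v. \<Sum>b\<in>Basis. Re (frechet_derivative (\<lambda>y. frechet_derivative ?h (at y) b) (at x) v) *\<^sub>R b)) (at x)"
    by (intro has_derivative_sum has_derivative_scaleR_left bounded_linear.has_derivative[OF bounded_linear_Re]
        c_holomorphic_on_derivative(1)[OF h2 x])
  note D\<alpha> = this[unfolded G]
  have e: "affine_system c x v (jet c f x) =
      (\<Sum>b\<in>Basis. (?\<alpha> x \<bullet> \<Gamma> c x v b) *\<^sub>R b, frechet_derivative ?h (at x) v)" for v
    by (simp only: affine_system_def jet_def fst_conv dh_eq[symmetric])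
  have j: "jet c f = (\<lambda>y. (?\<alpha> y, ?h y))" by (simp add: jet_def fun_eq_iff)
  show "(jet c f has_derivative (\<lambda>v. affine_system c x v (jet c f x))) (at x)"
    unfolding e unfolding j by (rule has_derivative_Pair[OF D\<alpha> dh(1)[OF x]])
qed

text \<open>Conversely, v \<mapsto> \<alpha>(v) - i \<alpha>(J v) is complex linear for every real
  \<alpha>, so f is holomorphic; the equation for \<alpha> says that d (Re f) is parallel.\<close>

lemma solves_special_function:
  assumes c: "c \<in> A" and U: "open U" "U \<subseteq> fst c"
    and u: "total_system.solves (affine_system c) (snd c ` U) (\<lambda>x. (\<alpha> x, f (inv_chart c x)))"
  shows "special_function U f"
    and "\<And>p v. p \<in> U \<Longrightarrow> differential A (Re \<circ> f) p v = \<alpha> (snd c p) \<bullet> differential A (snd c) p v"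
proof -
  let ?B = "snd c ` U" and ?h = "f \<circ> inv_chart c"
  have U': "fst c \<inter> U = U" using U(2) by auto
  have B: "open ?B" using open_image[OF c U(1)] U' by simp
  define H where "H x v = Complex (\<alpha> x \<bullet> v) (- (\<alpha> x \<bullet> J v))" for x v
  have u': "((\<lambda>x. (\<alpha> x, f (inv_chart c x))) has_derivative (\<lambda>v. affine_system c x v (\<alpha> x, f (inv_chart c x)))) (at x)"
    if "x \<in> ?B" for x
    using u that unfolding total_system.solves_def[OF total_system_affine[OF c]] by blast
  have d\<alpha>: "(\<alpha> has_derivative (\<lambda>v. \<Sum>b\<in>Basis. (\<alpha> x \<bullet> \<Gamma> c x v b) *\<^sub>R b)) (at x)" if "x \<in> ?B" for x
    using has_derivative_fst[OF u'[OF that]] by (simp add: affine_system_def)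
  have dh: "(?h has_derivative H x) (at x)" if "x \<in> ?B" for x
    using has_derivative_snd[OF u'[OF that]] by (simp add: affine_system_def H_def[abs_def] comp_def)
  \<comment> \<open>Scalar multiplication by z is rewritten through J, since \<alpha> is only real
    linear.\<close>
  have H: "H x (z *s v) = z * H x v" for x z v
  proof -
    have 1: "z *s v = Re z *\<^sub>R v + Im z *\<^sub>R J v"
      by (simp add: vec_eq_iff J_def complex_eq_iff)
    have 2: "J (z *s v) = Re z *\<^sub>R J v - Im z *\<^sub>R v" unfolding 1 by (simp add: J_simps)
    show ?thesis unfolding H_def 2 unfolding 1
      by (simp add: complex_eq_iff inner_add_right inner_diff_right algebra_simps)
  qed
  have hol: "c_holomorphic_on ?B ?h" unfolding c_holomorphic_on_def using dh H by blast
  have dq: "differential A (Re \<circ> f) p v = \<alpha> (snd c p) \<bullet> differential A (snd c) p v" if "p \<in> U" for p v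
    using differential_Re_eq[OF c _ dh, of p v] that U(2) by (auto simp: H_def)
  then show "\<And>p v. p \<in> U \<Longrightarrow> differential A (Re \<circ> f) p v = \<alpha> (snd c p) \<bullet> differential A (snd c) p v" .
  show "special_function U f"
    unfolding special_function_def
  proof (intro conjI allI ballI impI)
    fix d assume d: "d \<in> A"
    have o: "open (snd d ` (fst d \<inter> U))" by (rule open_image[OF d U(1)])
    have "c_holomorphic_on (snd d ` (fst d \<inter> U)) (\<lambda>y. ?h ((snd c \<circ> inv_chart d) y))"
    proof (rule c_holomorphic_on_compose[OF hol])
      show "cvec_holomorphic_on (snd d ` (fst d \<inter> U)) (snd c \<circ> inv_chart d)"
        using transition_holomorphic[OF d c] U(2) unfolding cvec_holomorphic_on_def by blast
      show "(snd c \<circ> inv_chart d) ` snd d ` (fst d \<inter> U) \<subseteq> ?B" using d by auto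
    qed
    then show "c_holomorphic_on (snd d ` (fst d \<inter> U)) (f \<circ> inv_chart d)"
      by (rule c_holomorphic_on_cong[OF o, rotated]) (use c d U(2) in auto)
  next
    fix V X Y p assume V: "open V" "V \<subseteq> U" "vector_field_on A V X" "vector_field_on A V Y" "p \<in> V"
    let ?x = "snd c p"
    have pc: "p \<in> fst c" "p \<in> U" using V(2,5) U(2) by auto
    have V': "fst c \<inter> V = V" using V(2) U(2) by auto
    have S: "open (snd c ` V)" "?x \<in> snd c ` V" using open_image[OF c V(1)] V' V(5) by auto
    have CY: "C_k_on k (snd c ` V) (rep A c Y)" for k
      using V(4) c V' unfolding vector_field_on_rep by force
    have xB: "?x \<in> ?B" using pc(2) by auto
    have "((\<lambda>y. \<alpha> y \<bullet> rep A c Y y) has_derivative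
        (\<lambda>h. \<alpha> ?x \<bullet> frechet_derivative (rep A c Y) (at ?x) h + (\<Sum>b\<in>Basis. (\<alpha> ?x \<bullet> \<Gamma> c ?x h b) *\<^sub>R b) \<bullet> rep A c Y ?x)) (at ?x)"
      by (rule has_derivative_inner[OF d\<alpha>[OF xB] C_k_on_Suc_has_derivative[OF CY S(2)]])
    then have "((\<lambda>y. \<alpha> y \<bullet> rep A c Y y) has_derivative
        (\<lambda>h. \<alpha> ?x \<bullet> (frechet_derivative (rep A c Y) (at ?x) h + \<Gamma> c ?x h (rep A c Y ?x)))) (at ?x)"
      using c pc(1) by (simp add: inner_dual_christoffel inner_add_right)
    then have D1: "(((\<lambda>q. differential A (Re \<circ> f) q (Y q)) \<circ> inv_chart c) has_derivative
        (\<lambda>h. \<alpha> ?x \<bullet> (frechet_derivative (rep A c Y) (at ?x) h + \<Gamma> c ?x h (rep A c Y ?x)))) (at ?x)"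
    proof (rule has_derivative_transform_within_open[OF _ S])
      fix y assume "y \<in> snd c ` V"
      then obtain q where q: "q \<in> V" "y = snd c q" by auto
      then have qc: "q \<in> fst c" "q \<in> U" using V(2) U(2) by auto
      show "\<alpha> y \<bullet> rep A c Y y = ((\<lambda>q. differential A (Re \<circ> f) q (Y q)) \<circ> inv_chart c) y"
        using dq[OF qc(2)] c qc(1) by (simp add: q(2) rep_chart)
    qed
    have "deriv_along A X (\<lambda>q. differential A (Re \<circ> f) q (Y q)) p =
        \<alpha> ?x \<bullet> differential A (snd c) p (D p (X p) Y)"
      using deriv_along_eq[OF c pc(1) D1] cov_deriv_rep[OF c pc(1) V(1,5,4), of "X p"]
      by (simp add: rep_chart[OF c pc(1)])
    then show "cov_deriv_form1 A D (differential A (Re \<circ> f)) X Y p = 0"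
      unfolding cov_deriv_form1_def cov_deriv_def using dq[OF pc(2)] by simp
  qed
qed

end

text \<open>Since two constant loops are freely homotopic, the track of the base point joins their
  values.\<close>

lemma simply_connected_path_between:
  fixes p q :: "'m::topological_space"
  assumes "simply_connected (UNIV :: 'm set)"
  obtains c :: "real \<Rightarrow> 'm" where "path c" "c 0 = p" "c 1 = q"
proof -
  have "homotopic_loops UNIV (\<lambda>t::real. p) (\<lambda>t. q)"
    by (rule assms[unfolded simply_connected_def, THEN spec[of _ "\<lambda>t. p"], THEN spec[of _ "\<lambda>t. q"], THEN mp])
       (simp add: pathfinish_def pathstart_def path_def)
  then obtain h :: "real \<times> real \<Rightarrow> 'm" where h: "continuous_on ({0..1} \<times> {0..1}) h"
    "\<forall>x\<in>{0..1}. h (0, x) = p" "\<forall>x\<in>{0..1}. h (1, x) = q"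
    unfolding homotopic_loops by blast
  have "continuous_on {0..1} (\<lambda>s. h (s, 0))"
    by (rule continuous_on_compose2[OF h(1)]) (auto intro!: continuous_intros)
  then show ?thesis using that[of "\<lambda>s. h (s, 0)"] h(2,3) by (simp add: path_def)
qed

lemma simply_connected_imp_connected_UNIV:
  assumes "simply_connected (UNIV :: ('m::topological_space) set)"
  shows "connected (UNIV :: ('m::topological_space) set)"
proof (rule path_connected_imp_connected)
  show "path_connected (UNIV :: 'm set)"
    unfolding path_connected_def
  proof (intro ballI)
    fix p q :: 'm
    obtain c :: "real \<Rightarrow> 'm" where "path c" "c 0 = p" "c 1 = q" by (rule simply_connected_path_between[OF assms])
    then show "\<exists>g. path g \<and> path_image g \<subseteq> UNIV \<and> pathstart g = p \<and> pathfinish g = q"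
      by (intro exI[of _ c]) (simp add: pathstart_def pathfinish_def)
  qed
qed

lemma connected_UNIV_induction:
  fixes p r :: "'m::topological_space"
  assumes "connected (UNIV :: 'm set)" "P p"
    and "\<And>q. \<exists>W. open W \<and> q \<in> W \<and> (\<forall>x\<in>W. \<forall>y\<in>W. P x \<longrightarrow> P y)"
  shows "P r"
  by (rule connected_induction_simple[where P=P, OF assms(1) UNIV_I UNIV_I assms(2)]) (use assms(3) in simp)

section \<open>Global continuation of special functions\<close>

context flat_special
begin

text \<open>The image is a ball in order that uniqueness of solutions, which needs connectedness,
  applies on all of W; \<open>frobenius_ball\<close> provides the solutions.\<close>

definition affine_nbhd :: "('m, 'n) chart \<Rightarrow> complex ^ 'n \<Rightarrow> real \<Rightarrow> 'm set \<Rightarrow> bool" where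
  "affine_nbhd c x0 r W \<longleftrightarrow> c \<in> A \<and> open W \<and> W \<subseteq> fst c \<and> snd c ` W = ball x0 r \<and> path_connected W \<and>
     (\<forall>q e. q \<in> ball x0 r \<longrightarrow> (\<exists>u. u q = e \<and> total_system.solves (affine_system c) (ball x0 r) u))"

lemma affine_nbhdD:
  assumes "affine_nbhd c x0 r W"
  shows "c \<in> A" "open W" "W \<subseteq> fst c" "snd c ` W = ball x0 r" "path_connected W"
    "q \<in> ball x0 r \<Longrightarrow> \<exists>u. u q = e \<and> total_system.solves (affine_system c) (ball x0 r) u"
    "ball x0 r \<subseteq> snd c ` fst c"
proof -
  show "c \<in> A" "open W" "W \<subseteq> fst c" "snd c ` W = ball x0 r" "path_connected W"
    using assms unfolding affine_nbhd_def by simp_all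
  then show "ball x0 r \<subseteq> snd c ` fst c" by blast
  show "\<exists>u. u q = e \<and> total_system.solves (affine_system c) (ball x0 r) u" if "q \<in> ball x0 r"
    using assms that unfolding affine_nbhd_def by blast
qed

lemma affine_nbhd_exists: "\<exists>x0 r W. affine_nbhd (chart_at A p) x0 r W \<and> p \<in> W"
proof -
  let ?c = "chart_at A p" and ?x0 = "snd (chart_at A p) p"
  note c = chart_at[of p]
  have "?x0 \<in> snd ?c ` fst ?c" using c by auto
  then obtain r where r: "r > 0" "ball ?x0 r \<subseteq> snd ?c ` fst ?c"
    "\<And>q e. q \<in> ball ?x0 r \<Longrightarrow> \<exists>u. u q = e \<and> total_system.solves (affine_system ?c) (ball ?x0 r) u"
    using affine_system_local_solution[OF c(1)] by blast
  define W where "W = {q \<in> fst ?c. snd ?c q \<in> ball ?x0 r}"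
  have img: "snd ?c ` W = ball ?x0 r" using r(2) unfolding W_def by auto
  have "W = inv_chart ?c ` ball ?x0 r"
    unfolding img[symmetric] using c(1) by (auto simp: W_def image_image image_iff)
  moreover have "continuous_on (ball ?x0 r) (inv_chart ?c)"
    by (rule continuous_on_subset[OF homeomorphism_cont2[OF chart_homeo(3)[OF c(1)]] r(2)])
  ultimately have "path_connected W"
    using path_connected_continuous_image[OF _ convex_imp_path_connected[OF convex_ball], of ?x0 r "inv_chart ?c"]
    by simp
  then have "affine_nbhd ?c ?x0 r W"
    unfolding affine_nbhd_def using c(1) open_preimage[OF c(1) open_ball, of ?x0 r] img
    by (intro conjI allI impI r(3)) (simp_all add: W_def subset_iff)
  moreover have "p \<in> W" using c(2) r(1) by (simp add: W_def)
  ultimately show ?thesis by blast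
qed

lemma special_function_of_solution:
  assumes W: "affine_nbhd c x0 r W" and u: "total_system.solves (affine_system c) (ball x0 r) u"
  shows "special_function W (\<lambda>p. snd (u (snd c p)))"
    and "p \<in> W \<Longrightarrow> differential A (Re \<circ> (\<lambda>p. snd (u (snd c p)))) p v = fst (u (snd c p)) \<bullet> differential A (snd c) p v"
proof -
  note W = affine_nbhdD[OF W]
  have "total_system.solves (affine_system c) (snd c ` W) (\<lambda>x. (fst (u x), (\<lambda>p. snd (u (snd c p))) (inv_chart c x)))"
    unfolding W(4)
  proof (rule total_system.solves_cong[OF total_system_affine[OF W(1)] open_ball _ u])
    fix x assume "x \<in> ball x0 r"
    then have "x \<in> snd c ` (fst c \<inter> UNIV)" using W(7) by auto
    from chart_inv(1)[OF W(1) this] show "u x = (fst (u x), (\<lambda>p. snd (u (snd c p))) (inv_chart c x))" by simp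
  qed
  from solves_special_function[OF W(1-3) this]
  show "special_function W (\<lambda>p. snd (u (snd c p)))"
    and "p \<in> W \<Longrightarrow> differential A (Re \<circ> (\<lambda>p. snd (u (snd c p)))) p v = fst (u (snd c p)) \<bullet> differential A (snd c) p v"
    by blast+
qed

lemma jet_solves:
  assumes W: "affine_nbhd c x0 r W" and f: "special_function W f"
  shows "total_system.solves (affine_system c) (ball x0 r) (jet c f)"
  using special_function_solves[OF affine_nbhdD(1-3)[OF W] f] affine_nbhdD(4)[OF W] by simp

lemma solution_unique:
  assumes W: "affine_nbhd c x0 r W" and T: "T \<subseteq> snd c ` fst c" "open T" "connected T"
    and "total_system.solves (affine_system c) T u" "total_system.solves (affine_system c) T w"
    and "a \<in> T" "u a = w a" "x \<in> T"
  shows "u x = w x"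
  using total_system.solves_unique[OF total_system_affine[OF affine_nbhdD(1)[OF W]] assms(5,6) T assms(7-9)] .

text \<open>A germ extends by solving the system on the coordinate ball with its jet as initial
  value. Equal germs have equal jets, hence give equal solutions.\<close>

sublocale continuation special_function
proof
  show "special_function U f" if "open U" "\<And>p. p \<in> U \<Longrightarrow> \<exists>V g. open V \<and> p \<in> V \<and> special_function V g \<and> (\<forall>q\<in>V. f q = g q)"
    for U f using that(2) by (rule special_function_local)
  fix p
  obtain x0 r W where W0: "affine_nbhd (chart_at A p) x0 r W" "p \<in> W" using affine_nbhd_exists by blast
  define c where "c = chart_at A p"
  have W1: "affine_nbhd c x0 r W" using W0(1) unfolding c_def .
  note W = affine_nbhdD[OF W1]
  have "\<exists>g. special_function W g \<and> same_germ q g f"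
    if q: "q \<in> W" and V: "open V" "q \<in> V" and f: "special_function V f" for q V f
  proof -
    let ?x = "snd c q"
    have x: "?x \<in> ball x0 r" using q W(4) by blast
    obtain u where u: "u ?x = jet c f ?x" "total_system.solves (affine_system c) (ball x0 r) u"
      using W(6)[OF x] by blast
    define g where "g p = snd (u (snd c p))" for p
    have g: "special_function W g" unfolding g_def using special_function_of_solution(1)[OF W1 u(2)] by simp
    have VW: "open (V \<inter> W)" "V \<inter> W \<subseteq> fst c" "special_function (V \<inter> W) f"
      using V(1) W(2,3) special_function_subset[OF f] by auto
    have o: "open (snd c ` (V \<inter> W))" using open_image[OF W(1) VW(1)] VW(2) by (simp add: Int_absorb1)
    moreover have "?x \<in> snd c ` (V \<inter> W)" using q V(2) by blast
    ultimately obtain s where s: "s > 0" "ball ?x s \<subseteq> snd c ` (V \<inter> W)" using openE by blast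
    \<comment> \<open>Uniqueness needs a connected set, so solution and jet are compared on a ball
      inside the image of V \<inter> W.\<close>
    have eq: "u x = jet c f x" if "x \<in> ball ?x s" for x
    proof (rule solution_unique[where u=u and w="jet c f" and a="?x", OF W1 _ open_ball connected_ball _ _ _ u(1) that])
      show "ball ?x s \<subseteq> snd c ` fst c" using s(2) VW(2) by blast
      have "ball ?x s \<subseteq> ball x0 r" using s(2) W(4) by blast
      then show "total_system.solves (affine_system c) (ball ?x s) u"
        using total_system.solves_subset[OF total_system_affine[OF W(1)] u(2)] by blast
      show "total_system.solves (affine_system c) (ball ?x s) (jet c f)"
        using total_system.solves_subset[OF total_system_affine[OF W(1)] special_function_solves[OF W(1) VW] s(2)] .
    qed (use s(1) in simp)
    have "same_germ q g f"
      unfolding same_germ_def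
    proof (intro exI conjI ballI)
      show "open {p \<in> fst c. snd c p \<in> ball ?x s}" by (rule open_preimage[OF W(1) open_ball])
      show "q \<in> {p \<in> fst c. snd c p \<in> ball ?x s}" using q W(3) s(1) by auto
      fix y assume "y \<in> {p \<in> fst c. snd c p \<in> ball ?x s}"
      then show "g y = f y" using eq[of "snd c y"] W(1) by (simp add: g_def jet_def)
    qed
    then show ?thesis using g by blast
  qed
  moreover have "g x = h x"
    if g: "special_function W g" and h: "special_function W h" and q: "q \<in> W" and gh: "same_germ q g h" and x: "x \<in> W"
    for g h q x
  proof -
    obtain V where V: "open V" "q \<in> V" "\<forall>y\<in>V. g y = h y" using gh unfolding same_germ_def by blast
    have qc: "q \<in> fst c" "x \<in> fst c" using q x W(3) by auto
    have "frechet_derivative (g \<circ> inv_chart c) (at (snd c q)) = frechet_derivative (h \<circ> inv_chart c) (at (snd c q))"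
    proof (rule frechet_derivative_cong_open[OF open_image[OF W(1) V(1)]])
      show "snd c q \<in> snd c ` (fst c \<inter> V)" using qc V(2) by blast
      show "(g \<circ> inv_chart c) y = (h \<circ> inv_chart c) y" if "y \<in> snd c ` (fst c \<inter> V)" for y
        using chart_inv(3)[OF W(1) that] V(3) by simp
    qed
    then have j: "jet c g (snd c q) = jet c h (snd c q)"
      using V(2,3) W(1) qc(1) by (simp add: jet_def)
    have "snd c q \<in> ball x0 r" "snd c x \<in> ball x0 r" using q x W(4) by blast+
    then have "jet c g (snd c x) = jet c h (snd c x)"
      using solution_unique[where u="jet c g" and w="jet c h" and a="snd c q",
            OF W1 W(7) open_ball connected_ball jet_solves[OF W1 g] jet_solves[OF W1 h] _ j] by simp
    then show ?thesis using W(1) qc(2) by (simp add: jet_def)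
  qed
  ultimately show "\<exists>W. open W \<and> p \<in> W \<and> path_connected W \<and>
      (\<forall>q V f. q \<in> W \<longrightarrow> open V \<longrightarrow> q \<in> V \<longrightarrow> special_function V f \<longrightarrow> (\<exists>g. special_function W g \<and> same_germ q g f)) \<and>
      (\<forall>g h q. special_function W g \<longrightarrow> special_function W h \<longrightarrow> q \<in> W \<longrightarrow> same_germ q g h \<longrightarrow> (\<forall>x\<in>W. g x = h x))"
    using W(2,5) W0(2) by (intro exI[of _ W]) simp
qed

lemma special_function_holomorphic:
  "special_function U f \<Longrightarrow> c \<in> A \<Longrightarrow> c_holomorphic_on (snd c ` (fst c \<inter> U)) (f \<circ> inv_chart c)"
  unfolding special_function_def by simp

lemma special_function_affine:
  assumes "special_function U f" "open V" "V \<subseteq> U" "vector_field_on A V X" "vector_field_on A V Y" "p \<in> V"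
  shows "deriv_along A X (\<lambda>q. differential A (Re \<circ> f) q (Y q)) p = differential A (Re \<circ> f) p (cov_deriv D X Y p)"
  using assms(1)[unfolded special_function_def, THEN conjunct2, THEN spec, THEN spec, THEN spec, THEN mp, THEN mp,
      THEN mp, THEN mp, THEN bspec, OF assms(2-6)]
  unfolding cov_deriv_form1_def by simp

lemma special_function_differential:
  assumes c: "c \<in> A" "p \<in> fst c" and f: "special_function U f" "p \<in> U"
  shows "((f \<circ> inv_chart c) has_derivative frechet_derivative (f \<circ> inv_chart c) (at (snd c p))) (at (snd c p))"
    and "frechet_derivative (f \<circ> inv_chart c) (at (snd c p)) (z *s v) = z * frechet_derivative (f \<circ> inv_chart c) (at (snd c p)) v"
    and "differential A f p v = frechet_derivative (f \<circ> inv_chart c) (at (snd c p)) (differential A (snd c) p v)"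
    and "differential A (Re \<circ> f) p v = Re (differential A f p v)"
    and "differential A f p (z *s v) = z * differential A f p v"
proof -
  have h: "c_holomorphic_on (snd c ` (fst c \<inter> U)) (f \<circ> inv_chart c)" "snd c p \<in> snd c ` (fst c \<inter> U)"
    using special_function_holomorphic[OF f(1) c(1)] f(2) c(2) by simp_all
  note d = c_holomorphic_on_derivative[OF h]
  show "((f \<circ> inv_chart c) has_derivative frechet_derivative (f \<circ> inv_chart c) (at (snd c p))) (at (snd c p))"
    and "frechet_derivative (f \<circ> inv_chart c) (at (snd c p)) (z *s v) = z * frechet_derivative (f \<circ> inv_chart c) (at (snd c p)) v"
    by (rule d)+
  show e: "differential A f p v = frechet_derivative (f \<circ> inv_chart c) (at (snd c p)) (differential A (snd c) p v)" for v
    by (rule differential_eq(1)[OF c d(1)])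
  show "differential A (Re \<circ> f) p v = Re (differential A f p v)"
    unfolding e by (rule differential_Re_eq[OF c d(1)])
  show "differential A f p (z *s v) = z * differential A f p v"
    unfolding e differential_chart_scale[OF c] by (rule d(2))
qed

text \<open>A pair \<open>(0, k)\<close> with \<open>k\<close> constant solves the system, so a solution whose first component
  vanishes somewhere is of this form.\<close>

lemma special_function_constant:
  assumes con: "connected (UNIV :: 'm set)" and f: "special_function UNIV f"
    and zero: "\<And>v. differential A (Re \<circ> f) p v = 0"
  shows "f q = f p"
proof -
  have const: "f y = f x" if W: "affine_nbhd c x0 r W" and xy: "x \<in> W" "y \<in> W"
    and z: "\<And>v. differential A (Re \<circ> f) x v = 0" for c x0 r W x y
  proof -
    note Wd = affine_nbhdD[OF W]
    have fW: "special_function W f" by (rule special_function_subset[OF f]) simp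
    have c: "x \<in> fst c" "y \<in> fst c" using xy Wd(3) by auto
    have "Re (frechet_derivative (f \<circ> inv_chart c) (at (snd c x)) b) = 0" for b
      using z[of "field_in A c (\<lambda>_. b) x"] special_function_differential(3,4)[OF Wd(1) c(1) f UNIV_I]
        differential_field_in[OF Wd(1) c(1)] by simp
    then have j: "jet c f (snd c x) = (0, f x)" using Wd(1) c(1) by (simp add: jet_def)
    have "total_system.solves (affine_system c) (ball x0 r) (\<lambda>_. (0, f x))"
      unfolding total_system.solves_def[OF total_system_affine[OF Wd(1)]]
    proof
      fix y assume "y \<in> ball x0 r"
      have "affine_system c y v (0, f x) = 0" for v
        by (simp add: affine_system_def complex_eq_iff zero_prod_def)
      then show "((\<lambda>_. (0, f x)) has_derivative (\<lambda>v. affine_system c y v (0, f x))) (at y)" by simp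
    qed
    moreover have "snd c x \<in> ball x0 r" "snd c y \<in> ball x0 r" using xy Wd(4) by blast+
    ultimately have "jet c f (snd c y) = (0, f x)"
      using solution_unique[where u="jet c f" and w="\<lambda>_. (0, f x)" and a="snd c x",
          OF W Wd(7) open_ball connected_ball jet_solves[OF W fW] _ _ j] by simp
    then show ?thesis using Wd(1) c(2) by (simp add: jet_def)
  qed
  have all_zero: "\<forall>v. differential A (Re \<circ> f) q v = 0" for q
  proof (rule connected_UNIV_induction[OF con, where P="\<lambda>q. \<forall>v. differential A (Re \<circ> f) q v = 0" and p=p])
    fix q
    obtain x0 r W where W: "affine_nbhd (chart_at A q) x0 r W" "q \<in> W" using affine_nbhd_exists by blast
    have "\<forall>v. differential A (Re \<circ> f) y v = 0" if "x \<in> W" "y \<in> W" "\<forall>v. differential A (Re \<circ> f) x v = 0" for x y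
    proof -
      \<comment> \<open>Vanishing at one point of W makes f constant on W, so the differential
        vanishes throughout W and the property spreads.\<close>
      have "differential A (Re \<circ> f) y = differential A (\<lambda>_. Re (f x)) y"
        by (rule differential_cong[OF affine_nbhdD(2)[OF W(1)] that(2)])
           (use const[OF W(1) that(1)] that(3) in simp)
      then show ?thesis by (simp add: differential_const)
    qed
    note step = this
    show "\<exists>W. open W \<and> q \<in> W \<and> (\<forall>x\<in>W. \<forall>y\<in>W. (\<forall>v. differential A (Re \<circ> f) x v = 0) \<longrightarrow> (\<forall>v. differential A (Re \<circ> f) y v = 0))"
      by (intro exI[of _ W] conjI ballI impI affine_nbhdD(2)[OF W(1)] W(2)) (rule step)
  qed (use zero in blast)
  show ?thesis
  proof (rule connected_UNIV_induction[OF con, where P="\<lambda>q. f q = f p" and p=p])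
    fix q
    obtain x0 r W where W: "affine_nbhd (chart_at A q) x0 r W" "q \<in> W" using affine_nbhd_exists by blast
    have "f y = f p" if "x \<in> W" "y \<in> W" "f x = f p" for x y
      using const[OF W(1) that(1,2)] all_zero that(3) by simp
    note step = this
    show "\<exists>W. open W \<and> q \<in> W \<and> (\<forall>x\<in>W. \<forall>y\<in>W. f x = f p \<longrightarrow> f y = f p)"
      by (intro exI[of _ W] conjI ballI impI affine_nbhdD(2)[OF W(1)] W(2)) (rule step)
  qed simp
qed

lemma special_function_exists:
  assumes sc: "simply_connected (UNIV :: 'm set)" and L: "linear (L :: complex ^ 'n \<Rightarrow> real)"
  obtains f where "special_function UNIV f" "\<And>v. differential A (Re \<circ> f) p v = L v"
proof -
  obtain x0 r W where W: "affine_nbhd (chart_at A p) x0 r W" "p \<in> W" using affine_nbhd_exists by blast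
  let ?c = "chart_at A p"
  note Wd = affine_nbhdD[OF W(1)]
  have x: "snd ?c p \<in> ball x0 r" using W(2) Wd(4) by blast
  \<comment> \<open>Tangent vectors at p are their own coordinates in the selected chart, so the
    vector representing L is the initial value of \<alpha>. The free additive constant of f is set
    to 0.\<close>
  obtain u where u: "u (snd ?c p) = ((\<Sum>b\<in>Basis. L b *\<^sub>R b), 0)"
    "total_system.solves (affine_system ?c) (ball x0 r) u"
    using Wd(6)[OF x] by blast
  define g where "g p = snd (u (snd ?c p))" for p
  have g: "special_function W g" unfolding g_def by (rule special_function_of_solution(1)[OF W(1) u(2)])
  have dg: "differential A (Re \<circ> g) p v = L v" for v
  proof -
    have "differential A (snd ?c) p v = v"
      unfolding differential_chart by (rule transition_deriv_self[OF chart_at])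
    then have "differential A (Re \<circ> g) p v = (\<Sum>b\<in>Basis. L b *\<^sub>R b) \<bullet> v"
      using special_function_of_solution(2)[OF W(1) u(2) W(2), of v] u(1) by (simp add: g_def[abs_def])
    also have "\<dots> = L v" unfolding inner_sum_Basis_left by (rule linear_sum_Basis[OF L, symmetric])
    finally show ?thesis .
  qed
  have "section_at p g" unfolding section_at_def using g Wd(2) W(2) by blast
  then obtain f where f: "special_function UNIV f" "same_germ p f g" using global_section[OF sc] by blast
  obtain V where V: "open V" "p \<in> V" "\<forall>q\<in>V. f q = g q" using f(2) unfolding same_germ_def by blast
  have "differential A (Re \<circ> f) p = differential A (Re \<circ> g) p"
    by (rule differential_cong[OF V(1,2)]) (use V(3) in simp)
  then show ?thesis using that[OF f(1)] dg by simp
qed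

lemma C_k_on_special_function_differential:
  assumes c: "c \<in> A" and U: "open U" and f: "special_function UNIV f" and Y: "vector_field_on A U Y"
  shows "C_k_on k (snd c ` (fst c \<inter> U)) ((\<lambda>q. differential A (Re \<circ> f) q (Y q)) \<circ> inv_chart c)"
proof -
  let ?S = "snd c ` (fst c \<inter> U)" and ?h = "f \<circ> inv_chart c"
  note S = open_image[OF c U]
  have hol: "c_holomorphic_on ?S ?h"
    by (rule special_function_holomorphic[OF special_function_subset[OF f subset_UNIV] c])
  have "C_k_on k ?S (\<lambda>y. frechet_derivative ?h (at y) (rep A c Y y))"
  proof (rule C_k_on_linear_apply[where L="\<lambda>y. frechet_derivative ?h (at y)" and f="rep A c Y", OF S])
    show "linear (frechet_derivative ?h (at y))" if "y \<in> ?S" for y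
      using has_derivative_linear[OF c_holomorphic_on_derivative(1)[OF hol that]] .
    show "C_k_on k ?S (\<lambda>y. frechet_derivative ?h (at y) b)" for b
      by (rule c_holomorphic_on_imp_C_k_on[OF c_holomorphic_on_directional_derivative[OF hol S] S])
    show "C_k_on k ?S (rep A c Y)" using Y c unfolding vector_field_on_rep by blast
  qed
  then have "C_k_on k ?S (\<lambda>y. Re (frechet_derivative ?h (at y) (rep A c Y y)))"
    by (rule C_k_on_bounded_linear[OF S bounded_linear_Re])
  also have "?this \<longleftrightarrow> ?thesis"
  proof (rule C_k_on_cong[OF S])
    fix y assume "y \<in> ?S"
    then obtain q where q: "q \<in> fst c" "y = snd c q" by auto
    show "Re (frechet_derivative ?h (at y) (rep A c Y y)) = ((\<lambda>q. differential A (Re \<circ> f) q (Y q)) \<circ> inv_chart c) y"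
      using special_function_differential(3,4)[OF c q(1) f UNIV_I] c q(1) by (simp add: q(2) rep_chart)
  qed
  finally show ?thesis .
qed

text \<open>The coefficients are real: complex ones would bring the imaginary parts, which need not
  be affine, into the real part.\<close>

lemma special_function_lincomb:
  assumes "finite I" "\<And>i. i \<in> I \<Longrightarrow> special_function UNIV (f i)"
  shows "special_function UNIV (\<lambda>q. \<Sum>i\<in>I. of_real (a i) * f i q)"
    and "differential A (\<lambda>q. \<Sum>i\<in>I. of_real (a i) * f i q) p v = (\<Sum>i\<in>I. of_real (a i) * differential A (f i) p v)"
proof -
  let ?g = "\<lambda>q. \<Sum>i\<in>I. of_real (a i) * f i q"
  have D: "((?g \<circ> inv_chart c) has_derivative
      (\<lambda>v. \<Sum>i\<in>I. of_real (a i) * frechet_derivative (f i \<circ> inv_chart c) (at (snd c p)) v)) (at (snd c p))"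
    if c: "c \<in> A" "p \<in> fst c" for c p
    unfolding comp_def
    by (intro has_derivative_sum has_derivative_mult_right)
       (use special_function_differential(1)[OF c assms(2) UNIV_I] in \<open>simp add: comp_def\<close>)
  show dg: "differential A ?g p v = (\<Sum>i\<in>I. of_real (a i) * differential A (f i) p v)" for p v
    using differential_eq(1)[OF chart_at D[OF chart_at]] special_function_differential(3)[OF chart_at assms(2) UNIV_I]
    by simp
  have dRe: "differential A (Re \<circ> ?g) p v = (\<Sum>i\<in>I. a i * differential A (Re \<circ> f i) p v)" for p v
    using differential_Re_eq[OF chart_at D[OF chart_at]] special_function_differential(3,4)[OF chart_at assms(2) UNIV_I]
    by (simp add: Re_sum)
  show "special_function UNIV ?g"
    unfolding special_function_def
  proof (intro conjI allI ballI impI)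
    fix c assume c: "c \<in> A"
    show "c_holomorphic_on (snd c ` (fst c \<inter> UNIV)) (?g \<circ> inv_chart c)"
      unfolding c_holomorphic_on_def
    proof
      fix x assume "x \<in> snd c ` (fst c \<inter> UNIV)"
      then obtain p where p: "p \<in> fst c" "x = snd c p" by auto
      show "\<exists>L. (?g \<circ> inv_chart c has_derivative L) (at x) \<and> (\<forall>c v. L (c *s v) = c * L v)"
        unfolding p(2)
        using D[OF c p(1)] special_function_differential(2)[OF c p(1) assms(2) UNIV_I]
        by (intro exI conjI) (assumption, simp add: sum_distrib_left mult.left_commute)
    qed
  next
    fix V X Y p assume V: "open V" "V \<subseteq> UNIV" "vector_field_on A V X" "vector_field_on A V Y" "p \<in> V"
    let ?c = "chart_at A p"
    have aff: "deriv_along A X (\<lambda>q. differential A (Re \<circ> f i) q (Y q)) p = differential A (Re \<circ> f i) p (cov_deriv D X Y p)"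
      if "i \<in> I" for i
      by (rule special_function_affine[OF assms(2)[OF that] V])
    have sm: "(((\<lambda>q. differential A (Re \<circ> f i) q (Y q)) \<circ> inv_chart ?c) has_derivative
        frechet_derivative ((\<lambda>q. differential A (Re \<circ> f i) q (Y q)) \<circ> inv_chart ?c) (at (snd ?c p))) (at (snd ?c p))"
      if "i \<in> I" for i
      by (rule C_k_on_Suc_has_derivative[OF C_k_on_special_function_differential[OF chart_at(1) V(1) assms(2)[OF that] V(4), of "Suc 0"]])
         (use chart_at(2) V(5) in simp)
    have "((\<lambda>q. \<Sum>i\<in>I. a i * differential A (Re \<circ> f i) q (Y q)) \<circ> inv_chart ?c has_derivative
        (\<lambda>v. \<Sum>i\<in>I. a i * frechet_derivative ((\<lambda>q. differential A (Re \<circ> f i) q (Y q)) \<circ> inv_chart ?c) (at (snd ?c p)) v)) (at (snd ?c p))"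
      unfolding comp_def by (intro has_derivative_sum has_derivative_mult_right) (use sm in \<open>simp add: comp_def\<close>)
    from deriv_along_eq[OF chart_at this, of X]
    have "deriv_along A X (\<lambda>q. differential A (Re \<circ> ?g) q (Y q)) p = (\<Sum>i\<in>I. a i * deriv_along A X (\<lambda>q. differential A (Re \<circ> f i) q (Y q)) p)"
      using deriv_along_eq[OF chart_at sm, of _ X] by (simp add: dRe)
    then show "cov_deriv_form1 A D (differential A (Re \<circ> ?g)) X Y p = 0"
      unfolding cov_deriv_form1_def by (simp add: aff dRe)
  qed
qed

end

section \<open>Alternating forms\<close>

lemma alternating_antisym:
  fixes B :: "'a::real_vector \<Rightarrow> 'a \<Rightarrow> real"
  assumes "bilinear B" "\<And>v. B v v = 0"
  shows "B u v = - B v u"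
proof -
  have "B (u + v) (u + v) = B u u + B u v + B v u + B v v"
    by (simp add: bilinear_ladd[OF assms(1)] bilinear_radd[OF assms(1)])
  then show ?thesis using assms(2)[of "u + v"] assms(2)[of u] assms(2)[of v] by simp
qed

text \<open>Splitting off a hyperbolic plane enlarges the radical by two dimensions.\<close>

lemma alternating_form_decomposition:
  fixes B :: "'a::euclidean_space \<Rightarrow> 'a \<Rightarrow> real"
  assumes "bilinear B" "\<And>v. B v v = 0"
  shows "\<exists>(k::nat) a b. 2 * k + dim {u. \<forall>v. B u v = 0} \<le> DIM('a) \<and> (\<forall>i<k. linear (a i) \<and> linear (b i)) \<and>
    (\<forall>u v. B u v = (\<Sum>i<k. a i u * b i v - a i v * b i u))"
  using assms
proof (induction "DIM('a) - dim {u. \<forall>v. B u v = 0}" arbitrary: B rule: less_induct)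
  case less
  note bil = less.prems(1) and alt = less.prems(2)
  note anti = alternating_antisym[OF bil alt]
  have lin: "linear (B u)" "linear (\<lambda>u. B u v)" for u v using bil unfolding bilinear_def by auto
  let ?R = "{u. \<forall>v. B u v = 0}"
  show ?case
  proof (cases "\<forall>u v. B u v = 0")
    case True
    then show ?thesis by (intro exI[of _ 0]) (simp add: dim_subset_UNIV)
  next
    case False
    then obtain e f0 where "B e f0 \<noteq> 0" by blast
    define f where "f = (1 / B e f0) *\<^sub>R f0"
    have ef: "B e f = 1" using \<open>B e f0 \<noteq> 0\<close> by (simp add: f_def linear_cmul[OF lin(1)])
    \<comment> \<open>Subtracts the part of B carried by the plane of e and f, so that both vectors
      fall into the radical of B'.\<close>
    define B' where "B' u v = B u v - (B u f * B e v - B v f * B e u)" for u v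
    have bil': "bilinear B'"
      unfolding bilinear_def
      by (intro conjI allI linearI)
         (simp_all add: B'_def linear_add[OF lin(1)] linear_add[OF lin(2)] linear_cmul[OF lin(1)] linear_cmul[OF lin(2)] algebra_simps)
    have alt': "B' v v = 0" for v by (simp add: B'_def alt)
    let ?R' = "{u. \<forall>v. B' u v = 0}"
    have "?R \<subseteq> ?R'"
    proof clarify
      fix u v assume u: "\<forall>v. B u v = 0"
      then have "B e u = 0" using anti[of e u] by simp
      then show "B' u v = 0" using u by (simp add: B'_def)
    qed
    moreover have "e \<in> ?R'" by (simp add: B'_def ef alt)
    moreover have "f \<in> ?R'" using anti[of f] by (simp add: B'_def ef alt)
    ultimately have sub: "insert f (insert e ?R) \<subseteq> ?R'" by blast
    \<comment> \<open>The normalisation B e f = 1 yields independence: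
      \<open>\<lambda>u. B u f\<close> vanishes on the old radical, and B e vanishes on the old
      radical together with e.\<close>
    have "e \<notin> span ?R"
    proof
      assume "e \<in> span ?R"
      have "B e f = 0" by (rule linear_eq_0_on_span[OF lin(2) _ \<open>e \<in> span ?R\<close>]) simp
      then show False using ef by simp
    qed
    moreover have "f \<notin> span (insert e ?R)"
    proof
      assume "f \<in> span (insert e ?R)"
      have "B e f = 0"
        by (rule linear_eq_0_on_span[OF lin(1) _ \<open>f \<in> span (insert e ?R)\<close>]) (use alt anti[of e] in auto)
      then show False using ef by simp
    qed
    ultimately have "dim (insert f (insert e ?R)) = dim ?R + 2" by (simp add: dim_insert)
    then have d: "dim ?R + 2 \<le> dim ?R'" using dim_subset[OF sub] by simp
    moreover have dR': "dim ?R' \<le> DIM('a)" by (rule dim_subset_UNIV)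
    ultimately have "DIM('a) - dim ?R' < DIM('a) - dim ?R" by linarith
    from less.hyps[OF this bil' alt'] obtain k :: nat and a b where IH:
      "2 * k + dim ?R' \<le> DIM('a)" "\<forall>i<k. linear (a i) \<and> linear (b i)"
      "\<forall>u v. B' u v = (\<Sum>i<k. a i u * b i v - a i v * b i u)" by blast
    let ?a = "\<lambda>i. if i < k then a i else (\<lambda>u. B u f)" and ?b = "\<lambda>i. if i < k then b i else B e"
    have 1: "B u v = (\<Sum>i<Suc k. ?a i u * ?b i v - ?a i v * ?b i u)" for u v
    proof -
      have "(\<Sum>i<k. ?a i u * ?b i v - ?a i v * ?b i u) = B' u v"
        unfolding IH(3)[rule_format] by (rule sum.cong) auto
      then show ?thesis by (simp add: B'_def)
    qed
    have 2: "2 * Suc k + dim ?R \<le> DIM('a)"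
    proof -
      have "2 * Suc k + dim ?R = 2 * k + (dim ?R + 2)" by simp
      also have "\<dots> \<le> 2 * k + dim ?R'" by (rule add_left_mono[OF d])
      also have "\<dots> \<le> DIM('a)" by (rule IH(1))
      finally show ?thesis .
    qed
    have 3: "\<forall>i<Suc k. linear (?a i) \<and> linear (?b i)" using IH(2) lin by auto
    show ?thesis
      by (rule exI[of _ "Suc k"], rule exI[of _ ?a], rule exI[of _ ?b]) (intro conjI allI 1 2 3)
  qed
qed

text \<open>At most n hyperbolic pairs occur, as the real dimension is 2n. Spare indices receive
  zero forms, and halving the first members of the pairs compensates for the factor 2 in
  \<open>induced_form2\<close>.\<close>

lemma darboux_basis:
  fixes B :: "complex ^ 'n \<Rightarrow> complex ^ 'n \<Rightarrow> real"
  assumes "bilinear B" "\<And>v. B v v = 0"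
  obtains \<beta> :: "'n + 'n \<Rightarrow> complex ^ 'n \<Rightarrow> real" where "\<And>k. linear (\<beta> k)"
    "\<And>u v. B u v = 2 * (\<Sum>i\<in>UNIV. \<beta> (Inl i) u * \<beta> (Inr i) v - \<beta> (Inl i) v * \<beta> (Inr i) u)"
proof -
  obtain k :: nat and a b where k: "2 * k + dim {u. \<forall>v. B u v = 0} \<le> DIM(complex ^ 'n)"
    and lin: "\<forall>i<k. linear (a i) \<and> linear (b i)"
    and B: "\<forall>u v. B u v = (\<Sum>i<k. a i u * b i v - a i v * b i u)"
    using alternating_form_decomposition[OF assms] by blast
  have kn: "k \<le> CARD('n)" using k by simp
  obtain h where h: "bij_betw h (UNIV :: 'n set) {0..<CARD('n)}"
    using ex_bij_betw_finite_nat[OF finite_class.finite_UNIV] by blast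
  define \<beta> where "\<beta> l = (case l of Inl i \<Rightarrow> if h i < k then (\<lambda>u. a (h i) u / 2) else (\<lambda>u. 0)
      | Inr i \<Rightarrow> if h i < k then b (h i) else (\<lambda>u. 0))" for l
  have z: "linear (\<lambda>u::complex ^ 'n. 0::real)" by (rule linearI) auto
  have half: "linear (\<lambda>u::complex ^ 'n. L u / 2 :: real)" if "linear L" for L
    by (rule linearI) (simp_all add: linear_add[OF that] linear_cmul[OF that] add_divide_distrib)
  have "linear (\<beta> l)" for l
    using lin half z by (auto simp: \<beta>_def split: sum.split)
  moreover have "B u v = 2 * (\<Sum>i\<in>UNIV. \<beta> (Inl i) u * \<beta> (Inr i) v - \<beta> (Inl i) v * \<beta> (Inr i) u)" for u v
  proof -
    let ?g = "\<lambda>j. if j < k then a j u * b j v - a j v * b j u else 0"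
    have "2 * (\<Sum>i\<in>UNIV. \<beta> (Inl i) u * \<beta> (Inr i) v - \<beta> (Inl i) v * \<beta> (Inr i) u) = (\<Sum>i\<in>UNIV. ?g (h i))"
      unfolding sum_distrib_left by (rule sum.cong) (auto simp: \<beta>_def algebra_simps)
    also have "\<dots> = (\<Sum>j\<in>{0..<CARD('n)}. ?g j)" by (rule sum.reindex_bij_betw[OF h])
    also have "\<dots> = (\<Sum>j<k. ?g j)" by (rule sum.mono_neutral_right) (use kn in auto)
    also have "\<dots> = B u v" unfolding B[rule_format] by (rule sum.cong) auto
    finally show ?thesis by simp
  qed
  ultimately show ?thesis by (rule that)
qed

section \<open>Parallel two-forms\<close>

context flat_special
begin

lemma torsion_free_bracket:
  assumes "open U" "vector_field_on A U X" "vector_field_on A U Y" "p \<in> U"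
  shows "lie_bracket A X Y p = cov_deriv D X Y p - cov_deriv D Y X p"
proof -
  have "torsion_free A D" using special unfolding special_complex_manifold_def by blast
  from this[unfolded torsion_free_def, THEN spec, THEN spec, THEN spec, THEN mp, THEN mp, THEN mp,
      THEN bspec, OF assms] show ?thesis by simp
qed

lemma parallel_form2D:
  assumes "parallel_form2 A D \<omega>" "open U" "vector_field_on A U X" "vector_field_on A U Y" "vector_field_on A U Z" "p \<in> U"
  shows "deriv_along A X (\<lambda>q. \<omega> q (Y q) (Z q)) p = \<omega> p (cov_deriv D X Y p) (Z p) + \<omega> p (Y p) (cov_deriv D X Z p)"
  using assms(1)[unfolded parallel_form2_def, THEN spec, THEN spec, THEN spec, THEN spec, THEN mp, THEN mp, THEN mp,
      THEN mp, THEN bspec, OF assms(2-6)]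
  unfolding cov_deriv_form2_def by simp

text \<open>Torsion-freeness writes the brackets as differences of covariant derivatives,
  parallelism does the same for the derivatives of \<omega>, and all terms cancel by
  antisymmetry.\<close>

lemma parallel_imp_closed:
  assumes par: "parallel_form2 A D \<omega>" and bil: "\<And>p. bilinear (\<omega> p)" and alt: "\<And>p v. \<omega> p v v = 0"
  shows "closed_form2 A \<omega>"
  unfolding closed_form2_def
proof (intro allI impI ballI)
  fix U X Y Z p
  assume U: "open U" and X: "vector_field_on A U X" and Y: "vector_field_on A U Y" and Z: "vector_field_on A U Z" and p: "p \<in> U"
  note anti = alternating_antisym[OF bil alt]
  note sub = bilinear_lsub[OF bil]
  show "deriv_along A X (\<lambda>q. \<omega> q (Y q) (Z q)) p
                - deriv_along A Y (\<lambda>q. \<omega> q (X q) (Z q)) p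
                + deriv_along A Z (\<lambda>q. \<omega> q (X q) (Y q)) p
                - \<omega> p (lie_bracket A X Y p) (Z p)
                + \<omega> p (lie_bracket A X Z p) (Y p)
                - \<omega> p (lie_bracket A Y Z p) (X p) = 0"
    unfolding parallel_form2D[OF par U X Y Z p] parallel_form2D[OF par U Y X Z p] parallel_form2D[OF par U Z X Y p]
      torsion_free_bracket[OF U X Y p] torsion_free_bracket[OF U X Z p] torsion_free_bracket[OF U Y Z p] sub
    using anti[of p "Y p" "cov_deriv D X Z p"] anti[of p "X p" "cov_deriv D Y Z p"] anti[of p "X p" "cov_deriv D Z Y p"]
    by simp
qed

lemma cov_deriv_constant_fields:
  assumes "c \<in> A" "p \<in> fst c"
  shows "cov_deriv D (field_in A c (\<lambda>_. z)) (field_in A c (\<lambda>_. v)) p = field_in A c (\<lambda>_. \<Gamma> c (snd c p) z v) p"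
proof (rule differential_inj[OF assms])
  show "differential A (snd c) p (cov_deriv D (field_in A c (\<lambda>_. z)) (field_in A c (\<lambda>_. v)) p) =
    differential A (snd c) p (field_in A c (\<lambda>_. \<Gamma> c (snd c p) z v) p)"
    unfolding differential_field_in[OF assms] christoffel_def rep_chart[OF assms] ..
qed

text \<open>The components of a parallel form obey a linear first-order system with Christoffel
  coefficients, which is what \<open>linear_differential_inequality_zero\<close> takes as
  input.\<close>

lemma parallel_form_coordinates:
  assumes \<omega>: "smooth_form2 A \<omega>" "parallel_form2 A D \<omega>" and c: "c \<in> A" "p \<in> fst c"
  shows "(((\<lambda>q. \<omega> q (field_in A c (\<lambda>_. v) q) (field_in A c (\<lambda>_. w) q)) \<circ> inv_chart c) has_derivative
    (\<lambda>z. (\<Sum>a\<in>Basis. (\<Gamma> c (snd c p) z v \<bullet> a) * \<omega> p (field_in A c (\<lambda>_. a) p) (field_in A c (\<lambda>_. w) p)) +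
      (\<Sum>a\<in>Basis. (\<Gamma> c (snd c p) z w \<bullet> a) * \<omega> p (field_in A c (\<lambda>_. v) p) (field_in A c (\<lambda>_. a) p)))) (at (snd c p))"
proof -
  let ?E = "\<lambda>v. field_in A c (\<lambda>_. v)" and ?x = "snd c p"
  let ?g = "(\<lambda>q. \<omega> q (?E v q) (?E w q)) \<circ> inv_chart c"
  note U = chart_homeo(1)[OF c(1)] and E = constant_field[OF c(1)]
  have "smooth_map_on A (fst c) (\<lambda>q. \<omega> q (?E v q) (?E w q))"
    using \<omega>(1)[unfolded smooth_form2_def, THEN conjunct2, THEN spec, THEN spec, THEN spec, THEN mp, THEN mp, THEN mp, OF U E E] .
  then have "C_k_on (Suc 0) (snd c ` (fst c \<inter> fst c)) ?g"
    using c(1) unfolding smooth_map_on_def smooth_on_def by blast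
  then have D: "(?g has_derivative frechet_derivative ?g (at ?x)) (at ?x)"
    by (rule C_k_on_Suc_has_derivative) (use c(2) in simp)
  have bil: "bilinear (\<omega> p)" using \<omega>(1) unfolding smooth_form2_def by blast
  have Elin: "linear (\<lambda>v. ?E v p)"
    unfolding field_in_def by (rule linear_transition_deriv[OF c(1) chart_at(1) c(2) chart_at(2)])
  have l1: "linear (\<lambda>v. \<omega> p (?E v p) u)" and l2: "linear (\<lambda>v. \<omega> p u (?E v p))" for u
    using linear_compose[OF Elin, of "\<lambda>v. \<omega> p v u"] linear_compose[OF Elin, of "\<omega> p u"] bil
    unfolding bilinear_def by (simp_all add: comp_def)
  have "frechet_derivative ?g (at ?x) z =
      (\<Sum>a\<in>Basis. (\<Gamma> c ?x z v \<bullet> a) * \<omega> p (?E a p) (?E w p)) + (\<Sum>a\<in>Basis. (\<Gamma> c ?x z w \<bullet> a) * \<omega> p (?E v p) (?E a p))" for z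
  proof -
    have "frechet_derivative ?g (at ?x) z = deriv_along A (?E z) (\<lambda>q. \<omega> q (?E v q) (?E w q)) p"
      using deriv_along_eq[OF c D, of "?E z"] by (simp add: rep_chart[OF c] differential_field_in[OF c])
    also have "\<dots> = \<omega> p (?E (\<Gamma> c ?x z v) p) (?E w p) + \<omega> p (?E v p) (?E (\<Gamma> c ?x z w) p)"
      unfolding parallel_form2D[OF \<omega>(2) U E E E c(2)] cov_deriv_constant_fields[OF c] ..
    also have "\<omega> p (?E (\<Gamma> c ?x z v) p) (?E w p) = (\<Sum>a\<in>Basis. (\<Gamma> c ?x z v \<bullet> a) * \<omega> p (?E a p) (?E w p))"
      by (rule linear_sum_Basis[OF l1, unfolded real_scaleR_def])
    also have "\<omega> p (?E v p) (?E (\<Gamma> c ?x z w) p) = (\<Sum>a\<in>Basis. (\<Gamma> c ?x z w \<bullet> a) * \<omega> p (?E v p) (?E a p))"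
      by (rule linear_sum_Basis[OF l2, unfolded real_scaleR_def])
    finally show ?thesis .
  qed
  from D[unfolded ext[OF this]] show ?thesis .
qed

text \<open>Read off from the bound for \<open>affine_system\<close>: for the covector a, its first
  component has b-coordinate a \<bullet> \<Gamma>(z, b).\<close>

lemma christoffel_bound:
  assumes c: "c \<in> A" and X: "compact X" "X \<subseteq> snd c ` fst c"
  obtains K where "K \<ge> 0" "\<And>x z a b. x \<in> X \<Longrightarrow> a \<in> Basis \<Longrightarrow> b \<in> Basis \<Longrightarrow> \<bar>\<Gamma> c x z b \<bullet> a\<bar> \<le> K * norm z"
proof -
  obtain K where K: "K \<ge> 0" "\<And>x v e. x \<in> X \<Longrightarrow> norm (affine_system c x v e) \<le> K * norm v * norm e"
    using total_system.A_bound[OF total_system_affine[OF c] X] by blast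
  have "\<bar>\<Gamma> c x z b \<bullet> a\<bar> \<le> K * norm z" if x: "x \<in> X" and a: "a \<in> Basis" and b: "b \<in> Basis" for x z a b
  proof -
    have xc: "x \<in> snd c ` fst c" using X(2) x by blast
    have "\<bar>\<Gamma> c x z b \<bullet> a\<bar> = \<bar>fst (affine_system c x z (a, 0)) \<bullet> b\<bar>"
      by (simp only: affine_system_def fst_conv inner_dual_christoffel[OF c xc] inner_commute[of "\<Gamma> c x z b" a])
    also have "\<dots> \<le> norm (fst (affine_system c x z (a, 0)))" by (rule Basis_le_norm[OF b])
    also have "\<dots> \<le> norm (affine_system c x z (a, 0))"
      using norm_fst_le[of "fst (affine_system c x z (a, 0))" "snd (affine_system c x z (a, 0))"] by simp
    also have "\<dots> \<le> K * norm z * norm (a, 0 :: complex)" by (rule K(2)[OF x])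
    also have "\<dots> = K * norm z" using a by (simp add: norm_Pair)
    finally show ?thesis .
  qed
  then show ?thesis using that[OF K(1)] by blast
qed

text \<open>The differences of the components satisfy the same linear system, so vanishing spreads
  from a point over its coordinate ball and then over M.\<close>

lemma parallel_form_unique:
  assumes con: "connected (UNIV :: 'm set)"
    and \<omega>1: "smooth_form2 A \<omega>1" "parallel_form2 A D \<omega>1" and \<omega>2: "smooth_form2 A \<omega>2" "parallel_form2 A D \<omega>2"
    and eq: "\<And>u v. \<omega>1 p0 u v = \<omega>2 p0 u v"
  shows "\<omega>1 = \<omega>2"
proof -
  have bil: "bilinear (\<omega>1 p)" "bilinear (\<omega>2 p)" for p using \<omega>1(1) \<omega>2(1) unfolding smooth_form2_def by auto
  have "\<forall>u v. \<omega>1 p u v = \<omega>2 p u v" for p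
  proof (rule connected_UNIV_induction[OF con, where P="\<lambda>p. \<forall>u v. \<omega>1 p u v = \<omega>2 p u v" and p=p0])
    fix q
    obtain x0 r W where W: "affine_nbhd (chart_at A q) x0 r W" "q \<in> W" using affine_nbhd_exists by blast
    define c where "c = chart_at A q"
    note Wd = affine_nbhdD[OF W(1), folded c_def]
    let ?E = "\<lambda>v. field_in A c (\<lambda>_. v)"
    \<comment> \<open>The index i is a pair of basis vectors; g collects all component differences
      into the finite family required by the uniqueness lemma.\<close>
    define g where "g i x = \<omega>1 (inv_chart c x) (?E (fst i) (inv_chart c x)) (?E (snd i) (inv_chart c x)) -
      \<omega>2 (inv_chart c x) (?E (fst i) (inv_chart c x)) (?E (snd i) (inv_chart c x))" for i x
    define g' where "g' i x z = (\<Sum>a\<in>Basis. (\<Gamma> c x z (fst i) \<bullet> a) * g (a, snd i) x) +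
      (\<Sum>a\<in>Basis. (\<Gamma> c x z (snd i) \<bullet> a) * g (fst i, a) x)" for i x z
    let ?I = "Basis \<times> Basis :: ((complex ^ 'n) \<times> (complex ^ 'n)) set"
    have zero: "\<forall>i\<in>?I. g i y = 0" if x: "x \<in> ball x0 r" "\<forall>i\<in>?I. g i x = 0" and y: "y \<in> ball x0 r" for x y
    proof (rule linear_differential_inequality_zero[where f=g and f'=g', OF connected_ball open_ball _ _ _ x y])
      show "finite ?I" by simp
      fix i x assume "x \<in> ball x0 r"
      then have "x \<in> snd c ` (fst c \<inter> UNIV)" using Wd(7) by auto
      note ci = chart_inv[OF Wd(1) this]
      show "(g i has_derivative g' i x) (at x)"
        using has_derivative_diff[OF parallel_form_coordinates[OF \<omega>1 Wd(1) ci(2), of "fst i" "snd i"]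
            parallel_form_coordinates[OF \<omega>2 Wd(1) ci(2), of "fst i" "snd i"]]
        unfolding ci(1) by (simp add: g_def[abs_def] g'_def[abs_def] comp_def sum_subtractf right_diff_distrib algebra_simps)
    next
      fix X :: "(complex ^ 'n) set" assume X: "compact X" "X \<subseteq> ball x0 r"
      have "X \<subseteq> snd c ` fst c" using X(2) Wd(7) by blast
      from christoffel_bound[OF Wd(1) X(1) this] obtain K where K: "K \<ge> 0"
        "\<And>x z a b. x \<in> X \<Longrightarrow> a \<in> Basis \<Longrightarrow> b \<in> Basis \<Longrightarrow> \<bar>\<Gamma> c x z b \<bullet> a\<bar> \<le> K * norm z" by blast
      \<comment> \<open>Each of the two sums in g' varies one slot of i and is bounded by K times
        the sum over all pairs.\<close>
      have "norm (g' i x h) \<le> (2 * K) * (\<Sum>j\<in>?I. norm (g j x)) * norm h" if x: "x \<in> X" and i: "i \<in> ?I" for x i h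
      proof -
        have bb: "fst i \<in> Basis" "snd i \<in> Basis" using i by auto
        let ?N = "\<Sum>j\<in>?I. norm (g j x)"
        have 1: "(\<Sum>a\<in>Basis. \<bar>g (a, snd i) x\<bar>) \<le> ?N"
        proof -
          have "(\<Sum>a\<in>Basis. \<bar>g (a, snd i) x\<bar>) = (\<Sum>j\<in>(\<lambda>a. (a, snd i)) ` Basis. norm (g j x))"
            by (subst sum.reindex) (auto simp: inj_on_def)
          also have "\<dots> \<le> ?N" by (rule sum_mono2) (use bb in auto)
          finally show ?thesis .
        qed
        have 2: "(\<Sum>a\<in>Basis. \<bar>g (fst i, a) x\<bar>) \<le> ?N"
        proof -
          have "(\<Sum>a\<in>Basis. \<bar>g (fst i, a) x\<bar>) = (\<Sum>j\<in>(\<lambda>a. (fst i, a)) ` Basis. norm (g j x))"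
            by (subst sum.reindex) (auto simp: inj_on_def)
          also have "\<dots> \<le> ?N" by (rule sum_mono2) (use bb in auto)
          finally show ?thesis .
        qed
        have b1: "\<bar>\<Sum>a\<in>Basis. (\<Gamma> c x h b \<bullet> a) * k a\<bar> \<le> K * norm h * (\<Sum>a\<in>Basis. \<bar>k a\<bar>)"
          if b: "b \<in> Basis" for b and k :: "complex ^ 'n \<Rightarrow> real"
          unfolding sum_distrib_left
          by (rule order_trans[OF sum_abs sum_mono]) (auto simp: abs_mult intro!: mult_right_mono K(2)[OF x _ b])
        have "norm (g' i x h) \<le> K * norm h * (\<Sum>a\<in>Basis. \<bar>g (a, snd i) x\<bar>) + K * norm h * (\<Sum>a\<in>Basis. \<bar>g (fst i, a) x\<bar>)"
          unfolding g'_def real_norm_def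
          by (rule order_trans[OF abs_triangle_ineq add_mono[OF b1[OF bb(1)] b1[OF bb(2)]]])
        also have "\<dots> \<le> K * norm h * ?N + K * norm h * ?N"
          using 1 2 K(1) by (intro add_mono mult_left_mono) auto
        finally show ?thesis by (simp add: algebra_simps)
      qed
      then show "\<exists>C. \<forall>x\<in>X. \<forall>i\<in>?I. \<forall>h. norm (g' i x h) \<le> C * (\<Sum>j\<in>?I. norm (g j x)) * norm h" by blast
    qed
    have equiv: "(\<forall>u v. \<omega>1 p u v = \<omega>2 p u v) \<longleftrightarrow> (\<forall>i\<in>?I. g i (snd c p) = 0)" if p: "p \<in> W" for p
    proof
      assume "\<forall>u v. \<omega>1 p u v = \<omega>2 p u v"
      then show "\<forall>i\<in>?I. g i (snd c p) = 0" using p Wd(1,3) by (auto simp: g_def)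
    next
      assume z: "\<forall>i\<in>?I. g i (snd c p) = 0"
      have pc: "p \<in> fst c" using p Wd(3) by auto
      have Elin: "linear (\<lambda>v. ?E v p)"
        unfolding field_in_def by (rule linear_transition_deriv[OF Wd(1) chart_at(1) pc chart_at(2)])
      have bE: "bilinear (\<lambda>v w. \<omega> p (?E v p) (?E w p))" if "bilinear (\<omega> p)" for \<omega> :: "('m, 'n) form2"
        using that unfolding bilinear_def
        by (auto intro: linear_compose[OF Elin, unfolded comp_def])
      have "(\<lambda>v w. \<omega>1 p (?E v p) (?E w p)) = (\<lambda>v w. \<omega>2 p (?E v p) (?E w p))"
        by (rule bilinear_eq_stdbasis[OF bE[OF bil(1)] bE[OF bil(2)]]) (use z Wd(1) pc in \<open>auto simp: g_def\<close>)
      then have "\<omega>1 p (?E v p) (?E w p) = \<omega>2 p (?E v p) (?E w p)" for v w by meson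
      then have "\<omega>1 p (?E (differential A (snd c) p u) p) (?E (differential A (snd c) p v) p) =
          \<omega>2 p (?E (differential A (snd c) p u) p) (?E (differential A (snd c) p v) p)" for u v by blast
      then show "\<forall>u v. \<omega>1 p u v = \<omega>2 p u v"
        by (simp add: field_in_def field_in_differential[OF Wd(1) pc])
    qed
    have step: "\<forall>u v. \<omega>1 y u v = \<omega>2 y u v" if "x \<in> W" "y \<in> W" "\<forall>u v. \<omega>1 x u v = \<omega>2 x u v" for x y
    proof -
      have "snd c x \<in> ball x0 r" "snd c y \<in> ball x0 r" using that(1,2) Wd(4) by blast+
      then show ?thesis using zero[of "snd c x" "snd c y"] equiv[OF that(1)] equiv[OF that(2)] that(3) by blast
    qed
    show "\<exists>W. open W \<and> q \<in> W \<and> (\<forall>x\<in>W. \<forall>y\<in>W. (\<forall>u v. \<omega>1 x u v = \<omega>2 x u v) \<longrightarrow> (\<forall>u v. \<omega>1 y u v = \<omega>2 y u v))"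
      by (intro exI[of _ W] conjI ballI impI affine_nbhdD(2)[OF W(1)] W(2)) (rule step)
  qed (use eq in blast)
  then show ?thesis by (intro ext) blast
qed

end

section \<open>Real and imaginary parts in \<open>T\<^sup>*\<complex>\<^sup>n\<close>\<close>

text \<open>Needed between different types of equal dimension: tangent vectors in
  \<open>complex ^ 'n\<close>, real coordinates in \<open>real ^ ('n + 'n)\<close>.\<close>

lemma linear_inj_imp_surj_DIM:
  fixes f :: "'a::euclidean_space \<Rightarrow> 'b::euclidean_space"
  assumes "linear f" "inj f" "DIM('a) = DIM('b)"
  shows "surj f"
proof -
  have "dim (range f) = dim (UNIV :: 'a set)"
    by (rule dim_image_eq[OF assms(1)]) (use assms(2) in \<open>auto intro: inj_on_subset\<close>)
  then have "span (range f) = UNIV" using dim_eq_full[of "range f"] assms(3) by simp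
  moreover have "subspace (range f)" by (rule linear_subspace_image[OF assms(1) subspace_UNIV])
  ultimately show ?thesis by (metis span_eq_iff)
qed

lemma linear_surj_imp_inj_DIM:
  fixes f :: "'a::euclidean_space \<Rightarrow> 'b::euclidean_space"
  assumes "linear f" "surj f" "DIM('a) = DIM('b)"
  shows "inj f"
proof -
  obtain g where g: "linear g" "f \<circ> g = id" using linear_surjective_right_inverse[OF assms(1,2)] by blast
  have fg: "f (g x) = x" for x using g(2) by (metis comp_apply id_apply)
  then have "inj g" by (metis injI)
  then have "surj g" by (rule linear_inj_imp_surj_DIM[OF g(1) _ assms(3)[symmetric]])
  then show ?thesis using fg by (metis injI surjD)
qed

lemma linear_inj_isomorphism_DIM:
  fixes f :: "'a::euclidean_space \<Rightarrow> 'b::euclidean_space"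
  assumes "linear f" "inj f" "DIM('a) = DIM('b)"
  obtains g where "linear g" "\<And>x. g (f x) = x" "\<And>y. f (g y) = y"
proof -
  obtain g where g: "linear g" "g \<circ> f = id" using linear_injective_left_inverse[OF assms(1,2)] by blast
  have gf: "g (f x) = x" for x using g(2) by (metis comp_apply id_apply)
  have "f (g y) = y" for y
  proof -
    obtain x where "y = f x" using linear_inj_imp_surj_DIM[OF assms] by (rule surjE)
    then show ?thesis using gf by simp
  qed
  then show ?thesis using that[OF g(1) gf] by blast
qed

lemma DIM_complex_real_sum: "DIM(complex ^ 'n::finite) = DIM(real ^ ('n + 'n))"
  by simp

definition complex_of_reals :: "real ^ 'k \<Rightarrow> real ^ 'k \<Rightarrow> complex ^ 'k" where
  "complex_of_reals s t = (\<chi> k. Complex (s $ k) (t $ k))"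

text \<open>The form dx^i \<and> dy_i, summed over i, on the real points of V.\<close>

definition real_\<Omega> :: "real ^ ('n::finite + 'n) \<Rightarrow> real ^ ('n + 'n) \<Rightarrow> real" where
  "real_\<Omega> s t = (\<Sum>i\<in>UNIV. s $ Inl i * t $ Inr i - t $ Inl i * s $ Inr i)"

lemma real_\<Omega>_minus: "real_\<Omega> (- s) t = - real_\<Omega> s t" "real_\<Omega> s (- t) = - real_\<Omega> s t"
  by (simp_all add: real_\<Omega>_def sum_negf[symmetric])

lemma \<Omega>_complex_of_reals:
  "\<Omega> (complex_of_reals s t) (complex_of_reals s' t') =
     Complex (real_\<Omega> s s' - real_\<Omega> t t') (real_\<Omega> s t' + real_\<Omega> t s')"
  by (simp add: \<Omega>_def real_\<Omega>_def complex_of_reals_def complex_eq_iff Re_sum Im_sum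
      sum_subtractf[symmetric] sum.distrib[symmetric] algebra_simps)

lemma \<tau>_complex_of_reals: "\<tau> (complex_of_reals s t) = complex_of_reals s (- t)"
  by (simp add: \<tau>_def complex_of_reals_def vec_eq_iff complex_eq_iff)

lemma complex_of_reals_Re_Im: "u = complex_of_reals (\<chi> k. Re (u $ k)) (\<chi> k. Im (u $ k))"
  by (simp add: complex_of_reals_def vec_eq_iff)

lemma real_\<Omega>_nondegenerate:
  assumes "\<And>t. real_\<Omega> s t = 0"
  shows "s = 0"
proof -
  have "s $ Inl i = 0" for i
  proof -
    have "real_\<Omega> s (axis (Inr i) 1) = s $ Inl i"
      by (simp add: real_\<Omega>_def axis_def if_distrib[of "\<lambda>x. s $ Inl _ * x"] cong: if_cong)
    then show ?thesis using assms by simp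
  qed
  moreover have "s $ Inr i = 0" for i
  proof -
    have "real_\<Omega> s (axis (Inl i) 1) = - s $ Inr i"
      by (simp add: real_\<Omega>_def axis_def if_distrib[of "\<lambda>x. x * s $ Inr _"] sum_negf cong: if_cong)
    then show ?thesis using assms by simp
  qed
  ultimately show ?thesis by (simp add: vec_eq_iff) (metis sum.exhaust)
qed

text \<open>Complexification; real matrices give the complex linear maps of V that commute with
  \<open>\<tau>\<close>.\<close>

definition complex_matrix :: "real ^ 'k ^ 'k \<Rightarrow> complex ^ 'k ^ 'k" where
  "complex_matrix M = (\<chi> i j. of_real (M $ i $ j))"

lemma complex_matrix_mult: "complex_matrix (M ** N) = complex_matrix M ** complex_matrix N"
  by (simp add: complex_matrix_def matrix_matrix_mult_def vec_eq_iff)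

lemma complex_matrix_one: "complex_matrix (mat 1) = mat 1"
  by (simp add: complex_matrix_def mat_def vec_eq_iff)

lemma complex_matrix_vector: "complex_matrix M *v complex_of_reals s t = complex_of_reals (M *v s) (M *v t)"
  by (simp add: complex_matrix_def matrix_vector_mult_def complex_of_reals_def vec_eq_iff complex_eq_iff Re_sum Im_sum)

lemma frechet_derivative_affine:
  fixes C :: "complex ^ 'k ^ 'k::finite"
  shows "frechet_derivative (\<lambda>v. C *v v + b) (at p) u = C *v u"
proof -
  have "linear (\<lambda>v. C *v v)"
    by (rule linearI) (simp_all add: matrix_vector_mult_def vec_eq_iff scaleR_sum_right distrib_left sum.distrib)
  then have "bounded_linear (\<lambda>v. C *v v)" by (simp add: linear_conv_bounded_linear)
  then have "((\<lambda>v. C *v v + b) has_derivative (\<lambda>v. C *v v)) (at p)"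
    using has_derivative_add[OF bounded_linear_imp_has_derivative has_derivative_const[of b]] by fastforce
  from frechet_derivative_at[OF this] show ?thesis by (metis (full_types))
qed

text \<open>The differential is the constant complexified matrix. It commutes with conjugation
  because its entries are real, and it preserves \<Omega> if it preserves the real form, since
  \<Omega> is the complex bilinear extension.\<close>

lemma affine_complex_matrix:
  assumes M: "invertible (M :: real ^ ('n + 'n) ^ ('n::finite + 'n))"
  shows "affine_transformation (\<lambda>v. complex_matrix M *v v + b)"
    and "preserves_real_structure (\<lambda>v. complex_matrix M *v v + b)"
    and "(\<And>s t. real_\<Omega> (M *v s) (M *v t) = real_\<Omega> s t) \<Longrightarrow>
      preserves_symplectic_form (\<lambda>v. complex_matrix M *v v + b)"
proof -
  obtain N where "M ** N = mat 1" "N ** M = mat 1" using M unfolding invertible_def by blast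
  then have "complex_matrix M ** complex_matrix N = mat 1" "complex_matrix N ** complex_matrix M = mat 1"
    by (simp_all add: complex_matrix_mult[symmetric] complex_matrix_one)
  then have "invertible (complex_matrix M)" unfolding invertible_def by blast
  then show "affine_transformation (\<lambda>v. complex_matrix M *v v + b)"
    unfolding affine_transformation_def by blast
  have minus: "M *v (- s) = - (M *v s)" for s by (simp add: matrix_vector_mult_def vec_eq_iff sum_negf)
  have "complex_matrix M *v \<tau> u = \<tau> (complex_matrix M *v u)" for u
    by (subst (1 2) complex_of_reals_Re_Im[of u])
       (simp add: \<tau>_complex_of_reals complex_matrix_vector minus)
  then show "preserves_real_structure (\<lambda>v. complex_matrix M *v v + b)"
    unfolding preserves_real_structure_def frechet_derivative_affine by simp
  show "preserves_symplectic_form (\<lambda>v. complex_matrix M *v v + b)"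
    if "\<And>s t. real_\<Omega> (M *v s) (M *v t) = real_\<Omega> s t"
    unfolding preserves_symplectic_form_def frechet_derivative_affine
  proof (intro allI)
    fix u v :: "complex ^ ('n + 'n)"
    show "\<Omega> (complex_matrix M *v u) (complex_matrix M *v v) = \<Omega> u v"
      by (subst (1 2) complex_of_reals_Re_Im[of u], subst (1 2) complex_of_reals_Re_Im[of v])
         (simp only: complex_matrix_vector \<Omega>_complex_of_reals that)
  qed
qed

text \<open>The type \<open>option\<close> adds one index: it presents a component of \<psi> minus a
  combination of the components of \<phi> as a single sum.\<close>

lemma sum_UNIV_option: "(\<Sum>i\<in>UNIV. h i) = h None + (\<Sum>k\<in>UNIV. h (Some k))"
  for h :: "'k::finite option \<Rightarrow> 'b::comm_monoid_add"
  unfolding UNIV_option_conv by (simp add: sum.reindex)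

text \<open>The differential of all functions x^i \<circ> \<phi> and y_i \<circ> \<phi> together.
  For the maps in question its bijectivity says that these functions are local coordinates.\<close>

definition re_diff ::
    "('m, 'n::finite) chart set \<Rightarrow> ('m \<Rightarrow> 'n cotangent) \<Rightarrow> 'm \<Rightarrow> complex ^ 'n \<Rightarrow> real ^ ('n + 'n)" where
  "re_diff A \<phi> p v = (\<chi> k. Re (differential A \<phi> p v $ k))"

lemma induced_form2_re_diff: "induced_form2 A \<phi> p u v = 2 * real_\<Omega> (re_diff A \<phi> p u) (re_diff A \<phi> p v)"
  by (simp add: induced_form2_def real_\<Omega>_def re_diff_def x_coord_def y_coord_def)

section \<open>Maps into V whose components are special functions\<close>

context flat_special
begin

definition special_map :: "('m \<Rightarrow> 'n cotangent) \<Rightarrow> bool" where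
  "special_map \<phi> \<longleftrightarrow> (\<forall>k. special_function UNIV (\<lambda>q. \<phi> q $ k))"

lemma affine_function_iff:
  "affine_function A D f \<longleftrightarrow> (\<forall>V X Y. open V \<longrightarrow> V \<subseteq> UNIV \<longrightarrow> vector_field_on A V X \<longrightarrow> vector_field_on A V Y \<longrightarrow>
        (\<forall>p\<in>V. cov_deriv_form1 A D (differential A f) X Y p = 0))"
  unfolding affine_function_def by simp

text \<open>D is already known to be a flat torsion-free connection, so
  \<open>induces_connection\<close> reduces to affineness of the real parts, component by
  component.\<close>

lemma special_map_iff: "special_map \<phi> \<longleftrightarrow> holomorphic_map A \<phi> \<and> induces_connection A \<phi> D"
proof -
  have k: "(\<forall>i. affine_function A D (x_coord i \<circ> \<phi>) \<and> affine_function A D (y_coord i \<circ> \<phi>)) \<longleftrightarrow>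
      (\<forall>k. affine_function A D (Re \<circ> (\<lambda>q. \<phi> q $ k)))"
  proof -
    have "x_coord i \<circ> \<phi> = Re \<circ> (\<lambda>q. \<phi> q $ Inl i)" "y_coord i \<circ> \<phi> = Re \<circ> (\<lambda>q. \<phi> q $ Inr i)" for i
      by (auto simp: x_coord_def y_coord_def)
    then show ?thesis by (metis sum.exhaust)
  qed
  have "flat A D" "torsion_free A D" using special unfolding special_complex_manifold_def by blast+
  moreover have "holomorphic_map A \<phi> \<longleftrightarrow> (\<forall>k. \<forall>c\<in>A. c_holomorphic_on (snd c ` (fst c \<inter> UNIV)) ((\<lambda>q. \<phi> q $ k) \<circ> inv_chart c))"
    unfolding holomorphic_map_def cvec_holomorphic_on_componentwise comp_def by auto
  ultimately show ?thesis
    unfolding special_map_def induces_connection_def k special_function_def affine_function_iff[symmetric]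
    using connection by blast
qed

lemma special_map_has_derivative:
  assumes \<phi>: "special_map \<phi>" and c: "c \<in> A" "p \<in> fst c"
  shows "((\<phi> \<circ> inv_chart c) has_derivative
    (\<lambda>v. \<chi> k. frechet_derivative ((\<lambda>q. \<phi> q $ k) \<circ> inv_chart c) (at (snd c p)) v)) (at (snd c p))"
    (is "(_ has_derivative ?L) _")
proof (subst has_derivative_componentwise_within, rule ballI)
  fix b :: "complex ^ ('n + 'n)" assume "b \<in> Basis"
  then obtain j d where b: "b = axis j d" by (rule Basis_vecE)
  have "special_function UNIV (\<lambda>q. \<phi> q $ j)" using \<phi> unfolding special_map_def by blast
  from has_derivative_inner_left[OF special_function_differential(1)[OF c this UNIV_I], of d]
  show "((\<lambda>x. (\<phi> \<circ> inv_chart c) x \<bullet> b) has_derivative (\<lambda>x. ?L x \<bullet> b)) (at (snd c p))"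
    by (simp add: b inner_axis comp_def)
qed

lemma special_map_differential:
  assumes \<phi>: "special_map \<phi>"
  shows "differential A \<phi> p v $ k = differential A (\<lambda>q. \<phi> q $ k) p v"
    and "re_diff A \<phi> p v $ k = differential A (Re \<circ> (\<lambda>q. \<phi> q $ k)) p v"
    and "differential A \<phi> p v = complex_of_reals (re_diff A \<phi> p v) (- re_diff A \<phi> p (J v))"
    and "linear (differential A \<phi> p)" and "linear (re_diff A \<phi> p)"
proof -
  have f: "special_function UNIV (\<lambda>q. \<phi> q $ k)" for k using \<phi> unfolding special_map_def by blast
  show d: "differential A \<phi> p v $ k = differential A (\<lambda>q. \<phi> q $ k) p v" for v k
    using differential_eq(1)[OF chart_at special_map_has_derivative[OF \<phi> chart_at]]
      special_function_differential(3)[OF chart_at f UNIV_I] by simp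
  show "re_diff A \<phi> p v $ k = differential A (Re \<circ> (\<lambda>q. \<phi> q $ k)) p v"
    unfolding special_function_differential(4)[OF chart_at f UNIV_I] by (simp add: re_diff_def d)
  \<comment> \<open>Complex linearity again: the imaginary part of d\<phi>(v) is minus the real part
    of d\<phi>(J v).\<close>
  have "differential A \<phi> p (J v) $ k = \<i> * differential A \<phi> p v $ k" for k
    unfolding d J_def by (rule special_function_differential(5)[OF chart_at f UNIV_I])
  then show "differential A \<phi> p v = complex_of_reals (re_diff A \<phi> p v) (- re_diff A \<phi> p (J v))"
    by (simp add: complex_of_reals_def re_diff_def vec_eq_iff complex_eq_iff)
  show lin: "linear (differential A \<phi> p)"
    by (rule has_derivative_linear[OF differential_eq(2)[OF chart_at special_map_has_derivative[OF \<phi> chart_at]]])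
  show "linear (re_diff A \<phi> p)"
    by (rule linearI) (simp_all add: re_diff_def vec_eq_iff linear_add[OF lin] linear_cmul[OF lin])
qed

lemma J_eq_0: "J v = 0 \<longleftrightarrow> v = 0"
  by (metis J_J J_simps(3) neg_equal_0_iff_equal)

lemma complex_of_reals_eq_iff: "complex_of_reals s t = complex_of_reals s' t' \<longleftrightarrow> s = s' \<and> t = t'"
  by (auto simp: complex_of_reals_def vec_eq_iff)

text \<open>If d\<phi>(v) is real, its imaginary part - Re d\<phi>(J v) vanishes, so J v = 0 and v =
  0.\<close>

lemma special_map_inj_imp:
  assumes \<phi>: "special_map \<phi>" and inj: "\<And>p. inj (re_diff A \<phi> p)"
  shows "immersion A \<phi>" "totally_complex A \<phi>"
proof -
  note d = special_map_differential[OF \<phi>]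
  have z: "re_diff A \<phi> p v = 0 \<Longrightarrow> v = 0" for p v
    using linear_injective_0[OF d(5)[of p]] inj by blast
  have zero: "complex_of_reals 0 0 = (0 :: complex ^ ('n + 'n))"
    by (simp add: complex_of_reals_def vec_eq_iff complex_eq_iff)
  show "immersion A \<phi>"
    unfolding immersion_def
  proof
    fix p
    show "inj (differential A \<phi> p)"
    proof (subst linear_injective_0[OF d(4)], intro allI impI)
      fix v assume "differential A \<phi> p v = 0"
      then show "v = 0" using z unfolding d(3)[of p v] zero[symmetric] complex_of_reals_eq_iff by blast
    qed
  qed
  show "totally_complex A \<phi>"
    unfolding totally_complex_def
  proof (intro allI equalityI subsetI)
    fix p w assume "w \<in> {v. \<tau> v = v} \<inter> range (differential A \<phi> p)"
    then obtain v where v: "w = differential A \<phi> p v" "\<tau> w = w" by auto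
    then have "- (- re_diff A \<phi> p (J v)) = - re_diff A \<phi> p (J v)"
      unfolding v(1) d(3) \<tau>_complex_of_reals complex_of_reals_eq_iff by blast
    then have "re_diff A \<phi> p (J v) = 0" by (simp add: vec_eq_iff)
    then have "v = 0" using z J_eq_0 by blast
    then show "w \<in> {0}" using v(1) linear_0[OF d(4)] by simp
  next
    fix p and w :: "complex ^ ('n + 'n)" assume "w \<in> {0}"
    then have "w = differential A \<phi> p 0" "\<tau> w = w" using linear_0[OF d(4)] by (simp_all add: \<tau>_def vec_eq_iff)
    then show "w \<in> {v. \<tau> v = v} \<inter> range (differential A \<phi> p)" by blast
  qed
qed

text \<open>If Re d\<phi>(v) = 0, then d\<phi>(J v) has imaginary part 0; being real it vanishes by
  total complexity, and the immersion property gives J v = 0.\<close>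

lemma special_map_inj:
  assumes \<phi>: "special_map \<phi>" and imm: "immersion A \<phi>" and tc: "totally_complex A \<phi>"
  shows "inj (re_diff A \<phi> p)"
proof (subst linear_injective_0[OF special_map_differential(5)[OF \<phi>]], intro allI impI)
  note d = special_map_differential[OF \<phi>]
  fix v assume v: "re_diff A \<phi> p v = 0"
  have "J (J v) = - v" by simp
  then have "re_diff A \<phi> p (J (J v)) = 0" using v linear_neg[OF d(5)] by simp
  then have "\<tau> (differential A \<phi> p (J v)) = differential A \<phi> p (J v)"
    unfolding d(3) \<tau>_complex_of_reals by simp
  then have "differential A \<phi> p (J v) = 0" using tc unfolding totally_complex_def by blast
  then have "J v = 0" using imm linear_injective_0[OF d(4)] unfolding immersion_def by blast
  then show "v = 0" using J_eq_0 by blast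
qed

lemma special_complex_realisation_iff:
  "special_complex_realisation A D \<phi> \<longleftrightarrow> special_map \<phi> \<and> (\<forall>p. inj (re_diff A \<phi> p))"
  using special_map_iff special_map_inj special_map_inj_imp
  unfolding special_complex_realisation_def by blast

lemma special_map_combination:
  assumes \<phi>: "special_map \<phi>"
  shows "special_function UNIV (\<lambda>q. \<Sum>k\<in>UNIV. of_real (l $ k) * \<phi> q $ k)"
    and "differential A (Re \<circ> (\<lambda>q. \<Sum>k\<in>UNIV. of_real (l $ k) * \<phi> q $ k)) p v = l \<bullet> re_diff A \<phi> p v"
proof -
  have f: "special_function UNIV (\<lambda>q. \<phi> q $ k)" for k using \<phi> unfolding special_map_def by blast
  show s: "special_function UNIV (\<lambda>q. \<Sum>k\<in>UNIV. of_real (l $ k) * \<phi> q $ k)"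
    by (rule special_function_lincomb(1)) (use f in auto)
  show "differential A (Re \<circ> (\<lambda>q. \<Sum>k\<in>UNIV. of_real (l $ k) * \<phi> q $ k)) p v = l \<bullet> re_diff A \<phi> p v"
    unfolding special_function_differential(4)[OF chart_at s UNIV_I]
      special_function_lincomb(2)[OF finite_class.finite_UNIV f]
    by (simp add: inner_vec_def special_map_differential(1)[OF \<phi>] re_diff_def Re_sum)
qed

text \<open>If \<open>Re d\<phi>\<close> is an isomorphism at one point, then it is one everywhere: a real functional
  annihilating its range at some point gives a constant combination of the components.\<close>

lemma special_map_exists:
  assumes sc: "simply_connected (UNIV :: 'm set)" and \<beta>: "\<And>k. linear (\<beta> k)"
    and inj: "inj (\<lambda>v. (\<chi> k. \<beta> k v) :: real ^ ('n + 'n))"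
  obtains \<phi> where "special_complex_realisation A D \<phi>" "\<And>v. re_diff A \<phi> p0 v = (\<chi> k. \<beta> k v)"
proof -
  have con: "connected (UNIV :: 'm set)" by (rule simply_connected_imp_connected_UNIV[OF sc])
  have "\<forall>k. \<exists>f. special_function UNIV f \<and> (\<forall>v. differential A (Re \<circ> f) p0 v = \<beta> k v)"
    using special_function_exists[OF sc \<beta>] by metis
  from choice[OF this] obtain F where F: "\<And>k. special_function UNIV (F k)"
    "\<And>k v. differential A (Re \<circ> F k) p0 v = \<beta> k v" by blast
  define \<phi> where "\<phi> q = (\<chi> k. F k q)" for q
  have \<phi>: "special_map \<phi>" unfolding special_map_def \<phi>_def using F(1) by simp
  have re: "re_diff A \<phi> p0 v = (\<chi> k. \<beta> k v)" for v
    using special_map_differential(2)[OF \<phi>, of p0 v] F(2) by (simp add: vec_eq_iff \<phi>_def)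
  have lin0: "linear (\<lambda>v. (\<chi> k. \<beta> k v) :: real ^ ('n + 'n))"
    by (rule linearI) (simp_all add: vec_eq_iff linear_add[OF \<beta>] linear_cmul[OF \<beta>])
  have surj0: "surj (\<lambda>v. (\<chi> k. \<beta> k v) :: real ^ ('n + 'n))" by (rule linear_inj_imp_surj_DIM[OF lin0 inj DIM_complex_real_sum])
  have "inj (re_diff A \<phi> p)" for p
  proof (rule linear_surj_imp_inj_DIM[OF special_map_differential(5)[OF \<phi>] _ DIM_complex_real_sum])
    have "span (range (re_diff A \<phi> p)) = UNIV"
    proof (rule ccontr)
      assume "span (range (re_diff A \<phi> p)) \<noteq> UNIV"
      then obtain l where l: "l \<noteq> 0" "span (range (re_diff A \<phi> p)) \<subseteq> {x. l \<bullet> x = 0}"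
        using span_not_univ_subset_hyperplane by blast
      then have "l \<bullet> re_diff A \<phi> p v = 0" for v using span_base[of "re_diff A \<phi> p v"] by blast
      then have zero: "differential A (Re \<circ> (\<lambda>q. \<Sum>k\<in>UNIV. of_real (l $ k) * \<phi> q $ k)) p v = 0" for v
        using special_map_combination(2)[OF \<phi>] by simp
      let ?f = "\<lambda>q. \<Sum>k\<in>UNIV. of_real (l $ k) * \<phi> q $ k"
      have const: "?f q = ?f p" for q
        by (rule special_function_constant[OF con special_map_combination(1)[OF \<phi>] zero])
      \<comment> \<open>A constant combination has zero differential at p0 too, so l is orthogonal
        to the range there, which is everything; hence l = 0.\<close>
      have "differential A (Re \<circ> ?f) p0 = differential A (\<lambda>q. Re (?f p)) p0"
        by (rule differential_cong[OF open_UNIV UNIV_I]) (unfold comp_def, rule arg_cong[where f=Re, OF const])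
      then have "l \<bullet> re_diff A \<phi> p0 v = 0" for v
        using special_map_combination(2)[OF \<phi>, of l p0 v] differential_const[of "Re (?f p)" p0 v] by simp
      moreover obtain v where "l = (\<chi> k. \<beta> k v)" using surj0 by (rule surjE)
      ultimately have "l \<bullet> l = 0" using re by metis
      then show False using l(1) by simp
    qed
    moreover have "subspace (range (re_diff A \<phi> p))"
      by (rule linear_subspace_image[OF special_map_differential(5)[OF \<phi>] subspace_UNIV])
    ultimately show "surj (re_diff A \<phi> p)" by (metis span_eq_iff)
  qed
  then show ?thesis using that \<phi> re special_complex_realisation_iff by blast
qed

text \<open>M is the quotient of the two isomorphisms Re d\<psi> and Re d\<phi> at the single point
  p. Each component of \<psi> - M \<phi> is a special function whose real part has zero differential
  at p, hence a constant; these constants form b.\<close>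

lemma special_map_unique:
  assumes con: "connected (UNIV :: 'm set)" and \<phi>: "special_complex_realisation A D \<phi>"
    and \<psi>: "special_complex_realisation A D \<psi>"
  obtains M b where "invertible (M :: real ^ ('n + 'n) ^ ('n + 'n))"
    "\<And>v. re_diff A \<psi> p v = M *v re_diff A \<phi> p v" "\<psi> = (\<lambda>v. complex_matrix M *v v + b) \<circ> \<phi>"
proof -
  have s: "special_map \<phi>" "special_map \<psi>" and inj: "inj (re_diff A \<phi> p)" "inj (re_diff A \<psi> p)"
    using \<phi> \<psi> special_complex_realisation_iff by blast+
  note l\<phi> = special_map_differential(5)[OF s(1), of p] and l\<psi> = special_map_differential(5)[OF s(2), of p]
  obtain g where g: "linear g" "\<And>x. g (re_diff A \<phi> p x) = x" "\<And>y. re_diff A \<phi> p (g y) = y"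
    using linear_inj_isomorphism_DIM[OF l\<phi> inj(1) DIM_complex_real_sum] by blast
  obtain h where h: "linear h" "\<And>x. h (re_diff A \<psi> p x) = x" "\<And>y. re_diff A \<psi> p (h y) = y"
    using linear_inj_isomorphism_DIM[OF l\<psi> inj(2) DIM_complex_real_sum] by blast
  let ?L = "\<lambda>y. re_diff A \<psi> p (g y)" and ?N = "\<lambda>y. re_diff A \<phi> p (h y)"
  have L: "linear ?L" "linear ?N"
    using linear_compose[OF g(1) l\<psi>] linear_compose[OF h(1) l\<phi>] by (simp_all add: comp_def)
  define M where "M = matrix ?L"
  have Mv: "M *v y = ?L y" for y
    unfolding M_def by (rule matrix_works) (use L(1) in \<open>simp add: linear_matrix_vector_mul_eq\<close>)
  have one: "matrix (\<lambda>y::real ^ ('n + 'n). y) = mat 1"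
    by (simp add: matrix_def mat_def axis_def vec_eq_iff)
  have "M ** matrix ?N = mat 1" "matrix ?N ** M = mat 1"
    unfolding M_def using matrix_compose[OF L(2,1)] matrix_compose[OF L(1,2)] g h
    by (simp_all add: comp_def one)
  then have inv: "invertible M" unfolding invertible_def by blast
  have reM: "re_diff A \<psi> p v = M *v re_diff A \<phi> p v" for v unfolding Mv by (simp add: g(2))
  define F where "F j q = \<psi> q $ j - (\<Sum>k\<in>UNIV. of_real (M $ j $ k) * \<phi> q $ k)" for j q
  have F: "F j q = F j p" for j q
  proof -
    \<comment> \<open>\<open>None\<close> stands for the component j of \<psi>, with coefficient
      1.\<close>
    let ?a = "\<lambda>i. case i of None \<Rightarrow> 1 | Some k \<Rightarrow> - M $ j $ k"
    let ?f = "\<lambda>i q. case i of None \<Rightarrow> \<psi> q $ j | Some k \<Rightarrow> \<phi> q $ k"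
    have f: "special_function UNIV (?f i)" for i
      using s unfolding special_map_def by (cases i) auto
    have Feq: "F j = (\<lambda>q. \<Sum>i\<in>UNIV. of_real (?a i) * ?f i q)"
      by (simp add: F_def fun_eq_iff sum_UNIV_option sum_negf)
    have sF: "special_function UNIV (F j)"
      unfolding Feq by (rule special_function_lincomb(1)) (use f in auto)
    have "differential A (Re \<circ> F j) p v = 0" for v
    proof -
      have "differential A (F j) p v = (\<Sum>i\<in>UNIV. of_real (?a i) * differential A (?f i) p v)"
        unfolding Feq by (rule special_function_lincomb(2)) (use f in auto)
      also have "\<dots> = differential A \<psi> p v $ j - (\<Sum>k\<in>UNIV. of_real (M $ j $ k) * differential A \<phi> p v $ k)"
        by (simp add: sum_UNIV_option sum_negf special_map_differential(1)[OF s(1)] special_map_differential(1)[OF s(2)])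
      finally have "Re (differential A (F j) p v) = re_diff A \<psi> p v $ j - (M *v re_diff A \<phi> p v) $ j"
        by (simp add: re_diff_def matrix_vector_mult_def Re_sum)
      then show ?thesis
        unfolding special_function_differential(4)[OF chart_at sF UNIV_I] reM by simp
    qed
    then show ?thesis using special_function_constant[OF con sF] by blast
  qed
  have "\<psi> = (\<lambda>v. complex_matrix M *v v + (\<chi> j. F j p)) \<circ> \<phi>"
  proof
    fix q
    have "\<psi> q $ j = (\<Sum>k\<in>UNIV. of_real (M $ j $ k) * \<phi> q $ k) + F j p" for j
      using F[of j q] by (simp add: F_def algebra_simps)
    then show "\<psi> q = ((\<lambda>v. complex_matrix M *v v + (\<chi> j. F j p)) \<circ> \<phi>) q"
      by (simp add: vec_eq_iff complex_matrix_def matrix_vector_mult_def)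
  qed
  then show ?thesis using that[OF inv reM] by blast
qed

end

section \<open>Realisations\<close>

lemma linear_real_\<Omega>: "linear (real_\<Omega> s)" "linear (\<lambda>s. real_\<Omega> s t)"
  by (rule linearI; simp add: real_\<Omega>_def sum.distrib[symmetric] sum_distrib_left algebra_simps)+

lemma \<Omega>_\<tau>: "\<Omega> (\<tau> u) (\<tau> v) = cnj (\<Omega> u v)"
  by (simp add: \<Omega>_def \<tau>_def cnj_sum)

text \<open>If w = d\<phi>(u) is fixed by \<tau>, then \<gamma>(w, d\<phi>(v)) is i times the
  conjugate of \<Omega>(w, d\<phi>(v)), which is 0 for a Lagrangian map; so u = 0.\<close>

lemma lagrangian_nondegenerate_imp_totally_complex:
  assumes lin: "\<And>p. linear (differential A \<phi> p)" and lag: "lagrangian A \<phi>" and nd: "nondegenerate A \<phi>"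
  shows "totally_complex A \<phi>"
  unfolding totally_complex_def
proof (intro allI equalityI subsetI)
  fix p w assume "w \<in> {v. \<tau> v = v} \<inter> range (differential A \<phi> p)"
  then obtain u where u: "w = differential A \<phi> p u" "\<tau> w = w" by auto
  have "\<gamma> (differential A \<phi> p u) (differential A \<phi> p v) = 0" for v
  proof -
    have "\<gamma> w (differential A \<phi> p v) = \<i> * \<Omega> (\<tau> w) (\<tau> (differential A \<phi> p v))" by (simp only: \<gamma>_def u(2))
    also have "\<dots> = 0" using lag by (simp add: \<Omega>_\<tau> u(1) lagrangian_def)
    finally show ?thesis by (simp only: u(1))
  qed
  then have "u = 0" using nd unfolding nondegenerate_def by blast
  then show "w \<in> {0}" using u(1) linear_0[OF lin] by simp
next
  fix p and w :: "complex ^ ('b + 'b)" assume "w \<in> {0}"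
  then have "w = differential A \<phi> p 0" "\<tau> w = w" using linear_0[OF lin] by (simp_all add: \<tau>_def vec_eq_iff)
  then show "w \<in> {v. \<tau> v = v} \<inter> range (differential A \<phi> p)" by blast
qed

context flat_special
begin

text \<open>The induced form is a constant combination of products of the parallel one-forms d(x^i
  \<circ> \<phi>) and d(y_i \<circ> \<phi>), hence smooth and parallel. Nondegeneracy comes from the
  real form because \<open>re_diff\<close> is an isomorphism.\<close>

lemma realisation_symplectic:
  assumes \<phi>: "special_complex_realisation A D \<phi>"
  shows "special_symplectic_manifold A D (induced_form2 A \<phi>)"
proof -
  have s: "special_map \<phi>" and inj: "\<And>p. inj (re_diff A \<phi> p)"
    using \<phi> special_complex_realisation_iff by blast+
  have f: "special_function UNIV (\<lambda>q. \<phi> q $ k)" for k using s unfolding special_map_def by blast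
  note R = special_map_differential(5)[OF s]
  let ?\<omega> = "induced_form2 A \<phi>"
  define r where "r k X q = differential A (Re \<circ> (\<lambda>q. \<phi> q $ k)) q (X q)" for k and X :: "'m \<Rightarrow> complex ^ 'n" and q
  have \<omega>_eq: "?\<omega> q (X q) (Y q) = 2 * (\<Sum>i\<in>UNIV. r (Inl i) X q * r (Inr i) Y q - r (Inl i) Y q * r (Inr i) X q)" for X Y q
    by (simp add: induced_form2_re_diff real_\<Omega>_def special_map_differential(2)[OF s] r_def)
  have bil: "bilinear (?\<omega> p)" for p
    unfolding bilinear_def induced_form2_re_diff real_scaleR_def[symmetric]
    by (intro conjI allI linear_compose_scale_right
        linear_compose[OF R linear_real_\<Omega>(1), unfolded comp_def] linear_compose[OF R linear_real_\<Omega>(2), unfolded comp_def])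
  have alt: "?\<omega> p v v = 0" for p v by (simp add: induced_form2_re_diff real_\<Omega>_def)
  have Ck: "C_k_on j (snd c ` (fst c \<inter> U)) (r k X \<circ> inv_chart c)"
    if "c \<in> A" "open U" "vector_field_on A U X" for c U X j k
    using C_k_on_special_function_differential[OF that(1,2) f that(3)] unfolding r_def .
  have smooth: "smooth_form2 A ?\<omega>"
    unfolding smooth_form2_def smooth_map_on_def smooth_on_def
  proof (intro conjI allI impI ballI bil alt)
    fix U X Y c j
    assume U: "open U" and X: "vector_field_on A U X" and Y: "vector_field_on A U Y" and c: "c \<in> A"
    let ?S = "snd c ` (fst c \<inter> U)"
    note S = open_image[OF c U]
    have prod: "C_k_on j ?S (\<lambda>x. r k Z (inv_chart c x) * r l W (inv_chart c x))"
      if "vector_field_on A U Z" "vector_field_on A U W" for k l Z W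
      using C_k_on_scaleR[OF S Ck[OF c U that(1)] Ck[OF c U that(2)]] by (simp add: comp_def)
    show "C_k_on j ?S ((\<lambda>p. ?\<omega> p (X p) (Y p)) \<circ> inv_chart c)"
      unfolding comp_def \<omega>_eq
      by (intro C_k_on_bounded_linear[OF S bounded_linear_mult_right] C_k_on_sum[OF S] C_k_on_diff[OF S] prod X Y)
  qed
  have parallel: "parallel_form2 A D ?\<omega>"
    unfolding parallel_form2_def
  proof (intro allI impI ballI)
    fix U X Y Z p
    assume U: "open U" and X: "vector_field_on A U X" and Y: "vector_field_on A U Y" and Z: "vector_field_on A U Z"
      and p: "p \<in> U"
    let ?c = "chart_at A p"
    let ?x = "snd ?c p"
    let ?r' = "\<lambda>k Y. frechet_derivative (r k Y \<circ> inv_chart ?c) (at ?x)"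
    have D: "((r k W \<circ> inv_chart ?c) has_derivative ?r' k W) (at ?x)" if "vector_field_on A U W" for k W
      by (rule C_k_on_Suc_has_derivative[OF Ck[OF chart_at(1) U that, of "Suc 0"]]) (use chart_at(2) p in simp)
    have deriv: "deriv_along A X (r k W) p = differential A (Re \<circ> (\<lambda>q. \<phi> q $ k)) p (cov_deriv D X W p)"
      if "vector_field_on A U W" for k W
      using special_function_affine[OF f U subset_UNIV X that p] unfolding r_def .
    note r' = deriv_along_eq[OF chart_at D, of _ X]
    have prod: "((\<lambda>x. r k V (inv_chart ?c x) * r l W (inv_chart ?c x)) has_derivative
        (\<lambda>v. r k V p * ?r' l W v + ?r' k V v * r l W p)) (at ?x)"
      if "vector_field_on A U V" "vector_field_on A U W" for k l V W
      using has_derivative_mult[OF D[OF that(1)] D[OF that(2)]] chart_at by (simp add: comp_def)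
    have "((\<lambda>q. ?\<omega> q (Y q) (Z q)) \<circ> inv_chart ?c has_derivative (\<lambda>v. 2 * (\<Sum>i\<in>UNIV.
        (r (Inl i) Y p * ?r' (Inr i) Z v + ?r' (Inl i) Y v * r (Inr i) Z p) -
        (r (Inl i) Z p * ?r' (Inr i) Y v + ?r' (Inl i) Z v * r (Inr i) Y p)))) (at ?x)"
      unfolding comp_def \<omega>_eq
      by (intro has_derivative_mult_right has_derivative_sum has_derivative_diff)
         (rule prod[OF Y Z, unfolded comp_def] prod[OF Z Y, unfolded comp_def])+
    from deriv_along_eq[OF chart_at this, of X]
    have "deriv_along A X (\<lambda>q. ?\<omega> q (Y q) (Z q)) p = 2 * (\<Sum>i\<in>UNIV.
        (r (Inl i) Y p * deriv_along A X (r (Inr i) Z) p + deriv_along A X (r (Inl i) Y) p * r (Inr i) Z p) -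
        (r (Inl i) Z p * deriv_along A X (r (Inr i) Y) p + deriv_along A X (r (Inl i) Z) p * r (Inr i) Y p))"
      unfolding r'[OF Y] r'[OF Z] .
    also have "\<dots> = ?\<omega> p (cov_deriv D X Y p) (Z p) + ?\<omega> p (Y p) (cov_deriv D X Z p)"
      unfolding deriv[OF Y] deriv[OF Z] induced_form2_re_diff real_\<Omega>_def special_map_differential(2)[OF s] r_def
      by (simp add: distrib_left[symmetric] sum.distrib[symmetric] algebra_simps)
    finally show "cov_deriv_form2 A D ?\<omega> X Y Z p = 0" unfolding cov_deriv_form2_def by simp
  qed
  have "u = 0" if u: "\<forall>v. ?\<omega> p u v = 0" for p u
  proof -
    have "re_diff A \<phi> p u = 0"
    proof (rule real_\<Omega>_nondegenerate)
      fix t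
      obtain v where "t = re_diff A \<phi> p v" using linear_inj_imp_surj_DIM[OF R inj DIM_complex_real_sum] by (rule surjE)
      then show "real_\<Omega> (re_diff A \<phi> p u) t = 0" using u by (simp add: induced_form2_re_diff)
    qed
    then show ?thesis using linear_injective_0[OF R] inj by blast
  qed
  then have "symplectic_form A ?\<omega>"
    unfolding symplectic_form_def using smooth parallel_imp_closed[OF parallel bil alt] by blast
  then show ?thesis unfolding special_symplectic_manifold_def using special parallel by blast
qed

lemma complex_realisation_exists:
  assumes "simply_connected (UNIV :: 'm set)"
  shows "\<exists>\<phi>. special_complex_realisation A D \<phi>"
proof -
  \<comment> \<open>Without a form to match, any basis of real functionals will do; real and
    imaginary parts of the coordinates are taken.\<close>
  let ?\<beta> = "\<lambda>k v. case k of Inl i \<Rightarrow> Re (v $ i) | Inr i \<Rightarrow> Im (v $ i :: complex)"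
  have \<beta>: "linear (?\<beta> k)" for k :: "'n + 'n" by (rule linearI) (simp_all split: sum.split)
  have "inj (\<lambda>v. (\<chi> k. ?\<beta> k v) :: real ^ ('n + 'n))"
  proof (rule injI)
    fix u v :: "complex ^ 'n"
    assume "(\<chi> k. ?\<beta> k u) = (\<chi> k. ?\<beta> k v)"
    then have e: "?\<beta> k u = ?\<beta> k v" for k by (simp add: vec_eq_iff)
    show "u = v" using e[of "Inl _"] e[of "Inr _"] by (simp add: vec_eq_iff complex_eq_iff)
  qed
  from special_map_exists[OF assms \<beta> this] show ?thesis by blast
qed

lemma complex_realisation_unique:
  assumes "simply_connected (UNIV :: 'm set)"
    and "special_complex_realisation A D \<phi>" "special_complex_realisation A D \<psi>"
  shows "\<exists>F. affine_transformation F \<and> preserves_real_structure F \<and> \<psi> = F \<circ> \<phi>"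
proof -
  obtain M b where "invertible (M :: real ^ ('n + 'n) ^ ('n + 'n))" 
      "\<And>v. re_diff A \<psi> undefined v = M *v re_diff A \<phi> undefined v" "\<psi> = (\<lambda>v. complex_matrix M *v v + b) \<circ> \<phi>"
    by (rule special_map_unique[OF simply_connected_imp_connected_UNIV[OF assms(1)] assms(2,3)])
      (rule that, assumption, blast, assumption)
  then show ?thesis using affine_complex_matrix(1,2) by blast
qed

lemma symplectic_realisation_exists:
  assumes sc: "simply_connected (UNIV :: 'm set)" and \<omega>: "special_symplectic_manifold A D \<omega>"
  shows "\<exists>\<phi>. special_symplectic_realisation A D \<omega> \<phi>"
proof -
  have sm: "smooth_form2 A \<omega>" and par: "parallel_form2 A D \<omega>" and nd: "\<And>p u. (\<forall>v. \<omega> p u v = 0) \<Longrightarrow> u = 0"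
    using \<omega> unfolding special_symplectic_manifold_def symplectic_form_def by blast+
  have bil: "bilinear (\<omega> p)" "\<omega> p v v = 0" for p v using sm unfolding smooth_form2_def by blast+
  \<comment> \<open>An arbitrary base point; types are inhabited.\<close>
  define p0 :: 'm where "p0 = undefined"
  obtain \<beta> :: "'n + 'n \<Rightarrow> complex ^ 'n \<Rightarrow> real" where \<beta>: "\<And>k. linear (\<beta> k)"
    "\<And>u v. \<omega> p0 u v = 2 * (\<Sum>i\<in>UNIV. \<beta> (Inl i) u * \<beta> (Inr i) v - \<beta> (Inl i) v * \<beta> (Inr i) u)"
    using darboux_basis[OF bil] by blast
  have lin: "linear (\<lambda>v. (\<chi> k. \<beta> k v) :: real ^ ('n + 'n))"
    by (rule linearI) (simp_all add: vec_eq_iff linear_add[OF \<beta>(1)] linear_cmul[OF \<beta>(1)])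
  \<comment> \<open>A vector killed by all \<beta> lies in the radical of \<omega>, which is
    trivial; so the \<beta> form a basis of the dual space.\<close>
  have "inj (\<lambda>v. (\<chi> k. \<beta> k v) :: real ^ ('n + 'n))"
  proof (subst linear_injective_0[OF lin], intro allI impI)
    fix u assume "(\<chi> k. \<beta> k u) = (0 :: real ^ ('n + 'n))"
    then have "\<beta> k u = 0" for k by (simp add: vec_eq_iff)
    then have "\<forall>v. \<omega> p0 u v = 0" by (simp add: \<beta>(2))
    then show "u = 0" by (rule nd)
  qed
  then obtain \<phi> where \<phi>: "special_complex_realisation A D \<phi>" "\<And>v. re_diff A \<phi> p0 v = (\<chi> k. \<beta> k v)"
    using special_map_exists[where \<beta>=\<beta> and ?p0.0=p0, OF sc \<beta>(1)] by blast
  have "smooth_form2 A (induced_form2 A \<phi>)" "parallel_form2 A D (induced_form2 A \<phi>)"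
    using realisation_symplectic[OF \<phi>(1)] unfolding special_symplectic_manifold_def symplectic_form_def by blast+
  then have "\<omega> = induced_form2 A \<phi>"
    by (rule parallel_form_unique[OF simply_connected_imp_connected_UNIV[OF sc] sm par, where ?p0.0=p0])
       (simp add: induced_form2_re_diff real_\<Omega>_def \<phi>(2) \<beta>(2))
  then show ?thesis using \<phi>(1) unfolding special_symplectic_realisation_def by blast
qed

lemma symplectic_realisation_unique:
  assumes sc: "simply_connected (UNIV :: 'm set)"
    and \<phi>: "special_symplectic_realisation A D \<omega> \<phi>" and \<psi>: "special_symplectic_realisation A D \<omega> \<psi>"
  shows "\<exists>F. affine_transformation F \<and> preserves_symplectic_form F \<and> preserves_real_structure F \<and> \<psi> = F \<circ> \<phi>"
proof -
  have r: "special_complex_realisation A D \<phi>" "special_complex_realisation A D \<psi>"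
    and eq: "induced_form2 A \<psi> = induced_form2 A \<phi>"
    using \<phi> \<psi> unfolding special_symplectic_realisation_def by auto
  define p :: 'm where "p = undefined"
  obtain M b where M: "invertible (M :: real ^ ('n + 'n) ^ ('n + 'n))"
    "\<And>v. re_diff A \<psi> p v = M *v re_diff A \<phi> p v" "\<psi> = (\<lambda>v. complex_matrix M *v v + b) \<circ> \<phi>"
    by (rule special_map_unique[OF simply_connected_imp_connected_UNIV[OF sc] r, of p]) (rule that, assumption, blast, assumption)
  have s: "special_map \<phi>" "inj (re_diff A \<phi> p)" using r(1) special_complex_realisation_iff by blast+
  \<comment> \<open>Both maps induce the same form at p, and every t is a value of
    \<open>re_diff A \<phi> p\<close>; so M is symplectic on the whole space.\<close>
  have "real_\<Omega> (M *v t) (M *v t') = real_\<Omega> t t'" for t t'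
  proof -
    have surj: "surj (re_diff A \<phi> p)"
      by (rule linear_inj_imp_surj_DIM[OF special_map_differential(5)[OF s(1)] s(2) DIM_complex_real_sum])
    obtain u where u: "t = re_diff A \<phi> p u" using surj by (rule surjE)
    obtain v where v: "t' = re_diff A \<phi> p v" using surj by (rule surjE)
    have "induced_form2 A \<psi> p u v = induced_form2 A \<phi> p u v" by (simp only: eq)
    then show ?thesis by (simp add: induced_form2_re_diff M(2) u v)
  qed
  then show ?thesis using affine_complex_matrix[OF M(1)] M(3) by blast
qed

text \<open>The real part of d\<phi>(v) and its imaginary part - Re d\<phi>(J v) are both given by
  \<open>re_diff\<close>, so \<Omega> and \<gamma> on the image are expressed through \<omega> and
  J. Invariance under J cancels the terms of \<Omega> and doubles those of \<gamma>.\<close>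

lemma symplectic_realisation_kaehler:
  assumes \<phi>: "special_symplectic_realisation A D \<omega> \<phi>" and inv: "\<And>p u v. \<omega> p (J u) (J v) = \<omega> p u v"
  shows "special_kaehler_realisation A D \<omega> \<phi>" and "totally_complex A \<phi>"
proof -
  have r: "special_complex_realisation A D \<phi>" and \<omega>: "\<omega> = induced_form2 A \<phi>"
    using \<phi> unfolding special_symplectic_realisation_def by blast+
  have s: "special_map \<phi>" and inj: "\<And>p. inj (re_diff A \<phi> p)" using r special_complex_realisation_iff by blast+
  note d = special_map_differential(3)[OF s] and R = special_map_differential(5)[OF s]
  let ?R = "re_diff A \<phi>"
  have J1: "real_\<Omega> (?R p (J u)) (?R p (J v)) = real_\<Omega> (?R p u) (?R p v)" for p u v
    using inv[of p u v] by (simp add: \<omega> induced_form2_re_diff)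
  have J2: "real_\<Omega> (?R p u) (?R p (J v)) = - real_\<Omega> (?R p (J u)) (?R p v)" for p u v
  proof -
    have "?R p (J (J v)) = - ?R p v" using linear_neg[OF R] by simp
    then show ?thesis using J1[of p u "J v"] by (simp add: real_\<Omega>_minus)
  qed
  have lag: "lagrangian A \<phi>"
    unfolding lagrangian_def
  proof (intro allI)
    fix p u v
    show "\<Omega> (differential A \<phi> p u) (differential A \<phi> p v) = 0"
      unfolding d \<Omega>_complex_of_reals using J1[of p u v] J2[of p u v] by (simp add: real_\<Omega>_minus complex_eq_iff)
  qed
  \<comment> \<open>As \<omega> is twice the real form, the real part is \<omega>(J u, v) and the
    imaginary part is \<omega>(u, v); the latter gives nondegeneracy.\<close>
  have \<gamma>: "\<gamma> (differential A \<phi> p u) (differential A \<phi> p v) =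
      2 * Complex (real_\<Omega> (?R p (J u)) (?R p v)) (real_\<Omega> (?R p u) (?R p v))" for p u v
    unfolding \<gamma>_def d \<tau>_complex_of_reals \<Omega>_complex_of_reals
    using J1[of p u v] J2[of p u v] by (simp add: real_\<Omega>_minus complex_eq_iff)
  have nd: "nondegenerate A \<phi>"
    unfolding nondegenerate_def
  proof (intro allI impI)
    fix p u assume "\<forall>v. \<gamma> (differential A \<phi> p u) (differential A \<phi> p v) = 0"
    then have "\<omega> p u v = 0" for v by (simp add: \<gamma> \<omega> induced_form2_re_diff complex_eq_iff)
    then show "u = 0"
      using realisation_symplectic[OF r] unfolding special_symplectic_manifold_def symplectic_form_def \<omega> by blast
  qed
  have "special_kaehler_metric \<omega> = induced_metric A \<phi>"
    by (intro ext) (simp add: special_kaehler_metric_def induced_metric_def \<gamma> \<omega> induced_form2_re_diff)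
  then show "special_kaehler_realisation A D \<omega> \<phi>"
    unfolding special_kaehler_realisation_def using r lag nd \<omega> unfolding special_complex_realisation_def by blast
  show "totally_complex A \<phi>" using r unfolding special_complex_realisation_def by blast
qed

text \<open>Reduces uniqueness in the Kaehler case to the symplectic case; total complexity is
  recovered from the Lagrangian and nondegeneracy conditions.\<close>

lemma kaehler_realisation_symplectic:
  assumes "special_kaehler_realisation A D \<omega> \<phi>"
  shows "special_symplectic_realisation A D \<omega> \<phi>"
proof -
  have r: "holomorphic_map A \<phi>" "immersion A \<phi>" "nondegenerate A \<phi>" "lagrangian A \<phi>" "induces_connection A \<phi> D"
    "\<omega> = induced_form2 A \<phi>"
    using assms unfolding special_kaehler_realisation_def by blast+
  have "special_map \<phi>" using r special_map_iff by blast
  then have "totally_complex A \<phi>"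
    by (intro lagrangian_nondegenerate_imp_totally_complex special_map_differential(4) r)
  then show ?thesis
    unfolding special_symplectic_realisation_def special_complex_realisation_def using r by blast
qed

end

theorem theorem4:
  fixes A :: "('m::{t2_space, second_countable_topology}, 'n::finite) chart set"
    and D :: "('m, 'n) conn"
    and \<omega> :: "('m, 'n) form2"
  assumes sc: "simply_connected (UNIV :: 'm set)"
  shows
   "(special_complex_manifold A D \<longrightarrow>
       (\<exists>\<phi>. special_complex_realisation A D \<phi>) \<and>
       (\<forall>\<phi> \<psi>. special_complex_realisation A D \<phi> \<and> special_complex_realisation A D \<psi> \<longrightarrow>
          (\<exists>F. affine_transformation F \<and> preserves_real_structure F \<and> \<psi> = F \<circ> \<phi>)) \<and>
       (\<forall>\<phi>. special_complex_realisation A D \<phi> \<longrightarrow>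
          special_symplectic_manifold A D (induced_form2 A \<phi>)))
    \<and>
    (special_symplectic_manifold A D \<omega> \<longrightarrow>
       (\<exists>\<phi>. special_symplectic_realisation A D \<omega> \<phi>) \<and>
       (\<forall>\<phi> \<psi>. special_symplectic_realisation A D \<omega> \<phi> \<and> special_symplectic_realisation A D \<omega> \<psi> \<longrightarrow>
          (\<exists>F. affine_transformation F \<and> preserves_symplectic_form F \<and> preserves_real_structure F \<and>
               \<psi> = F \<circ> \<phi>)))
    \<and>
    (special_kaehler_manifold A D \<omega> \<longrightarrow>
       (\<exists>\<phi>. special_kaehler_realisation A D \<omega> \<phi> \<and> totally_complex A \<phi>) \<and>
       (\<forall>p u v. \<omega> p u v = special_kaehler_metric \<omega> p u (J v)) \<and>
       (\<forall>\<phi> \<psi>. special_kaehler_realisation A D \<omega> \<phi> \<and> special_kaehler_realisation A D \<omega> \<psi> \<longrightarrow>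
          (\<exists>F. affine_transformation F \<and> preserves_symplectic_form F \<and> preserves_real_structure F \<and>
               \<psi> = F \<circ> \<phi>)))"
proof (intro conjI impI allI)
  assume "special_complex_manifold A D"
  then interpret flat_special A D
    by unfold_locales (simp_all add: special_complex_manifold_def)
  show "\<exists>\<phi>. special_complex_realisation A D \<phi>"
    by (rule complex_realisation_exists[OF sc])
  show "\<exists>F. affine_transformation F \<and> preserves_real_structure F \<and> \<psi> = F \<circ> \<phi>"
    if "special_complex_realisation A D \<phi> \<and> special_complex_realisation A D \<psi>" for \<phi> \<psi>
    using complex_realisation_unique[OF sc] that by blast
  show "special_symplectic_manifold A D (induced_form2 A \<phi>)" if "special_complex_realisation A D \<phi>" for \<phi>
    by (rule realisation_symplectic[OF that])
next
  assume \<omega>: "special_symplectic_manifold A D \<omega>"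
  then interpret flat_special A D
    by unfold_locales (simp_all add: special_symplectic_manifold_def special_complex_manifold_def)
  show "\<exists>\<phi>. special_symplectic_realisation A D \<omega> \<phi>"
    by (rule symplectic_realisation_exists[OF sc \<omega>])
  show "\<exists>F. affine_transformation F \<and> preserves_symplectic_form F \<and> preserves_real_structure F \<and> \<psi> = F \<circ> \<phi>"
    if "special_symplectic_realisation A D \<omega> \<phi> \<and> special_symplectic_realisation A D \<omega> \<psi>" for \<phi> \<psi>
    using symplectic_realisation_unique[OF sc] that by blast
next
  assume "special_kaehler_manifold A D \<omega>"
  then have \<omega>: "special_symplectic_manifold A D \<omega>" and inv: "\<And>p u v. \<omega> p (J u) (J v) = \<omega> p u v"
    unfolding special_kaehler_manifold_def by blast+
  from \<omega> interpret flat_special A D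
    by unfold_locales (simp_all add: special_symplectic_manifold_def special_complex_manifold_def)
  show "\<exists>\<phi>. special_kaehler_realisation A D \<omega> \<phi> \<and> totally_complex A \<phi>"
    using symplectic_realisation_exists[OF sc \<omega>] symplectic_realisation_kaehler[where \<omega>=\<omega>, OF _ inv] by blast
  show "\<omega> p u v = special_kaehler_metric \<omega> p u (J v)" for p u v
    by (simp add: special_kaehler_metric_def inv)
  show "\<exists>F. affine_transformation F \<and> preserves_symplectic_form F \<and> preserves_real_structure F \<and> \<psi> = F \<circ> \<phi>"
    if "special_kaehler_realisation A D \<omega> \<phi> \<and> special_kaehler_realisation A D \<omega> \<psi>" for \<phi> \<psi>
    using symplectic_realisation_unique[OF sc] kaehler_realisation_symplectic that by blast
qed

end
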